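(* The affine connection $\nabla^{\mathrm{cv}}$ on $\Omega$ is flat (has zero curvature) and has nonzero torsion. For every $x,y\in\Omega$, the Cholesky-Vinberg path $\gamma^{\mathrm{cv}}_{x,y}(t)=\Phi\bigl(T_x(T_x^{-1}T_y)^t\bigr)$, $0\le t\le 1$, is the unique (affinely parametrized on $[0,1]$) $\nabla^{\mathrm{cv}}$-geodesic joining $x$ to $y$, and its midpoint is the Cholesky-Vinberg mean, $x\,\#_{\mathrm{cv}}\,y=\gamma^{\mathrm{cv}}_{x,y}(1/2)$.
   Context: Let $V\subset \mathrm{Sym}(3,\mathbb{R})$ be the 5-dimensional space of real symmetric $3\times3$ matrices whose $(1,2)$ and $(2,1)$ entries are $0$, and let $\Omega\subset V$ be the open cone of positive definite matrices in $V$. Let $H$ be the Lie group of real lower triangular $3\times 3$ matrices with positive diagonal entries and zero $(2,1)$ entry, with Lie algebra $\mathfrak{h}$ the lower triangular $3\times3$ matrices with zero $(2,1)$ entry. The map $\Phi:H\to\Omega$, $\Phi(T)=TT^{\top}$, is a diffeomorphism; $T_x:=\Phi^{-1}(x)\in H$. For $T\in H$ and $t\in\mathbb{R}$, $T^t:=\exp(t\log T)\in H$, with the principal matrix logarithm. The Cholesky-Vinberg mean is $x\,\#_{\mathrm{cv}}\,y:=\Phi\bigl(T_x(T_x^{-1}T_y)^{1/2}\bigr)$. For $A\in\mathfrak h$ let $E^\ell_A(T)=TA$ be the corresponding left-invariant vector field on $H$. Let $\nabla^{H,\ell}$ be the unique left-invariant affine connection on $H$ with $\nabla^{H,\ell}_{E^\ell_A}E^\ell_B=0$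 for all $A,B\in\mathfrak h$, and let $\nabla^{\mathrm{cv}}$ be its pushforward to $\Omega$: $\nabla^{\mathrm{cv}}_UW:=\Phi_*\bigl(\nabla^{H,\ell}_{\Phi_*^{-1}U}\Phi_*^{-1}W\bigr)$ for vector fields $U,W$ on $\Omega$. *)

theory Defs
  imports "HOL-Analysis.Analysis"
begin

text \<open>
  Both \<open>H\<close> and \<open>\<Omega>\<close> are relatively open subsets of a linear subspace of the space of matrices
  (of \<open>\<hh>\<close> and of \<open>V\<close>, respectively). The calculus below is therefore that of a
  set \<open>M\<close> which is open in a finite-dimensional linear subspace \<open>E\<close>; the tangent space of \<open>M\<close> at
  each point is \<open>E\<close>.
\<close>

subsection \<open>Smooth functions and vector fields\<close>

definition dirderiv :: "('a::real_normed_vector \<Rightarrow> 'b::real_normed_vector) \<Rightarrow> 'a \<Rightarrow> 'a \<Rightarrow> 'b" where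
  "dirderiv f x v = vector_derivative (\<lambda>t::real. f (x + t *\<^sub>R v)) (at 0)"

text \<open>Directions are restricted to \<open>E\<close>: for \<open>x \<in> M\<close> and \<open>v \<in> E\<close>, \<open>x + t v\<close> remains in \<open>M\<close> for
  small \<open>t\<close>, so that only the values of \<open>f\<close> on \<open>M\<close> matter.\<close>

primrec Ck_on :: "nat \<Rightarrow> 'a::real_normed_vector set \<Rightarrow> 'a set \<Rightarrow> ('a \<Rightarrow> 'b::real_normed_vector) \<Rightarrow> bool" where
  "Ck_on 0 E M f \<longleftrightarrow> continuous_on M f"
| "Ck_on (Suc k) E M f \<longleftrightarrow>
     f differentiable_on M \<and> (\<forall>v\<in>E. Ck_on k E M (\<lambda>x. dirderiv f x v))"

definition smooth_fun :: "'a::real_normed_vector set \<Rightarrow> 'a set \<Rightarrow> ('a \<Rightarrow> 'b::real_normed_vector) \<Rightarrow> bool" where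
  "smooth_fun E M f \<longleftrightarrow> (\<forall>k. Ck_on k E M f)"

text \<open>Vector fields on \<open>M\<close> are represented by functions extended by \<open>0\<close> outside \<open>M\<close>, so that
  equality of functions is equality of fields.\<close>

definition vfields :: "'a::real_normed_vector set \<Rightarrow> 'a set \<Rightarrow> ('a \<Rightarrow> 'a) set" where
  "vfields E M = {X. smooth_fun E M X \<and> (\<forall>x\<in>M. X x \<in> E) \<and> (\<forall>x. x \<notin> M \<longrightarrow> X x = 0)}"

definition const_field :: "'a::real_normed_vector set \<Rightarrow> 'a \<Rightarrow> 'a \<Rightarrow> 'a" where
  "const_field M u = (\<lambda>x. if x \<in> M then u else 0)"

definition lie_bracket :: "('a::real_normed_vector \<Rightarrow> 'a) \<Rightarrow> ('a \<Rightarrow> 'a) \<Rightarrow> 'a \<Rightarrow> 'a" where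
  "lie_bracket X Y = (\<lambda>x. dirderiv Y x (X x) - dirderiv X x (Y x))"

text \<open>\<open>f\<^sub>* X\<close> for a diffeomorphism \<open>f\<close> from \<open>M\<close> onto \<open>N\<close>.\<close>

definition pushforward ::
  "('a::real_normed_vector \<Rightarrow> 'a) \<Rightarrow> 'a set \<Rightarrow> 'a set \<Rightarrow> ('a \<Rightarrow> 'a) \<Rightarrow> ('a \<Rightarrow> 'a)" where
  "pushforward f M N X =
     (\<lambda>y. if y \<in> N then dirderiv f (inv_into M f y) (X (inv_into M f y)) else 0)"

subsection \<open>Affine connections\<close>

type_synonym 'a connection = "('a \<Rightarrow> 'a) \<Rightarrow> ('a \<Rightarrow> 'a) \<Rightarrow> ('a \<Rightarrow> 'a)"

definition affine_connection ::
  "'a::real_normed_vector set \<Rightarrow> 'a set \<Rightarrow> 'a connection \<Rightarrow> bool" where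
  "affine_connection E M D \<longleftrightarrow>
     (\<forall>X\<in>vfields E M. \<forall>Y\<in>vfields E M. D X Y \<in> vfields E M) \<and>
     (\<forall>X\<in>vfields E M. \<forall>X'\<in>vfields E M. \<forall>Y\<in>vfields E M.
        D (\<lambda>x. X x + X' x) Y = (\<lambda>x. D X Y x + D X' Y x)) \<and>
     (\<forall>f::'a \<Rightarrow> real. \<forall>X\<in>vfields E M. \<forall>Y\<in>vfields E M. smooth_fun E M f \<longrightarrow>
        D (\<lambda>x. f x *\<^sub>R X x) Y = (\<lambda>x. f x *\<^sub>R D X Y x)) \<and>
     (\<forall>X\<in>vfields E M. \<forall>Y\<in>vfields E M. \<forall>Y'\<in>vfields E M.
        D X (\<lambda>x. Y x + Y' x) = (\<lambda>x. D X Y x + D X Y' x)) \<and>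
     (\<forall>f::'a \<Rightarrow> real. \<forall>X\<in>vfields E M. \<forall>Y\<in>vfields E M. smooth_fun E M f \<longrightarrow>
        D X (\<lambda>x. f x *\<^sub>R Y x) = (\<lambda>x. dirderiv f x (X x) *\<^sub>R Y x + f x *\<^sub>R D X Y x))"

definition curvature :: "'a::real_normed_vector connection \<Rightarrow>
    ('a \<Rightarrow> 'a) \<Rightarrow> ('a \<Rightarrow> 'a) \<Rightarrow> ('a \<Rightarrow> 'a) \<Rightarrow> ('a \<Rightarrow> 'a)" where
  "curvature D X Y Z =
     (\<lambda>x. D X (D Y Z) x - D Y (D X Z) x - D (lie_bracket X Y) Z x)"

definition torsion :: "'a::real_normed_vector connection \<Rightarrow> ('a \<Rightarrow> 'a) \<Rightarrow> ('a \<Rightarrow> 'a) \<Rightarrow> ('a \<Rightarrow> 'a)" where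
  "torsion D X Y = (\<lambda>x. D X Y x - D Y X x - lie_bracket X Y x)"

definition flat_connection ::
  "'a::real_normed_vector set \<Rightarrow> 'a set \<Rightarrow> 'a connection \<Rightarrow> bool" where
  "flat_connection E M D \<longleftrightarrow>
     (\<forall>X\<in>vfields E M. \<forall>Y\<in>vfields E M. \<forall>Z\<in>vfields E M. \<forall>x\<in>M. curvature D X Y Z x = 0)"

definition torsion_free ::
  "'a::real_normed_vector set \<Rightarrow> 'a set \<Rightarrow> 'a connection \<Rightarrow> bool" where
  "torsion_free E M D \<longleftrightarrow> (\<forall>X\<in>vfields E M. \<forall>Y\<in>vfields E M. \<forall>x\<in>M. torsion D X Y x = 0)"

text \<open>The inclusion of \<open>M\<close> into \<open>E\<close> is a global chart whose coordinate fields are the constant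
  fields. In it, the Christoffel symbols form the bilinear map \<open>christoffel\<close>, and the covariant
  derivative of a field \<open>W\<close> along a curve \<open>\<gamma>\<close> is \<open>W' + \<Gamma>\<^sub>\<gamma>(\<gamma>', W)\<close>. Derivatives of curves are
  one-sided at the end points of the parameter interval.\<close>

definition christoffel :: "'a::real_normed_vector set \<Rightarrow> 'a connection \<Rightarrow> 'a \<Rightarrow> 'a \<Rightarrow> 'a \<Rightarrow> 'a" where
  "christoffel M D x u v = D (const_field M u) (const_field M v) x"

definition velocity :: "real set \<Rightarrow> (real \<Rightarrow> 'a::real_normed_vector) \<Rightarrow> real \<Rightarrow> 'a" where
  "velocity I \<gamma> t = vector_derivative \<gamma> (at t within I)"

definition cov_deriv_along :: "'a::real_normed_vector set \<Rightarrow> 'a connection \<Rightarrow> real set \<Rightarrow>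
    (real \<Rightarrow> 'a) \<Rightarrow> (real \<Rightarrow> 'a) \<Rightarrow> real \<Rightarrow> 'a" where
  "cov_deriv_along M D I \<gamma> W t =
     vector_derivative W (at t within I) + christoffel M D (\<gamma> t) (velocity I \<gamma> t) (W t)"

text \<open>Twice differentiable solutions of the geodesic equation are automatically smooth.\<close>

definition geodesic_on ::
  "'a::real_normed_vector set \<Rightarrow> 'a connection \<Rightarrow> real set \<Rightarrow> (real \<Rightarrow> 'a) \<Rightarrow> bool" where
  "geodesic_on M D I \<gamma> \<longleftrightarrow>
     \<gamma> ` I \<subseteq> M \<and> \<gamma> differentiable_on I \<and> velocity I \<gamma> differentiable_on I \<and>
     (\<forall>t\<in>I. cov_deriv_along M D I \<gamma> (velocity I \<gamma>) t = 0)"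

subsection \<open>Matrix exponential, principal logarithm, real powers\<close>

text \<open>On the type of matrices \<open>*\<close> and \<open>^\<close> are componentwise, hence the separate \<open>mat_power\<close>.\<close>

definition mat_power :: "real^'n^'n \<Rightarrow> nat \<Rightarrow> real^'n^'n" where
  "mat_power A k = (((**) A) ^^ k) (mat 1)"

definition mat_exp :: "real^'n^'n \<Rightarrow> real^'n^'n" where
  "mat_exp A = (\<Sum>k. (1 / fact k) *\<^sub>R mat_power A k)"

definition complex_eigenvalue :: "real^'n^'n \<Rightarrow> complex \<Rightarrow> bool" where
  "complex_eigenvalue A z \<longleftrightarrow>
     (\<exists>v::complex^'n. v \<noteq> 0 \<and> map_matrix complex_of_real A *v v = z *s v)"

text \<open>The principal logarithm is the logarithm with spectrum in the strip \<open>-\<pi> < Im z < \<pi>\<close>. It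
  exists and is unique (and is real) for real matrices with no eigenvalue in \<open>(-\<infinity>, 0]\<close>.\<close>

definition mat_log :: "real^'n^'n \<Rightarrow> real^'n^'n" where
  "mat_log T = (THE X. mat_exp X = T \<and> (\<forall>z. complex_eigenvalue X z \<longrightarrow> \<bar>Im z\<bar> < pi))"

definition mat_powr :: "real^'n^'n \<Rightarrow> real \<Rightarrow> real^'n^'n" where
  "mat_powr T t = mat_exp (t *\<^sub>R mat_log T)"

subsection \<open>The cone and the group\<close>

definition V_space :: "(real^3^3) set" where
  "V_space = {A. transpose A = A \<and> A$1$2 = 0}"

definition Omega :: "(real^3^3) set" where
  "Omega = {A\<in>V_space. \<forall>v. v \<noteq> 0 \<longrightarrow> v \<bullet> (A *v v) > 0}"

definition h_algebra :: "(real^3^3) set" where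
  "h_algebra = {A. (\<forall>i j. (i, j) \<in> {(1, 2), (1, 3), (2, 3)} \<longrightarrow> A$i$j = 0) \<and> A$2$1 = 0}"

definition H_group :: "(real^3^3) set" where
  "H_group = {T\<in>h_algebra. \<forall>i. T$i$i > 0}"

definition Phi :: "real^3^3 \<Rightarrow> real^3^3" where
  "Phi T = T ** transpose T"

definition Phi_inv :: "real^3^3 \<Rightarrow> real^3^3" where
  "Phi_inv = inv_into H_group Phi"

definition cv_path :: "real^3^3 \<Rightarrow> real^3^3 \<Rightarrow> real \<Rightarrow> real^3^3" where
  "cv_path x y t =
     Phi (Phi_inv x ** mat_powr (matrix_inv (Phi_inv x) ** Phi_inv y) t)"

definition cv_mean :: "real^3^3 \<Rightarrow> real^3^3 \<Rightarrow> real^3^3" where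
  "cv_mean x y =
     Phi (Phi_inv x ** mat_powr (matrix_inv (Phi_inv x) ** Phi_inv y) (1/2))"

subsection \<open>The connections\<close>

definition left_inv_field :: "real^3^3 \<Rightarrow> real^3^3 \<Rightarrow> real^3^3" where
  "left_inv_field A = (\<lambda>T. if T \<in> H_group then T ** A else 0)"

definition left_invariant_connection :: "(real^3^3) connection \<Rightarrow> bool" where
  "left_invariant_connection D \<longleftrightarrow>
     (\<forall>S\<in>H_group. \<forall>X\<in>vfields h_algebra H_group. \<forall>Y\<in>vfields h_algebra H_group.
        pushforward ((**) S) H_group H_group (D X Y) =
        D (pushforward ((**) S) H_group H_group X) (pushforward ((**) S) H_group H_group Y))"

text \<open>The last condition only normalises the values on arguments that are not smooth vector
  fields; without it the defining properties do not single out one HOL function.\<close>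

definition nabla_H :: "(real^3^3) connection" where
  "nabla_H = (THE D.
     affine_connection h_algebra H_group D \<and>
     left_invariant_connection D \<and>
     (\<forall>A\<in>h_algebra. \<forall>B\<in>h_algebra. D (left_inv_field A) (left_inv_field B) = (\<lambda>_. 0)) \<and>
     (\<forall>X Y. X \<notin> vfields h_algebra H_group \<or> Y \<notin> vfields h_algebra H_group \<longrightarrow>
        D X Y = (\<lambda>_. 0)))"

definition nabla_cv :: "(real^3^3) connection" where
  "nabla_cv U W = pushforward Phi H_group Omega
     (nabla_H (pushforward Phi_inv Omega H_group U) (pushforward Phi_inv Omega H_group W))"

end

theory Submission
  imports Defs "HOL-Computational_Algebra.Fundamental_Theorem_Algebra"
begin

text \<open>
  A global frame of vector fields determines a unique affine connection making the frame parallel; it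
  differentiates the coefficients of a field, so its curvature vanishes by symmetry of second
  derivatives, and its geodesics are the integral curves of the constant combinations of the frame.
  Such connections are natural under diffeomorphisms. On \<open>H\<close> the frame of left-invariant fields gives
  \<open>nabla_H\<close>, whose geodesics solve \<open>T' = T A\<close>, that is \<open>T(t) = T(0) exp(t A)\<close>; transporting the frame by the
  Cholesky diffeomorphism \<open>\<Phi>\<close> gives \<open>nabla_cv\<close>. Existence and uniqueness of the geodesic from \<open>x\<close> to \<open>y\<close> is
  then the bijectivity of \<open>exp\<close> from the Lie algebra onto \<open>H\<close>, read off explicit formulas, together with the
  fact that the principal logarithm of an element of \<open>H\<close> is its logarithm in the Lie algebra. The torsion
  is visible in the \<open>(1,3)\<close> entry of the bracket of two frame fields at the identity matrix.
\<close>

subsection \<open>Directional derivatives on relatively open sets\<close>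

text \<open>When \<open>E\<close> is a proper subspace, a derivative within \<open>M\<close> is not
  unique as a linear map on the ambient space; only its values on \<open>E\<close> are. Hence
  everything is phrased with \<open>dirderiv\<close> in directions from \<open>E\<close>, and
  directions that move with the point are expanded in a fixed orthonormal basis. Two definitions by
  description shape the rest. \<open>nabla_cv\<close> is compared with a frame connection on smooth
  fields only, so its properties are obtained by congruence lemmas restricted to such fields. In
  \<open>mat_log\<close> the competing logarithms range over all real matrices and need not be
  triangular. What forces the triangular shape is that the first two standard row vectors are left
  eigenvectors of every element of \<open>H_group\<close>. When eigenvalues coincide, an eigenvector
  of an exponential need not be one of the logarithm; the condition on the strip is what settles
  this.\<close>

lemma has_vector_derivative_in_subspace:
  fixes F :: "'a::euclidean_space set"
  assumes F: "subspace F" and f: "(f has_vector_derivative w) (at t within S)"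
    and S: "\<And>s. s \<in> S \<Longrightarrow> f s \<in> F" and t: "t \<in> S" "at t within S \<noteq> bot"
  shows "w \<in> F"
proof -
  have "((\<lambda>s. norm ((f s - f t - (s - t) *\<^sub>R w) /\<^sub>R norm (s - t))) \<longlongrightarrow> 0) (at t within S)"
    using f unfolding has_vector_derivative_def has_derivative_at_within by (intro tendsto_norm_zero) simp
  then have "((\<lambda>s. norm ((f s - f t) /\<^sub>R (s - t) - w)) \<longlongrightarrow> 0) (at t within S)"
  proof (rule Lim_transform_eventually)
    have "norm ((f s - f t - (s - t) *\<^sub>R w) /\<^sub>R norm (s - t)) = norm ((f s - f t) /\<^sub>R (s - t) - w)" if "s \<noteq> t" for s
    proof -
      have "(f s - f t) /\<^sub>R (s - t) - w = (f s - f t - (s - t) *\<^sub>R w) /\<^sub>R (s - t)"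
        using that by (simp add: scaleR_diff_right)
      then show ?thesis by simp
    qed
    then show "\<forall>\<^sub>F s in at t within S. norm ((f s - f t - (s - t) *\<^sub>R w) /\<^sub>R norm (s - t)) =
        norm ((f s - f t) /\<^sub>R (s - t) - w)"
      by (auto simp: eventually_at_filter)
  qed
  then have "((\<lambda>s. (f s - f t) /\<^sub>R (s - t)) \<longlongrightarrow> w) (at t within S)"
    by (simp only: tendsto_norm_zero_iff Lim_null[symmetric])
  \<comment> \<open>The difference quotients lie in \<open>F\<close>, which is closed, and the
    filter is nontrivial; so their limit \<open>w\<close> lies in \<open>F\<close>.\<close>
  moreover have "eventually (\<lambda>s. (f s - f t) /\<^sub>R (s - t) \<in> F) (at t within S)"
    using t S F by (auto simp: eventually_at_filter intro!: always_eventually subspace_scale subspace_diff)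
  ultimately show ?thesis
    by (intro Lim_in_closed_set[OF closed_subspace[OF F] _ t(2)])
qed

locale linear_domain =
  fixes E M :: "'a::euclidean_space set"
  assumes subspace_E: "subspace E"
    and openin_M: "openin (top_of_set E) M"
begin

lemma M_subset: "M \<subseteq> E"
  using openin_M by (rule openin_imp_subset)

lemma in_E: "x \<in> M \<Longrightarrow> x \<in> E"
  using M_subset by blast

lemma open_line:
  assumes "x \<in> E" "v \<in> E"
  shows "open {t::real. x + t *\<^sub>R v \<in> M}"
proof -
  obtain T where T: "open T" "M = E \<inter> T"
    using openin_M by (auto simp: openin_open)
  have "{t::real. x + t *\<^sub>R v \<in> M} = (\<lambda>t. x + t *\<^sub>R v) -` T"
    using assms subspace_E by (auto simp: T(2) subspace_add subspace_scale)
  moreover have "open ((\<lambda>t::real. x + t *\<^sub>R v) -` T)"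
    by (intro open_vimage T(1) continuous_intros)
  ultimately show ?thesis by simp
qed

lemma eventually_line:
  assumes "x \<in> M" "v \<in> E"
  shows "\<forall>\<^sub>F t::real in nhds 0. x + t *\<^sub>R v \<in> M"
  using open_line[OF in_E[OF assms(1)] assms(2)] assms(1)
  by (auto simp: eventually_nhds)

text \<open>Orthonormality makes the coordinates of \<open>v\<close> inner products with fixed
  vectors. These are bounded linear in \<open>v\<close>, hence smooth along any smooth
  field.\<close>

lemma obtain_basis:
  obtains B where "finite B" "B \<subseteq> E" "\<And>v. v \<in> E \<Longrightarrow> (\<Sum>b\<in>B. (v \<bullet> b) *\<^sub>R b) = v"
proof -
  obtain B where B: "B \<subseteq> E" "pairwise orthogonal B" "\<And>x. x \<in> B \<Longrightarrow> norm x = 1"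
    "independent B" "span B = E"
    using orthonormal_basis_subspace[OF subspace_E] by metis
  have fin: "finite B" using B(4) independent_imp_finite by blast
  have "(\<Sum>b\<in>B. (v \<bullet> b) *\<^sub>R b) = v" if "v \<in> E" for v
  proof -
    have "v \<in> range (\<lambda>c. \<Sum>b\<in>B. c b *\<^sub>R b)"
      using that B(5) span_finite[OF fin] by simp
    then obtain c where c: "v = (\<Sum>b\<in>B. c b *\<^sub>R b)"
      by (rule rangeE)
    have "v \<bullet> b = c b" if b: "b \<in> B" for b
    proof -
      have "v \<bullet> b = (\<Sum>a\<in>B. if a = b then c b else 0)"
        unfolding c inner_sum_left using B(2,3) b
        by (intro sum.cong) (auto simp: pairwise_def orthogonal_def norm_eq_1)
      then show ?thesis using fin b by simp
    qed
    then show ?thesis by (simp add: c)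
  qed
  then show ?thesis using that fin B(1) by blast
qed

lemma dirderiv_cong:
  assumes "x \<in> M" "v \<in> E" "\<And>y. y \<in> M \<Longrightarrow> f y = g y"
  shows "dirderiv f x v = dirderiv g x v"
  unfolding dirderiv_def
  using eventually_line[OF assms(1,2)]
  by (intro vector_derivative_cong_eq refl) (auto elim!: eventually_mono simp: assms(3))

text \<open>The parameters whose line point lies in \<open>M\<close> form an open set of reals, so a
  derivative relative to \<open>M\<close> restricts to a two-sided derivative along the
  line.\<close>

lemma has_vector_derivative_line:
  assumes f: "(f has_derivative f') (at (x + t *\<^sub>R v) within M)"
    and x: "x \<in> E" "v \<in> E" "x + t *\<^sub>R v \<in> M"
  shows "((\<lambda>s. f (x + s *\<^sub>R v)) has_vector_derivative f' v) (at t)"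
proof -
  define S where "S = {s. x + s *\<^sub>R v \<in> M}"
  have S: "open S" "t \<in> S"
    unfolding S_def using open_line x by auto
  have "((\<lambda>s. x + s *\<^sub>R v) has_derivative (\<lambda>h. h *\<^sub>R v)) (at t within S)"
    by (auto intro!: derivative_eq_intros)
  moreover have "(f has_derivative f') (at (x + t *\<^sub>R v) within (\<lambda>s. x + s *\<^sub>R v) ` S)"
    by (rule has_derivative_subset[OF f]) (auto simp: S_def)
  ultimately have "((\<lambda>s. f (x + s *\<^sub>R v)) has_derivative (\<lambda>h. f' (h *\<^sub>R v))) (at t within S)"
    by (rule has_derivative_in_compose)
  then show ?thesis
    using S linear_scale[OF has_derivative_linear[OF f]]
    by (simp add: has_vector_derivative_def at_within_open_NO_MATCH)
qed

lemma dirderiv_eq: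
  assumes "(f has_derivative f') (at x within M)" "x \<in> M" "v \<in> E"
  shows "dirderiv f x v = f' v"
  unfolding dirderiv_def using has_vector_derivative_line[of f f' x 0 v] assms in_E
  by (intro vector_derivative_at) auto

lemma dirderiv_eqI:
  assumes "(f has_derivative f') (at x)" "x \<in> M" "v \<in> E"
  shows "dirderiv f x v = f' v"
  using dirderiv_eq has_derivative_at_withinI assms by blast

text \<open>Off \<open>E\<close> the map \<open>f'\<close> may be arbitrary, so it is compared with
  \<open>dirderiv\<close> on \<open>E\<close> only; its linearity passes to the direction argument
  of \<open>dirderiv\<close>.\<close>

lemma ex_dirderiv:
  assumes "f differentiable_on M" "x \<in> M"
  shows "\<exists>f'. (f has_derivative f') (at x within M) \<and> linear f' \<and> (\<forall>v\<in>E. dirderiv f x v = f' v)"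
proof -
  obtain f' where "(f has_derivative f') (at x within M)"
    using assms unfolding differentiable_on_def differentiable_def by blast
  then show ?thesis using dirderiv_eq[OF _ assms(2)] has_derivative_linear by blast
qed

lemma dirderiv_line:
  fixes f :: "'a \<Rightarrow> 'b::real_normed_vector"
  assumes "f differentiable_on M" "x \<in> E" "v \<in> E" "x + t *\<^sub>R v \<in> M"
  shows "((\<lambda>s. f (x + s *\<^sub>R v)) has_vector_derivative dirderiv f (x + t *\<^sub>R v) v) (at t)"
  using ex_dirderiv[OF assms(1,4)] has_vector_derivative_line assms(2-4) by fastforce

text \<open>With \<open>S\<close> a closed interval this chain rule covers the one-sided derivatives
  at the end points.\<close>

lemma dirderiv_curve:
  fixes f :: "'a \<Rightarrow> 'b::real_normed_vector"
  assumes f: "f differentiable_on M" and c: "(c has_vector_derivative w) (at t within S)"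
    and S: "\<And>s. s \<in> S \<Longrightarrow> c s \<in> M" "t \<in> S" and w: "w \<in> E"
  shows "((\<lambda>s. f (c s)) has_vector_derivative dirderiv f (c t) w) (at t within S)"
proof -
  obtain f' where f': "(f has_derivative f') (at (c t) within M)" "dirderiv f (c t) w = f' w" "linear f'"
    using ex_dirderiv[OF f S(1)[OF S(2)]] w by blast
  have "((\<lambda>s. f (c s)) has_derivative (\<lambda>h. f' (h *\<^sub>R w))) (at t within S)"
    using c unfolding has_vector_derivative_def
    by (rule has_derivative_in_compose) (rule has_derivative_subset[OF f'(1)], use S in auto)
  then show ?thesis by (simp add: has_vector_derivative_def f'(2) linear_scale[OF f'(3)])
qed

lemma dirderiv_sum:
  assumes f: "f differentiable_on M" "x \<in> M" and B: "\<And>b. b \<in> B \<Longrightarrow> w b \<in> E"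
  shows "dirderiv f x (\<Sum>b\<in>B. c b *\<^sub>R w b) = (\<Sum>b\<in>B. c b *\<^sub>R dirderiv f x (w b))"
proof -
  obtain f' where f': "(f has_derivative f') (at x within M)" "\<And>v. v \<in> E \<Longrightarrow> dirderiv f x v = f' v"
    "linear f'" using ex_dirderiv[OF f] by blast
  have "(\<Sum>b\<in>B. c b *\<^sub>R w b) \<in> E"
    using B subspace_E by (intro subspace_sum subspace_scale) auto
  then show ?thesis
    using B by (simp add: f'(2) linear_sum[OF f'(3)] linear_scale[OF f'(3)])
qed

lemma dirderiv_add_dir:
  assumes "f differentiable_on M" "x \<in> M" "u \<in> E" "v \<in> E"
  shows "dirderiv f x (u + v) = dirderiv f x u + dirderiv f x v"
proof -
  obtain f' where "(f has_derivative f') (at x within M)"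
    and f': "\<And>v. v \<in> E \<Longrightarrow> dirderiv f x v = f' v" "linear f'"
    using ex_dirderiv[OF assms(1,2)] by blast
  show ?thesis using assms by (simp add: f'(1) linear_add[OF f'(2)] subspace_add[OF subspace_E])
qed

lemma dirderiv_diff_dir:
  assumes "f differentiable_on M" "x \<in> M" "u \<in> E" "v \<in> E"
  shows "dirderiv f x (u - v) = dirderiv f x u - dirderiv f x v"
proof -
  obtain f' where "(f has_derivative f') (at x within M)"
    and f': "\<And>v. v \<in> E \<Longrightarrow> dirderiv f x v = f' v" "linear f'"
    using ex_dirderiv[OF assms(1,2)] by blast
  show ?thesis using assms by (simp add: f'(1) linear_diff[OF f'(2)] subspace_diff[OF subspace_E])
qed

lemma dirderiv_scaleR_dir:
  assumes "f differentiable_on M" "x \<in> M" "v \<in> E"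
  shows "dirderiv f x (c *\<^sub>R v) = c *\<^sub>R dirderiv f x v"
  using dirderiv_sum[OF assms(1,2), of "{v}" id "\<lambda>_. c"] assms by simp

lemma dirderiv_bilinear:
  assumes h: "bounded_bilinear h" and f: "f differentiable_on M" "g differentiable_on M"
    and x: "x \<in> M" "v \<in> E"
  shows "dirderiv (\<lambda>y. h (f y) (g y)) x v = h (f x) (dirderiv g x v) + h (dirderiv f x v) (g x)"
proof -
  obtain f' where f': "(f has_derivative f') (at x within M)" "dirderiv f x v = f' v"
    using ex_dirderiv[OF f(1) x(1)] x by blast
  obtain g' where g': "(g has_derivative g') (at x within M)" "dirderiv g x v = g' v"
    using ex_dirderiv[OF f(2) x(1)] x by blast
  show ?thesis
    using dirderiv_eq[OF bounded_bilinear.FDERIV[OF h f'(1) g'(1)] x] by (simp add: f' g')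
qed

lemma dirderiv_add:
  assumes f: "f differentiable_on M" "g differentiable_on M" and x: "x \<in> M" "v \<in> E"
  shows "dirderiv (\<lambda>y. f y + g y) x v = dirderiv f x v + dirderiv g x v"
proof -
  obtain f' where f': "(f has_derivative f') (at x within M)" "dirderiv f x v = f' v"
    using ex_dirderiv[OF f(1) x(1)] x by blast
  obtain g' where g': "(g has_derivative g') (at x within M)" "dirderiv g x v = g' v"
    using ex_dirderiv[OF f(2) x(1)] x by blast
  show ?thesis
    using dirderiv_eq[OF has_derivative_add[OF f'(1) g'(1)] x] by (simp add: f' g')
qed

lemma dirderiv_bounded_linear:
  assumes h: "bounded_linear h" and f: "f differentiable_on M" and x: "x \<in> M" "v \<in> E"
  shows "dirderiv (\<lambda>y. h (f y)) x v = h (dirderiv f x v)"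
proof -
  obtain f' where f': "(f has_derivative f') (at x within M)" "dirderiv f x v = f' v"
    using ex_dirderiv[OF f x(1)] x by blast
  show ?thesis
    using dirderiv_eq[OF bounded_linear.has_derivative[OF h f'(1)] x] by (simp add: f')
qed

lemma dirderiv_in:
  fixes f :: "'a \<Rightarrow> 'b::euclidean_space"
  assumes F: "subspace F" and f: "f differentiable_on M" "\<And>y. y \<in> M \<Longrightarrow> f y \<in> F" and x: "x \<in> M" "v \<in> E"
  shows "dirderiv f x v \<in> F"
proof -
  let ?S = "{t::real. x + t *\<^sub>R v \<in> M}"
  have S: "open ?S" "0 \<in> ?S"
    using open_line x in_E by auto
  have "((\<lambda>s. f (x + s *\<^sub>R v)) has_vector_derivative dirderiv f x v) (at 0)"
    using dirderiv_line[OF f(1), of x v 0] x in_E by simp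
  then have "((\<lambda>s. f (x + s *\<^sub>R v)) has_vector_derivative dirderiv f x v) (at 0 within ?S)"
    by (rule has_vector_derivative_at_within)
  then show ?thesis
    by (rule has_vector_derivative_in_subspace[OF F])
      (use S f(2) in \<open>auto simp: at_within_open_NO_MATCH\<close>)
qed

lemma dirderiv_compose:
  fixes f :: "'b::euclidean_space \<Rightarrow> 'c::real_normed_vector"
  assumes N: "linear_domain F N"
    and f: "f differentiable_on N" and g: "g differentiable_on M" "\<And>y. y \<in> M \<Longrightarrow> g y \<in> N"
    and x: "x \<in> M" "v \<in> E"
  shows "dirderiv (\<lambda>y. f (g y)) x v = dirderiv f (g x) (dirderiv g x v)"
proof -
  interpret N: linear_domain F N by fact
  obtain g' where g': "(g has_derivative g') (at x within M)" "dirderiv g x v = g' v"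
    using ex_dirderiv[OF g(1) x(1)] x by blast
  have "dirderiv g x v \<in> F"
    using dirderiv_in[OF N.subspace_E g(1)] g(2) N.in_E x by blast
  then obtain f' where f': "(f has_derivative f') (at (g x) within N)"
      "dirderiv f (g x) (dirderiv g x v) = f' (dirderiv g x v)"
    using N.ex_dirderiv[OF f g(2)[OF x(1)]] by blast
  have "((\<lambda>y. f (g y)) has_derivative (\<lambda>h. f' (g' h))) (at x within M)"
    using g'(1) by (rule has_derivative_in_compose) (rule has_derivative_subset[OF f'(1)], use g in auto)
  from dirderiv_eq[OF this x] show ?thesis using f'(2) by (simp add: g')
qed

lemma differentiable_compose:
  fixes f :: "'b::euclidean_space \<Rightarrow> 'c::real_normed_vector"
  assumes "f differentiable_on N" "g differentiable_on M" "\<And>y. y \<in> M \<Longrightarrow> g y \<in> N"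
  shows "(\<lambda>y. f (g y)) differentiable_on M"
  using differentiable_on_compose[of g M f] differentiable_on_subset[OF assms(1), of "g ` M"] assms
  by blast

subsection \<open>Closure properties of smooth functions\<close>

text \<open>Derivative formulas hold on \<open>M\<close> only, and fields are cut off to 0 outside
  it; this lets such formulas replace a function inside \<open>Ck_on\<close> at every order.\<close>

lemma Ck_on_cong:
  fixes f g :: "'a \<Rightarrow> 'b::real_normed_vector"
  assumes "\<And>x. x \<in> M \<Longrightarrow> f x = g x"
  shows "Ck_on k E M f \<longleftrightarrow> Ck_on k E M g"
  using assms
proof (induction k arbitrary: f g)
  case 0
  then show ?case using continuous_on_cong[OF refl, of M f g] by simp
next
  case (Suc k)
  have "q differentiable_on M" if p: "p differentiable_on M" "\<And>x. x \<in> M \<Longrightarrow> q x = p x" for p q :: "'a \<Rightarrow> 'b"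
    unfolding differentiable_on_def differentiable_def
  proof
    fix x assume x: "x \<in> M"
    then obtain p' where "(p has_derivative p') (at x within M)"
      using p(1) unfolding differentiable_on_def differentiable_def by blast
    then have "(q has_derivative p') (at x within M)"
      by (intro has_derivative_transform[OF x p(2)])
    then show "\<exists>q'. (q has_derivative q') (at x within M)" by blast
  qed
  from this[of f g] this[of g f] have "f differentiable_on M \<longleftrightarrow> g differentiable_on M"
    using Suc.prems by auto
  moreover have "Ck_on k E M (\<lambda>x. dirderiv f x v) \<longleftrightarrow> Ck_on k E M (\<lambda>x. dirderiv g x v)" if "v \<in> E" for v
    by (rule Suc.IH) (rule dirderiv_cong, use that Suc.prems in auto)
  ultimately show ?case by auto
qed

lemma Ck_on_transform:
  "Ck_on k E M g \<Longrightarrow> (\<And>x. x \<in> M \<Longrightarrow> f x = g x) \<Longrightarrow> Ck_on k E M f"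
  using Ck_on_cong[of f g] by blast

lemma Ck_on_SucD: "Ck_on (Suc k) E M f \<Longrightarrow> Ck_on k E M f"
proof (induction k arbitrary: f)
  case 0
  then show ?case by (simp add: differentiable_imp_continuous_on)
qed simp

lemma Ck_on_const: "Ck_on k E M (\<lambda>_. c)"
proof (induction k arbitrary: c)
  case (Suc k)
  have "Ck_on k E M (\<lambda>x. dirderiv (\<lambda>_. c) x v)" for v
    by (simp add: dirderiv_def Suc)
  then show ?case by simp
qed simp

lemma Ck_on_add: "Ck_on k E M f \<Longrightarrow> Ck_on k E M g \<Longrightarrow> Ck_on k E M (\<lambda>x. f x + g x)"
proof (induction k arbitrary: f g)
  case 0
  then show ?case by (simp add: continuous_on_add)
next
  case (Suc k)
  then show ?case
    by (auto simp: dirderiv_add cong: Ck_on_cong)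
qed

lemma differentiable_on_bilinear:
  assumes h: "bounded_bilinear h" and f: "f differentiable_on M" "g differentiable_on M"
  shows "(\<lambda>x. h (f x) (g x)) differentiable_on M"
  unfolding differentiable_on_def
proof
  fix x assume x: "x \<in> M"
  obtain f' where f': "(f has_derivative f') (at x within M)"
    using ex_dirderiv[OF f(1) x] by blast
  obtain g' where g': "(g has_derivative g') (at x within M)"
    using ex_dirderiv[OF f(2) x] by blast
  show "(\<lambda>x. h (f x) (g x)) differentiable (at x within M)"
    unfolding differentiable_def using bounded_bilinear.FDERIV[OF h f' g'] by blast
qed

lemma Ck_on_bilinear:
  assumes h: "bounded_bilinear h"
  shows "Ck_on k E M f \<Longrightarrow> Ck_on k E M g \<Longrightarrow> Ck_on k E M (\<lambda>x. h (f x) (g x))"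
proof (induction k arbitrary: f g)
  case 0
  then show ?case by (simp add: bounded_bilinear.continuous_on[OF h])
next
  case (Suc k)
  have "(\<lambda>x. h (f x) (g x)) differentiable_on M"
    using Suc.prems by (intro differentiable_on_bilinear[OF h]) auto
  moreover have "Ck_on k E M (\<lambda>x. dirderiv (\<lambda>x. h (f x) (g x)) x v)" if "v \<in> E" for v
  proof -
    have "Ck_on k E M (\<lambda>x. h (f x) (dirderiv g x v) + h (dirderiv f x v) (g x))"
      using Suc.prems that by (intro Ck_on_add Suc.IH Ck_on_SucD[of k f] Ck_on_SucD[of k g]) auto
    then show ?thesis
      using Suc.prems that by (subst Ck_on_cong[OF dirderiv_bilinear[OF h]]) auto
  qed
  ultimately show ?case by simp
qed

lemma differentiable_on_bounded_linear:
  assumes h: "bounded_linear h" and f: "f differentiable_on M"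
  shows "(\<lambda>x. h (f x)) differentiable_on M"
  unfolding differentiable_on_def
proof
  fix x assume x: "x \<in> M"
  obtain f' where f': "(f has_derivative f') (at x within M)"
    using ex_dirderiv[OF f x] by blast
  show "(\<lambda>x. h (f x)) differentiable (at x within M)"
    unfolding differentiable_def using bounded_linear.has_derivative[OF h f'] by blast
qed

lemma Ck_on_bounded_linear:
  assumes h: "bounded_linear h"
  shows "Ck_on k E M f \<Longrightarrow> Ck_on k E M (\<lambda>x. h (f x))"
proof (induction k arbitrary: f)
  case 0
  then show ?case by (simp add: bounded_linear.continuous_on[OF h])
next
  case (Suc k)
  have "(\<lambda>x. h (f x)) differentiable_on M"
    using Suc.prems by (intro differentiable_on_bounded_linear[OF h]) auto
  moreover have "Ck_on k E M (\<lambda>x. dirderiv (\<lambda>x. h (f x)) x v)" if "v \<in> E" for v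
    using Suc.prems that
    by (auto simp: dirderiv_bounded_linear[OF h] cong: Ck_on_cong intro!: Suc.IH)
  ultimately show ?case by simp
qed

lemma Ck_on_sum: "(\<And>i. i \<in> I \<Longrightarrow> Ck_on k E M (f i)) \<Longrightarrow> Ck_on k E M (\<lambda>x. \<Sum>i\<in>I. f i x)"
  by (induction I rule: infinite_finite_induct) (auto intro: Ck_on_add Ck_on_const)

lemma smooth_cong:
  assumes "\<And>x. x \<in> M \<Longrightarrow> f x = g x"
  shows "smooth_fun E M f \<longleftrightarrow> smooth_fun E M g"
  unfolding smooth_fun_def using Ck_on_cong[of f g] assms by blast

lemma smooth_transform:
  "smooth_fun E M g \<Longrightarrow> (\<And>x. x \<in> M \<Longrightarrow> f x = g x) \<Longrightarrow> smooth_fun E M f"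
  using smooth_cong[of f g] by blast

lemma smooth_differentiable: "smooth_fun E M f \<Longrightarrow> f differentiable_on M"
  unfolding smooth_fun_def by (metis Ck_on.simps(2))

lemma smooth_continuous: "smooth_fun E M f \<Longrightarrow> continuous_on M f"
  unfolding smooth_fun_def by (metis Ck_on.simps(1))

lemma smooth_dirderiv: "smooth_fun E M f \<Longrightarrow> v \<in> E \<Longrightarrow> smooth_fun E M (\<lambda>x. dirderiv f x v)"
  unfolding smooth_fun_def by (metis Ck_on.simps(2))

lemma smoothI:
  assumes "f differentiable_on M" "\<And>v. v \<in> E \<Longrightarrow> smooth_fun E M (\<lambda>x. dirderiv f x v)"
  shows "smooth_fun E M f"
  unfolding smooth_fun_def
proof
  fix k
  have "Ck_on (Suc k) E M f" using assms by (auto simp: smooth_fun_def)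
  then show "Ck_on k E M f" by (rule Ck_on_SucD)
qed

lemma smooth_const: "smooth_fun E M (\<lambda>_. c)"
  by (simp add: smooth_fun_def Ck_on_const)

lemma smooth_add: "smooth_fun E M f \<Longrightarrow> smooth_fun E M g \<Longrightarrow> smooth_fun E M (\<lambda>x. f x + g x)"
  by (simp add: smooth_fun_def Ck_on_add)

lemma smooth_bilinear:
  "bounded_bilinear h \<Longrightarrow> smooth_fun E M f \<Longrightarrow> smooth_fun E M g \<Longrightarrow> smooth_fun E M (\<lambda>x. h (f x) (g x))"
  by (simp add: smooth_fun_def Ck_on_bilinear)

lemma smooth_bounded_linear:
  "bounded_linear h \<Longrightarrow> smooth_fun E M f \<Longrightarrow> smooth_fun E M (\<lambda>x. h (f x))"
  by (simp add: smooth_fun_def Ck_on_bounded_linear)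

lemma smooth_sum:
  "(\<And>i. i \<in> I \<Longrightarrow> smooth_fun E M (f i)) \<Longrightarrow> smooth_fun E M (\<lambda>x. \<Sum>i\<in>I. f i x)"
  by (simp add: smooth_fun_def Ck_on_sum)

lemma smooth_scaleR:
  "smooth_fun E M f \<Longrightarrow> smooth_fun E M g \<Longrightarrow> smooth_fun E M (\<lambda>x. f x *\<^sub>R g x)"
  by (rule smooth_bilinear[OF bounded_bilinear_scaleR])

lemma smooth_mult:
  fixes f g :: "'a \<Rightarrow> real"
  shows "smooth_fun E M f \<Longrightarrow> smooth_fun E M g \<Longrightarrow> smooth_fun E M (\<lambda>x. f x * g x)"
  by (rule smooth_bilinear[OF bounded_bilinear_mult])

lemma smooth_uminus: "smooth_fun E M f \<Longrightarrow> smooth_fun E M (\<lambda>x. - f x)"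
  by (rule smooth_bounded_linear[OF bounded_linear_minus[OF bounded_linear_ident]])

lemma smooth_diff: "smooth_fun E M f \<Longrightarrow> smooth_fun E M g \<Longrightarrow> smooth_fun E M (\<lambda>x. f x - g x)"
  using smooth_add[OF _ smooth_uminus] by fastforce

lemma smooth_id: "smooth_fun E M (\<lambda>x. x)"
proof (rule smoothI)
  fix v assume v: "v \<in> E"
  have "dirderiv (\<lambda>x. x) x v = v" if "x \<in> M" for x
    using dirderiv_eq[OF has_derivative_ident that v] .
  then show "smooth_fun E M (\<lambda>x. dirderiv (\<lambda>x. x) x v)"
    by (rule smooth_transform[OF smooth_const])
qed simp

text \<open>\<open>Ck_on\<close> differentiates in fixed directions, whereas here the direction
  moves. Expanding \<open>Y x\<close> in a basis leaves products of coordinate functions with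
  fixed-direction derivatives.\<close>

lemma smooth_dirderiv_field:
  assumes f: "smooth_fun E M f" and Y: "smooth_fun E M Y" "\<And>x. x \<in> M \<Longrightarrow> Y x \<in> E"
  shows "smooth_fun E M (\<lambda>x. dirderiv f x (Y x))"
proof -
  obtain B where B: "finite B" "B \<subseteq> E" "\<And>v. v \<in> E \<Longrightarrow> (\<Sum>b\<in>B. (v \<bullet> b) *\<^sub>R b) = v"
    using obtain_basis by blast
  have "dirderiv f x (Y x) = (\<Sum>b\<in>B. (Y x \<bullet> b) *\<^sub>R dirderiv f x b)" if "x \<in> M" for x
    using dirderiv_sum[OF smooth_differentiable[OF f] that, of B "\<lambda>b. b" "\<lambda>b. Y x \<bullet> b"] B(2) B(3)[OF Y(2)[OF that]]
    by (auto simp: subset_iff)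
  moreover have "smooth_fun E M (\<lambda>x. \<Sum>b\<in>B. (Y x \<bullet> b) *\<^sub>R dirderiv f x b)"
    using B(2) by (intro smooth_sum smooth_scaleR smooth_dirderiv f
        smooth_bounded_linear[OF bounded_linear_inner_left] Y(1)) auto
  ultimately show ?thesis by (rule smooth_transform[rotated])
qed

text \<open>The chain rule produces the moving direction \<open>dirderiv g x v\<close>. Expanded in
  a basis of \<open>F\<close>, it leaves fixed-direction derivatives of \<open>f\<close> composed
  with \<open>g\<close>, to which the induction hypothesis applies.\<close>

lemma Ck_on_compose:
  fixes f :: "'b::euclidean_space \<Rightarrow> 'c::real_normed_vector"
  assumes N: "linear_domain F N"
  shows "Ck_on k F N f \<Longrightarrow> Ck_on k E M g \<Longrightarrow> (\<And>x. x \<in> M \<Longrightarrow> g x \<in> N) \<Longrightarrow> Ck_on k E M (\<lambda>x. f (g x))"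
proof (induction k arbitrary: f g)
  case 0
  then show ?case
    using continuous_on_compose2[of N f M g] by auto
next
  case (Suc k)
  interpret N: linear_domain F N by fact
  obtain B where B: "finite B" "B \<subseteq> F" "\<And>v. v \<in> F \<Longrightarrow> (\<Sum>b\<in>B. (v \<bullet> b) *\<^sub>R b) = v"
    using N.obtain_basis by blast
  have f: "f differentiable_on N" and g: "g differentiable_on M" using Suc.prems by auto
  have "Ck_on k E M (\<lambda>x. dirderiv (\<lambda>x. f (g x)) x v)" if v: "v \<in> E" for v
  proof -
    have "dirderiv (\<lambda>x. f (g x)) x v = (\<Sum>b\<in>B. (dirderiv g x v \<bullet> b) *\<^sub>R dirderiv f (g x) b)" if x: "x \<in> M" for x
    proof -
      have "dirderiv g x v \<in> F"
        using dirderiv_in[OF N.subspace_E g _ x v] Suc.prems(3) N.in_E by blast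
      then show ?thesis
        using dirderiv_compose[OF N f g _ x v] Suc.prems(3) N.dirderiv_sum[OF f Suc.prems(3)[OF x], of B "\<lambda>b. b" "\<lambda>b. dirderiv g x v \<bullet> b"] B
        by (auto simp: subset_iff)
    qed
    moreover have "Ck_on k E M (\<lambda>x. \<Sum>b\<in>B. (dirderiv g x v \<bullet> b) *\<^sub>R dirderiv f (g x) b)"
    proof (intro Ck_on_sum Ck_on_bilinear[OF bounded_bilinear_scaleR]
        Ck_on_bounded_linear[OF bounded_linear_inner_left])
      show "Ck_on k E M (\<lambda>x. dirderiv g x v)" using Suc.prems v by simp
      fix b assume "b \<in> B"
      then have "Ck_on k F N (\<lambda>x. dirderiv f x b)" using Suc.prems B by auto
      then show "Ck_on k E M (\<lambda>x. dirderiv f (g x) b)"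
        by (rule Suc.IH) (use Suc.prems Ck_on_SucD in blast)+
    qed
    ultimately show ?thesis
      by (rule Ck_on_transform[rotated])
  qed
  moreover have "(\<lambda>x. f (g x)) differentiable_on M"
    using differentiable_compose[OF f g] Suc.prems(3) by blast
  ultimately show ?case by simp
qed

lemma smooth_compose:
  fixes f :: "'b::euclidean_space \<Rightarrow> 'c::real_normed_vector"
  assumes "linear_domain F N" "smooth_fun F N f" "smooth_fun E M g" "\<And>x. x \<in> M \<Longrightarrow> g x \<in> N"
  shows "smooth_fun E M (\<lambda>x. f (g x))"
  unfolding smooth_fun_def
  by (rule allI, rule Ck_on_compose[OF assms(1), of _ f g]) (use assms in \<open>auto simp: smooth_fun_def\<close>)

end

section \<open>Real powers, square roots and quotients of smooth functions\<close>

lemma linear_domain_UNIV: "open M \<Longrightarrow> linear_domain UNIV M"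
  by unfold_locales simp_all

text \<open>Differentiation lowers the exponent and multiplies by a constant, so the induction on
  \<open>k\<close> closes with \<open>s\<close> arbitrary. The exponents 1/2 and -1 give square
  roots and reciprocals.\<close>

lemma smooth_powr: "smooth_fun UNIV {0<..} (\<lambda>x::real. x powr s)"
proof -
  interpret linear_domain UNIV "{0::real<..}" by (rule linear_domain_UNIV) simp
  have deriv: "((\<lambda>x::real. x powr s) has_derivative (\<lambda>v. v * (s * x powr (s - 1)))) (at x within {0<..})"
    if "x > 0" for x s
  proof -
    have "(*) (s * x powr (s - 1)) = (\<lambda>v. v * (s * x powr (s - 1)))"
      by (simp add: fun_eq_iff)
    then show ?thesis
      using has_real_derivative_powr[OF that, of s]
      by (metis has_field_derivative_def has_derivative_at_withinI)
  qed
  have diff: "(\<lambda>x::real. x powr s) differentiable_on {0<..}" for s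
    using deriv by (auto simp: differentiable_on_def differentiable_def)
  have "Ck_on k UNIV {0<..} (\<lambda>x::real. x powr s)" for k
  proof (induction k arbitrary: s)
    case 0
    then show ?case by (simp add: differentiable_imp_continuous_on diff)
  next
    case (Suc k)
    have "Ck_on k UNIV {0<..} (\<lambda>x. dirderiv (\<lambda>x::real. x powr s) x v)" for v
    proof -
      have "Ck_on k UNIV {0<..} (\<lambda>x. v * (s * x powr (s - 1)))"
        by (intro Ck_on_bounded_linear[OF bounded_linear_mult_right] Suc)
      moreover have "dirderiv (\<lambda>x::real. x powr s) x v = v * (s * x powr (s - 1))" if "x \<in> {0<..}" for x
        using dirderiv_eq[OF deriv] that by simp
      ultimately show ?thesis by (rule Ck_on_transform)
    qed
    then show ?case by (simp add: diff)
  qed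
  then show ?thesis by (simp add: smooth_fun_def)
qed

context linear_domain
begin

lemma smooth_powr_compose:
  fixes f :: "'a \<Rightarrow> real"
  assumes "smooth_fun E M f" "\<And>x. x \<in> M \<Longrightarrow> f x > 0"
  shows "smooth_fun E M (\<lambda>x. f x powr s)"
  using smooth_compose[OF linear_domain_UNIV smooth_powr assms(1)] assms(2) by simp

lemma smooth_sqrt:
  assumes "smooth_fun E M f" "\<And>x. x \<in> M \<Longrightarrow> f x > 0"
  shows "smooth_fun E M (\<lambda>x. sqrt (f x))"
  using smooth_powr_compose[OF assms, of "1/2"] smooth_cong[of "\<lambda>x. f x powr (1/2)" "\<lambda>x. sqrt (f x)"]
  by (simp add: powr_half_sqrt less_imp_le assms(2))

lemma smooth_divide:
  fixes f g :: "'a \<Rightarrow> real"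
  assumes "smooth_fun E M f" "smooth_fun E M g" "\<And>x. x \<in> M \<Longrightarrow> g x > 0"
  shows "smooth_fun E M (\<lambda>x. f x / g x)"
  using smooth_mult[OF assms(1) smooth_powr_compose[OF assms(2,3), of "-1"]]
    smooth_cong[of "\<lambda>x. f x * g x powr -1" "\<lambda>x. f x / g x"]
  by (simp add: powr_minus_divide less_imp_le assms(3))

subsection \<open>Symmetry of second derivatives\<close>

text \<open>The mean value theorem is used twice: in direction \<open>v\<close> for the difference
  of \<open>g\<close> along two parallel segments, then in direction \<open>u\<close> for the
  derivative of \<open>g\<close> along \<open>v\<close>.\<close>

lemma double_difference:
  fixes g :: "'a \<Rightarrow> real"
  assumes g: "smooth_fun E M g" and x: "x \<in> E" "u \<in> E" "v \<in> E" and s: "s > 0"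
    and M: "\<And>a b. 0 \<le> a \<Longrightarrow> a \<le> s \<Longrightarrow> 0 \<le> b \<Longrightarrow> b \<le> s \<Longrightarrow> x + a *\<^sub>R u + b *\<^sub>R v \<in> M"
  obtains a b where "0 < a" "a < s" "0 < b" "b < s"
    "g (x + s *\<^sub>R u + s *\<^sub>R v) - g (x + s *\<^sub>R u) - g (x + s *\<^sub>R v) + g x =
     s\<^sup>2 * dirderiv (\<lambda>p. dirderiv g p v) (x + a *\<^sub>R u + b *\<^sub>R v) u"
proof -
  have E: "x + a *\<^sub>R u \<in> E" "x + a *\<^sub>R v \<in> E" for a
    using x subspace_E by (auto intro: subspace_add subspace_scale)
  have "((\<lambda>b. g (x + a *\<^sub>R u + b *\<^sub>R v)) has_real_derivative dirderiv g (x + a *\<^sub>R u + b *\<^sub>R v) v) (at b)"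
    if "0 \<le> a" "a \<le> s" "0 \<le> b" "b \<le> s" for a b
    using dirderiv_line[OF smooth_differentiable[OF g] E(1) x(3) M[OF that]]
    by (simp add: has_real_derivative_iff_has_vector_derivative)
  from this[of s] this[of 0]
  have "((\<lambda>b. g (x + s *\<^sub>R u + b *\<^sub>R v) - g (x + b *\<^sub>R v)) has_real_derivative
      dirderiv g (x + s *\<^sub>R u + b *\<^sub>R v) v - dirderiv g (x + b *\<^sub>R v) v) (at b)"
    if "0 \<le> b" "b \<le> s" for b
    using that s by (auto intro!: DERIV_diff)
  from MVT2[OF s this] obtain b where b: "0 < b" "b < s"
    "g (x + s *\<^sub>R u + s *\<^sub>R v) - g (x + s *\<^sub>R v) - (g (x + s *\<^sub>R u) - g x) =
     s * (dirderiv g (x + s *\<^sub>R u + b *\<^sub>R v) v - dirderiv g (x + b *\<^sub>R v) v)"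
    by auto
  have "((\<lambda>a. dirderiv g (x + b *\<^sub>R v + a *\<^sub>R u) v) has_real_derivative
      dirderiv (\<lambda>p. dirderiv g p v) (x + b *\<^sub>R v + a *\<^sub>R u) u) (at a)"
    if "0 \<le> a" "a \<le> s" for a
    using dirderiv_line[OF smooth_differentiable[OF smooth_dirderiv[OF g x(3)]] E(2)[of b] x(2), of a]
      M[OF that, of b] b
    by (simp add: has_real_derivative_iff_has_vector_derivative add_ac)
  from MVT2[OF s this] obtain a where a: "0 < a" "a < s"
    "dirderiv g (x + b *\<^sub>R v + s *\<^sub>R u) v - dirderiv g (x + b *\<^sub>R v) v =
     s * dirderiv (\<lambda>p. dirderiv g p v) (x + b *\<^sub>R v + a *\<^sub>R u) u"
    by auto
  have "g (x + s *\<^sub>R u + s *\<^sub>R v) - g (x + s *\<^sub>R u) - g (x + s *\<^sub>R v) + g x =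
     s * (dirderiv g (x + b *\<^sub>R v + s *\<^sub>R u) v - dirderiv g (x + b *\<^sub>R v) v)"
    using b(3) by (simp add: add_ac)
  also have "\<dots> = s\<^sup>2 * dirderiv (\<lambda>p. dirderiv g p v) (x + a *\<^sub>R u + b *\<^sub>R v) u"
    unfolding a(3) by (simp add: power2_eq_square add_ac)
  finally show ?thesis using that a b by blast
qed

text \<open>The second difference over a small parallelogram is symmetric in \<open>u\<close> and
  \<open>v\<close>, and equals \<open>s\<^sup>2\<close> times either mixed derivative at a nearby
  point. Continuity at \<open>x\<close> then excludes different values.\<close>

lemma dirderiv_commute:
  fixes g :: "'a \<Rightarrow> real"
  assumes g: "smooth_fun E M g" and x: "x \<in> M" and u: "u \<in> E" and v: "v \<in> E"
  shows "dirderiv (\<lambda>p. dirderiv g p v) x u = dirderiv (\<lambda>p. dirderiv g p u) x v"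
proof (rule ccontr)
  let ?A = "\<lambda>p. dirderiv (\<lambda>p. dirderiv g p v) p u"
  let ?B = "\<lambda>p. dirderiv (\<lambda>p. dirderiv g p u) p v"
  assume neq: "?A x \<noteq> ?B x"
  define e where "e = dist (?A x) (?B x) / 2"
  have e: "e > 0" using neq by (simp add: e_def)
  have "continuous_on M ?A" "continuous_on M ?B"
    using g u v by (auto intro!: smooth_continuous smooth_dirderiv)
  then obtain dA dB where d: "dA > 0" "dB > 0"
    "\<And>p. p \<in> M \<Longrightarrow> dist p x < dA \<Longrightarrow> dist (?A p) (?A x) < e"
    "\<And>p. p \<in> M \<Longrightarrow> dist p x < dB \<Longrightarrow> dist (?B p) (?B x) < e"
    using e x unfolding continuous_on_iff by metis
  obtain dM where dM: "dM > 0" "\<And>p. p \<in> E \<Longrightarrow> dist p x < dM \<Longrightarrow> p \<in> M"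
    using openin_M x by (meson openin_euclidean_subtopology_iff)
  define r where "r = min dM (min dA dB)"
  \<comment> \<open>This keeps the parallelogram spanned by \<open>s *\<^sub>R u\<close> and
    \<open>s *\<^sub>R v\<close> within distance \<open>r\<close> of \<open>x\<close>; the summand 1
    guards against \<open>u = v = 0\<close>.\<close>
  define s where "s = r / (norm u + norm v + 1)"
  have r: "r > 0" using d dM by (simp add: r_def)
  have s: "s > 0" using r by (simp add: s_def add_nonneg_pos)
  have near: "dist (x + a *\<^sub>R u + b *\<^sub>R v) x < r" if "0 \<le> a" "a \<le> s" "0 \<le> b" "b \<le> s" for a b
  proof -
    have "dist (x + a *\<^sub>R u + b *\<^sub>R v) x \<le> a * norm u + b * norm v"
      using norm_triangle_ineq[of "a *\<^sub>R u" "b *\<^sub>R v"] that by (simp add: dist_norm add.assoc)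
    also have "\<dots> \<le> s * norm u + s * norm v"
      using that by (intro add_mono mult_right_mono) auto
    also have "\<dots> < s * (norm u + norm v + 1)"
      using s by (simp add: algebra_simps)
    finally have less: "dist (x + a *\<^sub>R u + b *\<^sub>R v) x < s * (norm u + norm v + 1)" .
    have "norm u + norm v + 1 \<noteq> 0"
      using norm_ge_zero[of u] norm_ge_zero[of v] by linarith
    then have "s * (norm u + norm v + 1) = r" unfolding s_def by simp
    with less show ?thesis by simp
  qed
  have inM: "x + a *\<^sub>R u + b *\<^sub>R v \<in> M" if "0 \<le> a" "a \<le> s" "0 \<le> b" "b \<le> s" for a b
    using near[OF that] dM(2)[of "x + a *\<^sub>R u + b *\<^sub>R v"] u v in_E[OF x] subspace_E
    by (auto simp: r_def intro: subspace_add subspace_scale)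
  obtain a b where ab: "0 < a" "a < s" "0 < b" "b < s"
    "g (x + s *\<^sub>R u + s *\<^sub>R v) - g (x + s *\<^sub>R u) - g (x + s *\<^sub>R v) + g x = s\<^sup>2 * ?A (x + a *\<^sub>R u + b *\<^sub>R v)"
    using double_difference[OF g in_E[OF x] u v s] inM by blast
  have inM': "x + a *\<^sub>R v + b *\<^sub>R u \<in> M" if "0 \<le> a" "a \<le> s" "0 \<le> b" "b \<le> s" for a b
    using inM[OF that(3,4,1,2)] by (simp add: add_ac)
  obtain b' a' where ab': "0 < b'" "b' < s" "0 < a'" "a' < s"
    "g (x + s *\<^sub>R v + s *\<^sub>R u) - g (x + s *\<^sub>R v) - g (x + s *\<^sub>R u) + g x = s\<^sup>2 * ?B (x + b' *\<^sub>R v + a' *\<^sub>R u)"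
    using double_difference[OF g in_E[OF x] v u s] inM' by blast
  have e1: "x + s *\<^sub>R v + s *\<^sub>R u = x + s *\<^sub>R u + s *\<^sub>R v"
    and e2: "x + b' *\<^sub>R v + a' *\<^sub>R u = x + a' *\<^sub>R u + b' *\<^sub>R v"
    by (simp_all add: add_ac)
  have "s\<^sup>2 * ?A (x + a *\<^sub>R u + b *\<^sub>R v) = s\<^sup>2 * ?B (x + a' *\<^sub>R u + b' *\<^sub>R v)"
    using ab(5) ab'(5) unfolding e1 e2 by linarith
  then have "?A (x + a *\<^sub>R u + b *\<^sub>R v) = ?B (x + a' *\<^sub>R u + b' *\<^sub>R v)"
    using s by simp
  moreover have "dist (?A (x + a *\<^sub>R u + b *\<^sub>R v)) (?A x) < e" "dist (?B (x + a' *\<^sub>R u + b' *\<^sub>R v)) (?B x) < e"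
    using near[of a b] near[of a' b'] ab ab' by (auto intro!: d inM simp: r_def)
  ultimately have "dist (?A x) (?B x) < e + e"
    by (metis dist_triangle_less_add dist_commute)
  then show False by (simp add: e_def)
qed

text \<open>Separates the second derivative with \<open>Y x\<close> frozen, which is symmetric, from
  a first-order term whose antisymmetrisation is the Lie bracket.\<close>

lemma dirderiv_dirderiv_field:
  fixes z :: "'a \<Rightarrow> real"
  assumes z: "smooth_fun E M z" and Y: "smooth_fun E M Y" "\<And>p. p \<in> M \<Longrightarrow> Y p \<in> E"
    and x: "x \<in> M" "u \<in> E"
  shows "dirderiv (\<lambda>p. dirderiv z p (Y p)) x u =
    dirderiv z x (dirderiv Y x u) + dirderiv (\<lambda>p. dirderiv z p (Y x)) x u"
proof -
  obtain B where B: "finite B" "B \<subseteq> E" "\<And>v. v \<in> E \<Longrightarrow> (\<Sum>b\<in>B. (v \<bullet> b) *\<^sub>R b) = v"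
    using obtain_basis by blast
  have expand: "dirderiv z p w = (\<Sum>b\<in>B. (w \<bullet> b) * dirderiv z p b)" if "p \<in> M" "w \<in> E" for p w
    using dirderiv_sum[OF smooth_differentiable[OF z] that(1), of B "\<lambda>b. b" "\<lambda>b. w \<bullet> b"] B(2) B(3)[OF that(2)]
    by (auto simp: subset_iff)
  have sum: "dirderiv (\<lambda>p. \<Sum>b\<in>C. f b p) x u = (\<Sum>b\<in>C. dirderiv (f b) x u)"
    if "\<And>b. b \<in> C \<Longrightarrow> smooth_fun E M (f b)" "finite C" for C and f :: "'a \<Rightarrow> 'a \<Rightarrow> real"
    using that(2,1)
  proof (induction C)
    case empty
    then show ?case by (simp add: dirderiv_def)
  next
    case (insert c C)
    then show ?case using x
      by (simp add: dirderiv_add[OF smooth_differentiable smooth_differentiable[OF smooth_sum]])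
  qed
  have sm: "smooth_fun E M (\<lambda>p. dirderiv z p b)" if "b \<in> B" for b
    using that B(2) by (auto intro: smooth_dirderiv z)
  have smY: "smooth_fun E M (\<lambda>p. Y p \<bullet> b)" for b
    by (intro smooth_bounded_linear[OF bounded_linear_inner_left] Y)
  have dY: "dirderiv Y x u \<in> E"
    using dirderiv_in[OF subspace_E smooth_differentiable[OF Y(1)] Y(2) x] by blast
  have "dirderiv (\<lambda>p. dirderiv z p (Y p)) x u = dirderiv (\<lambda>p. \<Sum>b\<in>B. (Y p \<bullet> b) * dirderiv z p b) x u"
    by (rule dirderiv_cong[OF x]) (simp add: expand Y)
  also have "\<dots> = (\<Sum>b\<in>B. dirderiv (\<lambda>p. (Y p \<bullet> b) * dirderiv z p b) x u)"
    using B(1) by (intro sum smooth_mult sm smY)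
  also have "\<dots> = (\<Sum>b\<in>B. (dirderiv Y x u \<bullet> b) * dirderiv z x b + (Y x \<bullet> b) * dirderiv (\<lambda>p. dirderiv z p b) x u)"
  proof (rule sum.cong[OF refl])
    fix b assume b: "b \<in> B"
    have "dirderiv (\<lambda>p. Y p \<bullet> b) x u = dirderiv Y x u \<bullet> b"
      by (rule dirderiv_bounded_linear[OF bounded_linear_inner_left smooth_differentiable[OF Y(1)] x])
    then show "dirderiv (\<lambda>p. (Y p \<bullet> b) * dirderiv z p b) x u =
        (dirderiv Y x u \<bullet> b) * dirderiv z x b + (Y x \<bullet> b) * dirderiv (\<lambda>p. dirderiv z p b) x u"
      using dirderiv_bilinear[OF bounded_bilinear_mult smooth_differentiable[OF smY]
          smooth_differentiable[OF sm[OF b]] x, of b] by simp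
  qed
  also have "\<dots> = dirderiv z x (dirderiv Y x u) + (\<Sum>b\<in>B. (Y x \<bullet> b) * dirderiv (\<lambda>p. dirderiv z p b) x u)"
    by (simp add: sum.distrib expand[OF x(1) dY])
  also have "(\<Sum>b\<in>B. (Y x \<bullet> b) * dirderiv (\<lambda>p. dirderiv z p b) x u) =
      (\<Sum>b\<in>B. dirderiv (\<lambda>p. (Y x \<bullet> b) * dirderiv z p b) x u)"
    by (rule sum.cong[OF refl])
      (rule dirderiv_bounded_linear[OF bounded_linear_mult_right smooth_differentiable[OF sm] x, symmetric])
  also have "\<dots> = dirderiv (\<lambda>p. \<Sum>b\<in>B. (Y x \<bullet> b) * dirderiv z p b) x u"
    using B(1) by (intro sum[symmetric] smooth_mult smooth_const sm)
  also have "\<dots> = dirderiv (\<lambda>p. dirderiv z p (Y x)) x u"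
    by (rule dirderiv_cong[OF x]) (simp add: expand Y x)
  finally show ?thesis .
qed

end

subsection \<open>Vector fields and diffeomorphisms\<close>

context linear_domain
begin

lemma vfieldsI:
  "smooth_fun E M X \<Longrightarrow> (\<And>x. x \<in> M \<Longrightarrow> X x \<in> E) \<Longrightarrow> (\<And>x. x \<notin> M \<Longrightarrow> X x = 0) \<Longrightarrow> X \<in> vfields E M"
  by (simp add: vfields_def)

lemma vfield_smooth: "X \<in> vfields E M \<Longrightarrow> smooth_fun E M X"
  and vfield_in: "X \<in> vfields E M \<Longrightarrow> x \<in> M \<Longrightarrow> X x \<in> E"
  and vfield_out: "X \<in> vfields E M \<Longrightarrow> x \<notin> M \<Longrightarrow> X x = 0"
  by (simp_all add: vfields_def)

lemma vfield_in': "X \<in> vfields E M \<Longrightarrow> X x \<in> E"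
  using vfield_in vfield_out subspace_0[OF subspace_E] by metis

lemma vfield_diff_on: "X \<in> vfields E M \<Longrightarrow> X differentiable_on M"
  by (intro smooth_differentiable vfield_smooth)

lemma vfield_zero: "(\<lambda>_. 0) \<in> vfields E M"
  by (intro vfieldsI smooth_const) (auto simp: subspace_0[OF subspace_E])

lemma vfield_add: "X \<in> vfields E M \<Longrightarrow> Y \<in> vfields E M \<Longrightarrow> (\<lambda>x. X x + Y x) \<in> vfields E M"
  by (rule vfieldsI, intro smooth_add vfield_smooth) (auto simp: vfield_in vfield_out subspace_add[OF subspace_E])

lemma vfield_scaleR: "smooth_fun E M f \<Longrightarrow> X \<in> vfields E M \<Longrightarrow> (\<lambda>x. f x *\<^sub>R X x) \<in> vfields E M"
  by (rule vfieldsI, intro smooth_scaleR vfield_smooth) (auto simp: vfield_in vfield_out subspace_scale[OF subspace_E])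

lemma vfield_sum:
  "(\<And>i. i \<in> I \<Longrightarrow> X i \<in> vfields E M) \<Longrightarrow> (\<lambda>x. \<Sum>i\<in>I. X i x) \<in> vfields E M"
  by (induction I rule: infinite_finite_induct) (auto intro: vfield_zero vfield_add)

lemma vfield_const: "u \<in> E \<Longrightarrow> const_field M u \<in> vfields E M"
  by (rule vfieldsI) (auto simp: const_field_def smooth_const smooth_cong[of "\<lambda>x. if x \<in> M then u else 0" "\<lambda>_. u"])

lemma dirderiv_zero: "dirderiv f x 0 = 0"
  by (simp add: dirderiv_def)

lemma vfield_lie_bracket:
  assumes "X \<in> vfields E M" "Y \<in> vfields E M"
  shows "lie_bracket X Y \<in> vfields E M"
proof (rule vfieldsI)
  show "smooth_fun E M (lie_bracket X Y)"
    unfolding lie_bracket_def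
    by (intro smooth_diff smooth_dirderiv_field vfield_smooth assms vfield_in)
  show "lie_bracket X Y x \<in> E" if "x \<in> M" for x
    unfolding lie_bracket_def
    by (intro subspace_diff[OF subspace_E] dirderiv_in[OF subspace_E] vfield_diff_on
        vfield_in[OF assms(1)] vfield_in[OF assms(2)] assms that)
  show "lie_bracket X Y x = 0" if "x \<notin> M" for x
    using that by (simp add: lie_bracket_def vfield_out[OF assms(1)] vfield_out[OF assms(2)] dirderiv_zero)
qed

end

locale linear_diffeo = M: linear_domain E M + N: linear_domain F N
  for E M F N :: "'a::euclidean_space set" +
  fixes f g :: "'a \<Rightarrow> 'a"
  assumes f_in: "x \<in> M \<Longrightarrow> f x \<in> N" and g_in: "y \<in> N \<Longrightarrow> g y \<in> M"
    and g_f: "x \<in> M \<Longrightarrow> g (f x) = x" and f_g: "y \<in> N \<Longrightarrow> f (g y) = y"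
    and f_smooth: "smooth_fun E M f" and g_smooth: "smooth_fun F N g"
begin

lemma inverse_diffeo: "linear_diffeo F N E M g f"
  by unfold_locales (auto simp: f_in g_in g_f f_g f_smooth g_smooth)

lemma inv_into_eq: "y \<in> N \<Longrightarrow> inv_into M f y = g y"
  by (rule inv_into_f_eq) (auto simp: f_g g_in intro!: inj_on_inverseI[of M g f] g_f)

lemma push_eq: "y \<in> N \<Longrightarrow> pushforward f M N X y = dirderiv f (g y) (X (g y))"
  by (simp add: pushforward_def inv_into_eq)

lemma push_at: "x \<in> M \<Longrightarrow> pushforward f M N X (f x) = dirderiv f x (X x)"
  by (simp add: push_eq f_in g_f)

lemma dirderiv_f_in: "x \<in> M \<Longrightarrow> v \<in> E \<Longrightarrow> dirderiv f x v \<in> F"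
  using M.dirderiv_in[OF N.subspace_E M.smooth_differentiable[OF f_smooth]] f_in N.in_E by blast

lemma dirderiv_inverse:
  assumes "x \<in> M" "v \<in> E"
  shows "dirderiv g (f x) (dirderiv f x v) = v"
proof -
  have "dirderiv g (f x) (dirderiv f x v) = dirderiv (\<lambda>y. g (f y)) x v"
    by (rule M.dirderiv_compose[OF N.linear_domain_axioms N.smooth_differentiable[OF g_smooth]
        M.smooth_differentiable[OF f_smooth] _ assms, symmetric]) (rule f_in)
  also have "\<dots> = dirderiv (\<lambda>y. y) x v"
    by (rule M.dirderiv_cong[OF assms]) (rule g_f)
  also have "\<dots> = v"
    by (rule M.dirderiv_eq[OF has_derivative_ident assms])
  finally show ?thesis .
qed

lemma push_vfield:
  assumes X: "X \<in> vfields E M"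
  shows "pushforward f M N X \<in> vfields F N"
proof (rule N.vfieldsI)
  have "smooth_fun F N (\<lambda>y. dirderiv f (g y) (X (g y)))"
    by (rule N.smooth_compose[OF M.linear_domain_axioms _ g_smooth g_in,
          where f = "\<lambda>x. dirderiv f x (X x)"])
      (intro M.smooth_dirderiv_field f_smooth M.vfield_smooth M.vfield_in X)
  then show "smooth_fun F N (pushforward f M N X)"
    by (rule N.smooth_transform) (rule push_eq)
qed (auto simp: push_eq X M.vfield_in dirderiv_f_in g_in, simp add: pushforward_def)

lemma push_push:
  assumes X: "X \<in> vfields E M"
  shows "pushforward g N M (pushforward f M N X) = X"
proof -
  interpret inv: linear_diffeo F N E M g f by (rule inverse_diffeo)
  show ?thesis
  proof
    fix x show "pushforward g N M (pushforward f M N X) x = X x"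
      using X by (cases "x \<in> M")
        (simp_all add: inv.push_eq push_at dirderiv_inverse M.vfield_in M.vfield_out, simp add: pushforward_def)
  qed
qed

lemma dirderiv_push:
  assumes z: "z differentiable_on N" and x: "x \<in> M" and v: "v \<in> E"
  shows "dirderiv z (f x) (dirderiv f x v) = dirderiv (\<lambda>p. z (f p)) x v"
  by (rule M.dirderiv_compose[OF N.linear_domain_axioms z
        M.smooth_differentiable[OF f_smooth] _ x v, symmetric]) (rule f_in)

end

subsection \<open>Connections with a parallel frame\<close>

text \<open>\<open>\<theta>\<close> is the coframe dual to \<open>e\<close>. Its linearity is stated
  on \<open>E\<close>, where tangent vectors live, and its smoothness through evaluation on
  fields.\<close>

locale parallel_frame = linear_domain E M for E M :: "'a::euclidean_space set" +
  fixes I :: "'i set" and e :: "'i \<Rightarrow> 'a \<Rightarrow> 'a" and \<theta> :: "'i \<Rightarrow> 'a \<Rightarrow> 'a \<Rightarrow> real"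
  assumes finite_I: "finite I"
    and e_vfield: "i \<in> I \<Longrightarrow> e i \<in> vfields E M"
    and coframe_smooth: "i \<in> I \<Longrightarrow> Y \<in> vfields E M \<Longrightarrow> smooth_fun E M (\<lambda>x. \<theta> i x (Y x))"
    and coframe_add: "i \<in> I \<Longrightarrow> x \<in> M \<Longrightarrow> u \<in> E \<Longrightarrow> v \<in> E \<Longrightarrow> \<theta> i x (u + v) = \<theta> i x u + \<theta> i x v"
    and coframe_scaleR: "i \<in> I \<Longrightarrow> x \<in> M \<Longrightarrow> v \<in> E \<Longrightarrow> \<theta> i x (c *\<^sub>R v) = c * \<theta> i x v"
    and frame_expand: "x \<in> M \<Longrightarrow> v \<in> E \<Longrightarrow> (\<Sum>i\<in>I. \<theta> i x v *\<^sub>R e i x) = v"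
    and coframe_frame: "i \<in> I \<Longrightarrow> j \<in> I \<Longrightarrow> x \<in> M \<Longrightarrow> \<theta> i x (e j x) = (if i = j then 1 else 0)"
begin

text \<open>Differentiates the frame coefficients of \<open>Y\<close> along \<open>X\<close>. The
  value 0 off smooth fields matches the normalisation in \<open>nabla_H\<close>.\<close>

definition conn :: "'a connection" where
  "conn X Y = (\<lambda>x. if X \<in> vfields E M \<and> Y \<in> vfields E M
     then \<Sum>i\<in>I. dirderiv (\<lambda>p. \<theta> i p (Y p)) x (X x) *\<^sub>R e i x else 0)"

lemma conn_eq:
  "X \<in> vfields E M \<Longrightarrow> Y \<in> vfields E M \<Longrightarrow>
    conn X Y = (\<lambda>x. \<Sum>i\<in>I. dirderiv (\<lambda>p. \<theta> i p (Y p)) x (X x) *\<^sub>R e i x)"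
  by (simp add: conn_def)

lemma conn_eq_0: "X \<notin> vfields E M \<or> Y \<notin> vfields E M \<Longrightarrow> conn X Y = (\<lambda>_. 0)"
  by (auto simp: conn_def)

lemma coframe_diff_on:
  "i \<in> I \<Longrightarrow> Y \<in> vfields E M \<Longrightarrow> (\<lambda>x. \<theta> i x (Y x)) differentiable_on M"
  by (intro smooth_differentiable coframe_smooth)

lemma coframe_0: "i \<in> I \<Longrightarrow> x \<in> M \<Longrightarrow> \<theta> i x 0 = 0"
  using coframe_scaleR[of i x 0 0] subspace_0[OF subspace_E] by simp

lemma coframe_sum:
  assumes "i \<in> I" "x \<in> M" "\<And>j. j \<in> J \<Longrightarrow> w j \<in> E"
  shows "\<theta> i x (\<Sum>j\<in>J. c j *\<^sub>R w j) = (\<Sum>j\<in>J. c j * \<theta> i x (w j))"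
  using assms(3)
  by (induction J rule: infinite_finite_induct)
    (simp_all add: coframe_0 assms coframe_add coframe_scaleR subspace_sum subspace_scale subspace_E)

lemma coframe_sum_frame:
  assumes "i \<in> I" "x \<in> M"
  shows "\<theta> i x (\<Sum>j\<in>I. c j *\<^sub>R e j x) = c i"
proof -
  have "\<theta> i x (\<Sum>j\<in>I. c j *\<^sub>R e j x) = (\<Sum>j\<in>I. c j * \<theta> i x (e j x))"
    using assms by (intro coframe_sum) (auto intro: vfield_in e_vfield)
  also have "\<dots> = (\<Sum>j\<in>I. if j = i then c i else 0)"
    using assms by (intro sum.cong) (auto simp: coframe_frame)
  finally show ?thesis using assms finite_I by simp
qed

lemma coframe_inj:
  assumes "x \<in> M" "u \<in> E" "v \<in> E" "\<And>i. i \<in> I \<Longrightarrow> \<theta> i x u = \<theta> i x v"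
  shows "u = v"
proof -
  have "u = (\<Sum>i\<in>I. \<theta> i x u *\<^sub>R e i x)" by (rule frame_expand[OF assms(1,2), symmetric])
  also have "\<dots> = (\<Sum>i\<in>I. \<theta> i x v *\<^sub>R e i x)" by (rule sum.cong[OF refl]) (simp only: assms(4))
  also have "\<dots> = v" by (rule frame_expand[OF assms(1,3)])
  finally show ?thesis .
qed

lemma vfield_dirderiv:
  fixes h :: "'a \<Rightarrow> 'b::real_normed_vector"
  shows "smooth_fun E M h \<Longrightarrow> X \<in> vfields E M \<Longrightarrow> smooth_fun E M (\<lambda>x. dirderiv h x (X x))"
  by (intro smooth_dirderiv_field vfield_smooth) (auto intro: vfield_in)

lemma conn_vfield: "X \<in> vfields E M \<Longrightarrow> Y \<in> vfields E M \<Longrightarrow> conn X Y \<in> vfields E M"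
  by (simp add: conn_eq) (intro vfield_sum vfield_scaleR vfield_dirderiv coframe_smooth e_vfield)

lemma coframe_conn:
  "i \<in> I \<Longrightarrow> x \<in> M \<Longrightarrow> X \<in> vfields E M \<Longrightarrow> Y \<in> vfields E M \<Longrightarrow>
    \<theta> i x (conn X Y x) = dirderiv (\<lambda>p. \<theta> i p (Y p)) x (X x)"
  by (simp add: conn_eq coframe_sum_frame)

lemma vfield_eqI:
  assumes "X \<in> vfields E M" "Y \<in> vfields E M"
    and "\<And>i x. i \<in> I \<Longrightarrow> x \<in> M \<Longrightarrow> \<theta> i x (X x) = \<theta> i x (Y x)"
  shows "X = Y"
proof
  fix x show "X x = Y x"
    using assms(3) vfield_out[OF assms(1)] vfield_out[OF assms(2)]
      coframe_inj[of x "X x" "Y x"] vfield_in[OF assms(1)] vfield_in[OF assms(2)]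
    by (cases "x \<in> M") auto
qed

text \<open>By \<open>vfield_eqI\<close> each identity can be tested on coframe coefficients, where
  it becomes linearity in the direction, additivity or the product rule for real functions.\<close>

lemma affine_conn: "affine_connection E M conn"
  unfolding affine_connection_def
proof (intro conjI ballI allI impI)
  fix X Y X' Y' and h :: "'a \<Rightarrow> real"
  assume X: "X \<in> vfields E M" and Y: "Y \<in> vfields E M"
  show "conn X Y \<in> vfields E M" by (rule conn_vfield[OF X Y])
  show "conn (\<lambda>x. X x + X' x) Y = (\<lambda>x. conn X Y x + conn X' Y x)" if X': "X' \<in> vfields E M"
    by (rule vfield_eqI)
      (simp_all add: X X' Y conn_vfield vfield_add coframe_conn coframe_add vfield_in
        dirderiv_add_dir coframe_diff_on)
  show "conn (\<lambda>x. h x *\<^sub>R X x) Y = (\<lambda>x. h x *\<^sub>R conn X Y x)" if h: "smooth_fun E M h"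
    by (rule vfield_eqI)
      (simp_all add: X Y h conn_vfield vfield_scaleR coframe_conn coframe_scaleR vfield_in
        dirderiv_scaleR_dir coframe_diff_on)
  show "conn X (\<lambda>x. Y x + Y' x) = (\<lambda>x. conn X Y x + conn X Y' x)" if Y': "Y' \<in> vfields E M"
  proof (rule vfield_eqI)
    fix i x assume ix: "i \<in> I" "x \<in> M"
    have "dirderiv (\<lambda>p. \<theta> i p (Y p + Y' p)) x (X x) =
        dirderiv (\<lambda>p. \<theta> i p (Y p) + \<theta> i p (Y' p)) x (X x)"
      by (rule dirderiv_cong) (simp_all add: ix X Y Y' vfield_in coframe_add)
    then show "\<theta> i x (conn X (\<lambda>x. Y x + Y' x) x) = \<theta> i x (conn X Y x + conn X Y' x)"
      by (simp add: ix X Y Y' conn_vfield vfield_add coframe_conn coframe_add vfield_in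
          dirderiv_add coframe_diff_on)
  qed (simp_all add: X Y Y' conn_vfield vfield_add)
  show "conn X (\<lambda>x. h x *\<^sub>R Y x) = (\<lambda>x. dirderiv h x (X x) *\<^sub>R Y x + h x *\<^sub>R conn X Y x)"
    if h: "smooth_fun E M h"
  proof (rule vfield_eqI)
    have h': "smooth_fun E M (\<lambda>x. dirderiv h x (X x))" by (rule vfield_dirderiv[OF h X])
    show "(\<lambda>x. dirderiv h x (X x) *\<^sub>R Y x + h x *\<^sub>R conn X Y x) \<in> vfields E M"
      by (intro vfield_add vfield_scaleR h h' X Y conn_vfield)
    fix i x assume ix: "i \<in> I" "x \<in> M"
    have "dirderiv (\<lambda>p. \<theta> i p (h p *\<^sub>R Y p)) x (X x) =
        dirderiv (\<lambda>p. h p * \<theta> i p (Y p)) x (X x)"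
      by (rule dirderiv_cong) (simp_all add: ix X Y vfield_in coframe_scaleR)
    also have "\<dots> = h x * dirderiv (\<lambda>p. \<theta> i p (Y p)) x (X x) + dirderiv h x (X x) * \<theta> i x (Y x)"
      by (rule dirderiv_bilinear[OF bounded_bilinear_mult])
        (simp_all add: ix X Y h vfield_in coframe_diff_on smooth_differentiable)
    finally show "\<theta> i x (conn X (\<lambda>x. h x *\<^sub>R Y x) x) =
        \<theta> i x (dirderiv h x (X x) *\<^sub>R Y x + h x *\<^sub>R conn X Y x)"
      by (simp add: ix X Y h conn_vfield vfield_scaleR coframe_conn coframe_add coframe_scaleR
          vfield_in subspace_scale subspace_E)
  qed (simp add: X Y h conn_vfield vfield_scaleR)
qed

text \<open>In a parallel frame the curvature acts on coefficients as \<open>XY - YX - [X,Y]\<close>, which vanishes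
  by symmetry of second derivatives.\<close>

lemma flat_conn: "flat_connection E M conn"
  unfolding flat_connection_def
proof (intro ballI)
  fix X Y Z x
  assume X: "X \<in> vfields E M" and Y: "Y \<in> vfields E M" and Z: "Z \<in> vfields E M" and x: "x \<in> M"
  have second: "dirderiv (\<lambda>p. \<theta> i p (conn V Z p)) x (U x) =
      dirderiv (\<lambda>p. \<theta> i p (Z p)) x (dirderiv V x (U x)) +
      dirderiv (\<lambda>p. dirderiv (\<lambda>p. \<theta> i p (Z p)) p (V x)) x (U x)"
    if i: "i \<in> I" and U: "U \<in> vfields E M" and V: "V \<in> vfields E M" for i U V
  proof -
    have "dirderiv (\<lambda>p. \<theta> i p (conn V Z p)) x (U x) =
        dirderiv (\<lambda>p. dirderiv (\<lambda>p. \<theta> i p (Z p)) p (V p)) x (U x)"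
      by (rule dirderiv_cong) (simp_all add: x i U V Z vfield_in coframe_conn)
    also have "\<dots> = dirderiv (\<lambda>p. \<theta> i p (Z p)) x (dirderiv V x (U x)) +
      dirderiv (\<lambda>p. dirderiv (\<lambda>p. \<theta> i p (Z p)) p (V x)) x (U x)"
      by (rule dirderiv_dirderiv_field) (simp_all add: x i U V Z vfield_in vfield_smooth coframe_smooth)
    finally show ?thesis .
  qed
  have XY: "lie_bracket X Y \<in> vfields E M" by (rule vfield_lie_bracket[OF X Y])
  \<comment> \<open>Vanishing curvature is put in additive form, so that the coframe can be applied
    termwise.\<close>
  have "conn X (conn Y Z) x = conn Y (conn X Z) x + conn (lie_bracket X Y) Z x"
  proof (rule coframe_inj[OF x])
    fix i assume i: "i \<in> I"
    have "dirderiv (\<lambda>p. dirderiv (\<lambda>p. \<theta> i p (Z p)) p (Y x)) x (X x) =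
        dirderiv (\<lambda>p. dirderiv (\<lambda>p. \<theta> i p (Z p)) p (X x)) x (Y x)"
      by (rule dirderiv_commute) (simp_all add: x i X Y Z vfield_in coframe_smooth)
    moreover have "dirderiv (\<lambda>p. \<theta> i p (Z p)) x (lie_bracket X Y x) =
        dirderiv (\<lambda>p. \<theta> i p (Z p)) x (dirderiv Y x (X x)) -
        dirderiv (\<lambda>p. \<theta> i p (Z p)) x (dirderiv X x (Y x))"
      unfolding lie_bracket_def
      by (rule dirderiv_diff_dir)
        (intro x i Z coframe_diff_on dirderiv_in[OF subspace_E] vfield_diff_on
          vfield_in[OF X] vfield_in[OF Y] X Y; assumption)+
    ultimately show "\<theta> i x (conn X (conn Y Z) x) = \<theta> i x (conn Y (conn X Z) x + conn (lie_bracket X Y) Z x)"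
      by (simp add: x i X Y Z XY conn_vfield vfield_in coframe_conn coframe_add second)
  qed (simp_all add: x X Y Z XY conn_vfield vfield_in subspace_add subspace_E)
  then show "curvature conn X Y Z x = 0"
    by (simp add: curvature_def)
qed

text \<open>The coefficients of \<open>e j\<close> are the constants 0 and 1. Consequently the
  torsion of two frame fields is minus their Lie bracket.\<close>

lemma conn_frame:
  assumes X: "X \<in> vfields E M" and j: "j \<in> I"
  shows "conn X (e j) = (\<lambda>_. 0)"
proof (rule vfield_eqI)
  fix i x assume ix: "i \<in> I" "x \<in> M"
  have "dirderiv (\<lambda>p. \<theta> i p (e j p)) x (X x) = dirderiv (\<lambda>p. if i = j then 1 else 0 :: real) x (X x)"
    by (rule dirderiv_cong) (simp_all add: ix X j vfield_in coframe_frame)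
  then show "\<theta> i x (conn X (e j) x) = \<theta> i x 0"
    by (simp add: ix X j e_vfield coframe_conn coframe_0 dirderiv_def)
qed (simp_all add: X j e_vfield conn_vfield vfield_zero)

text \<open>Expand \<open>X\<close> by linearity over functions, then \<open>Y\<close> by the
  Leibniz rule; since the frame fields are parallel, only the derivatives of the coefficients of
  \<open>Y\<close> survive.\<close>

lemma conn_unique:
  assumes D: "affine_connection E M D"
    and flat: "\<And>i j. i \<in> I \<Longrightarrow> j \<in> I \<Longrightarrow> D (e i) (e j) = (\<lambda>_. 0)"
    and X: "X \<in> vfields E M" and Y: "Y \<in> vfields E M"
  shows "D X Y = conn X Y"
proof -
  have D_add1: "D (\<lambda>x. X x + X' x) Y = (\<lambda>x. D X Y x + D X' Y x)"
    and D_scale1: "smooth_fun E M f \<Longrightarrow> D (\<lambda>x. f x *\<^sub>R X x) Y = (\<lambda>x. f x *\<^sub>R D X Y x)"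
    and D_add2: "D Y (\<lambda>x. X x + X' x) = (\<lambda>x. D Y X x + D Y X' x)"
    and D_scale2: "smooth_fun E M f \<Longrightarrow>
      D Y (\<lambda>x. f x *\<^sub>R X x) = (\<lambda>x. dirderiv f x (Y x) *\<^sub>R X x + f x *\<^sub>R D Y X x)"
    if "X \<in> vfields E M" "X' \<in> vfields E M" "Y \<in> vfields E M" for X X' Y and f :: "'a \<Rightarrow> real"
    using D that unfolding affine_connection_def by blast+
  have expand: "(\<lambda>x. \<Sum>i\<in>I. \<theta> i x (Y x) *\<^sub>R e i x) = Y" if Y: "Y \<in> vfields E M" for Y
  proof
    fix x show "(\<Sum>i\<in>I. \<theta> i x (Y x) *\<^sub>R e i x) = Y x"
      using Y e_vfield by (cases "x \<in> M") (simp_all add: frame_expand vfield_in vfield_out)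
  qed
  have summand: "(\<lambda>x. \<theta> i x (Y x) *\<^sub>R e i x) \<in> vfields E M" if "i \<in> I" "Y \<in> vfields E M" for i Y
    by (intro vfield_scaleR coframe_smooth e_vfield that)
  \<comment> \<open>The zero field is a field scaled by the function 0, so the empty sums that start
    the inductions follow from the scaling axioms.\<close>
  have zero1: "D (\<lambda>_. 0) Y = (\<lambda>_. 0)" if "Y \<in> vfields E M" for Y
    using D_scale1[OF vfield_zero vfield_zero that smooth_const[of 0]] by simp
  have zero2: "D Y (\<lambda>_. 0) = (\<lambda>_. 0)" if "Y \<in> vfields E M" for Y
    using D_scale2[OF vfield_zero vfield_zero that smooth_const[of 0]] by simp
  have D_frame: "D X (e j) = (\<lambda>_. 0)" if j: "j \<in> I" for j
  proof -
    \<comment> \<open>The axioms add two fields at a time, so the expansion over \<open>I\<close> is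
      built up through partial sums over subsets \<open>J\<close>.\<close>
    have "D (\<lambda>x. \<Sum>i\<in>J. \<theta> i x (X x) *\<^sub>R e i x) (e j) = (\<lambda>_. 0)" if "J \<subseteq> I" for J
      using finite_subset[OF that finite_I] that
    proof (induction J)
      case empty
      then show ?case by (simp add: zero1 e_vfield j)
    next
      case (insert i J)
      then have "D (\<lambda>x. \<theta> i x (X x) *\<^sub>R e i x + (\<Sum>i\<in>J. \<theta> i x (X x) *\<^sub>R e i x)) (e j) =
          (\<lambda>x. D (\<lambda>x. \<theta> i x (X x) *\<^sub>R e i x) (e j) x + D (\<lambda>x. \<Sum>i\<in>J. \<theta> i x (X x) *\<^sub>R e i x) (e j) x)"
        by (intro D_add1 vfield_sum summand X e_vfield j) auto
      moreover have "D (\<lambda>x. \<theta> i x (X x) *\<^sub>R e i x) (e j) = (\<lambda>x. \<theta> i x (X x) *\<^sub>R D (e i) (e j) x)"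
        using insert.prems by (intro D_scale1[of _ "e i"] e_vfield j coframe_smooth X) auto
      ultimately show ?case using insert flat[of i j] j by simp
    qed
    from this[OF subset_refl] show ?thesis by (simp add: expand X)
  qed
  have "D X (\<lambda>x. \<Sum>i\<in>J. \<theta> i x (Y x) *\<^sub>R e i x) =
      (\<lambda>x. \<Sum>i\<in>J. dirderiv (\<lambda>p. \<theta> i p (Y p)) x (X x) *\<^sub>R e i x)" if "J \<subseteq> I" for J
    using finite_subset[OF that finite_I] that
  proof (induction J)
    case empty
    then show ?case by (simp add: zero2 X)
  next
    case (insert i J)
    then have "D X (\<lambda>x. \<theta> i x (Y x) *\<^sub>R e i x + (\<Sum>i\<in>J. \<theta> i x (Y x) *\<^sub>R e i x)) =
        (\<lambda>x. D X (\<lambda>x. \<theta> i x (Y x) *\<^sub>R e i x) x + D X (\<lambda>x. \<Sum>i\<in>J. \<theta> i x (Y x) *\<^sub>R e i x) x)"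
      by (intro D_add2 vfield_sum summand X Y) auto
    moreover have "D X (\<lambda>x. \<theta> i x (Y x) *\<^sub>R e i x) =
        (\<lambda>x. dirderiv (\<lambda>p. \<theta> i p (Y p)) x (X x) *\<^sub>R e i x + \<theta> i x (Y x) *\<^sub>R D X (e i) x)"
      using insert.prems by (intro D_scale2[of _ "e i"] e_vfield coframe_smooth X Y) auto
    ultimately show ?case using insert D_frame[of i] by simp
  qed
  from this[OF subset_refl] show ?thesis by (simp add: expand X Y conn_eq)
qed

end

section \<open>Naturality under diffeomorphisms that match frames\<close>

locale frame_diffeo = linear_diffeo E M F N f g + M: parallel_frame E M I e \<theta> + N: parallel_frame F N I e' \<theta>'
  for E M F N :: "'a::euclidean_space set" and f g and I :: "'i set" and e \<theta> e' \<theta>' +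
  assumes frame_related: "i \<in> I \<Longrightarrow> x \<in> M \<Longrightarrow> e' i (f x) = dirderiv f x (e i x)"
begin

lemma coframe_related:
  assumes i: "i \<in> I" and x: "x \<in> M" and v: "v \<in> E"
  shows "\<theta>' i (f x) (dirderiv f x v) = \<theta> i x v"
proof -
  have "dirderiv f x v = dirderiv f x (\<Sum>j\<in>I. \<theta> j x v *\<^sub>R e j x)"
    by (simp add: M.frame_expand x v)
  also have "\<dots> = (\<Sum>j\<in>I. \<theta> j x v *\<^sub>R dirderiv f x (e j x))"
    using x by (intro M.dirderiv_sum M.smooth_differentiable f_smooth) (auto intro: M.vfield_in M.e_vfield)
  also have "\<dots> = (\<Sum>j\<in>I. \<theta> j x v *\<^sub>R e' j (f x))"
    using x by (simp add: frame_related)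
  finally show ?thesis using i x by (simp add: N.coframe_sum_frame f_in)
qed

text \<open>By \<open>coframe_related\<close>, the coefficients of the pushed field composed with
  \<open>f\<close> are those of \<open>Y\<close>, so the chain rule identifies their derivatives in
  corresponding directions.\<close>

lemma push_conn:
  assumes X: "X \<in> vfields E M" and Y: "Y \<in> vfields E M"
  shows "pushforward f M N (M.conn X Y) = N.conn (pushforward f M N X) (pushforward f M N Y)"
proof (rule N.vfield_eqI)
  fix i y assume i: "i \<in> I" and y: "y \<in> N"
  define x where "x = g y"
  have x: "x \<in> M" "f x = y" using y by (simp_all add: x_def g_in f_g)
  have "\<theta>' i y (N.conn (pushforward f M N X) (pushforward f M N Y) y) =
      dirderiv (\<lambda>p. \<theta>' i p (pushforward f M N Y p)) (f x) (dirderiv f x (X x))"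
    by (simp add: i y X Y N.coframe_conn push_vfield push_at x flip: push_at[OF x(1)])
  also have "\<dots> = dirderiv (\<lambda>p. \<theta>' i (f p) (pushforward f M N Y (f p))) x (X x)"
    by (rule dirderiv_push) (simp_all add: i x X Y N.coframe_diff_on push_vfield M.vfield_in)
  also have "\<dots> = dirderiv (\<lambda>p. \<theta> i p (Y p)) x (X x)"
    by (rule M.dirderiv_cong) (simp_all add: i x X Y M.vfield_in push_at coframe_related)
  also have "\<dots> = \<theta>' i (f x) (dirderiv f x (M.conn X Y x))"
    unfolding coframe_related[OF i x(1) M.vfield_in[OF M.conn_vfield[OF X Y] x(1)]]
      M.coframe_conn[OF i x(1) X Y] ..
  finally show "\<theta>' i y (pushforward f M N (M.conn X Y) y) =
      \<theta>' i y (N.conn (pushforward f M N X) (pushforward f M N Y) y)"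
    using push_at[OF x(1)] x by simp
qed (simp_all add: X Y push_vfield M.conn_vfield N.conn_vfield)

end

text \<open>The new coframe is the pullback of \<open>\<theta>\<close> along \<open>g\<close>;
  duality survives because the derivatives of \<open>f\<close> and \<open>g\<close> are mutually
  inverse.\<close>

lemma (in linear_diffeo) transport_frame:
  assumes "parallel_frame E M I e \<theta>"
  shows "parallel_frame F N I (\<lambda>i. pushforward f M N (e i)) (\<lambda>i y v. \<theta> i (g y) (dirderiv g y v))"
proof -
  interpret M: parallel_frame E M I e \<theta> by fact
  interpret inv: linear_diffeo F N E M g f by (rule inverse_diffeo)
  have g_diff: "g differentiable_on N" by (rule N.smooth_differentiable[OF g_smooth])
  show ?thesis
  proof (unfold_locales, goal_cases)
    case 1
    then show ?case by (rule M.finite_I)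
  next
    case (2 i)
    then show ?case by (intro push_vfield M.e_vfield)
  next
    case (3 i Y)
    have "smooth_fun F N (\<lambda>y. \<theta> i (g y) (pushforward g N M Y (g y)))"
      by (rule N.smooth_compose[OF M.linear_domain_axioms _ g_smooth g_in,
            where f = "\<lambda>x. \<theta> i x (pushforward g N M Y x)"])
        (intro M.coframe_smooth 3 inv.push_vfield)
    then show ?case
      using N.smooth_cong[of "\<lambda>y. \<theta> i (g y) (pushforward g N M Y (g y))" "\<lambda>y. \<theta> i (g y) (dirderiv g y (Y y))"]
        inv.push_at by simp
  next
    case (4 i x u v)
    then show ?case
      by (simp add: N.dirderiv_add_dir g_diff M.coframe_add g_in inv.dirderiv_f_in)
  next
    case (5 i x v c)
    then show ?case
      by (simp add: N.dirderiv_scaleR_dir g_diff M.coframe_scaleR g_in inv.dirderiv_f_in)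
  next
    case (6 y v)
    define w where "w = dirderiv g y v"
    have w: "w \<in> E" "dirderiv f (g y) w = v"
      using 6 inv.dirderiv_f_in inv.dirderiv_inverse by (simp_all add: w_def)
    have "(\<Sum>i\<in>I. \<theta> i (g y) w *\<^sub>R pushforward f M N (e i) y) =
        dirderiv f (g y) (\<Sum>i\<in>I. \<theta> i (g y) w *\<^sub>R e i (g y))"
      unfolding push_eq[OF 6(1)]
      using 6 by (intro M.dirderiv_sum[symmetric] M.smooth_differentiable f_smooth)
        (auto intro: M.vfield_in M.e_vfield g_in)
    then show ?case
      using 6 w by (simp add: M.frame_expand g_in flip: w_def)
  next
    case (7 i j y)
    then show ?case
      using dirderiv_inverse[of "g y" "e j (g y)"]
      by (simp add: push_eq f_g g_in M.vfield_in M.e_vfield M.coframe_frame)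
  qed
qed

lemma (in linear_diffeo) frame_diffeo_transport:
  assumes "parallel_frame E M I e \<theta>"
  shows "frame_diffeo E M F N f g I e \<theta> (\<lambda>i. pushforward f M N (e i)) (\<lambda>i y v. \<theta> i (g y) (dirderiv g y v))"
  using assms transport_frame[OF assms] linear_diffeo_axioms push_at
  by (auto simp: frame_diffeo_def frame_diffeo_axioms_def)

subsection \<open>Geodesics\<close>

context parallel_frame
begin

text \<open>Write \<open>W s\<close> in constant basis vectors and use the product rule: the terms
  in which the coframe is differentiated make up the Christoffel part. So covariant differentiation
  along a curve is differentiation of frame coefficients.\<close>

lemma coframe_along:
  assumes c: "(c has_vector_derivative v) (at t within S)" and v: "v \<in> E"
    and S: "\<And>s. s \<in> S \<Longrightarrow> c s \<in> M" "t \<in> S"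
    and W: "(W has_vector_derivative w) (at t within S)" "\<And>s. s \<in> S \<Longrightarrow> W s \<in> E" and w: "w \<in> E"
    and i: "i \<in> I"
  shows "((\<lambda>s. \<theta> i (c s) (W s)) has_vector_derivative \<theta> i (c t) (w + christoffel M conn (c t) v (W t)))
    (at t within S)"
proof -
  obtain B where B: "finite B" "B \<subseteq> E" "\<And>v. v \<in> E \<Longrightarrow> (\<Sum>b\<in>B. (v \<bullet> b) *\<^sub>R b) = v"
    using obtain_basis by blast
  have expand: "\<theta> i x u = (\<Sum>b\<in>B. (u \<bullet> b) * \<theta> i x b)" if "x \<in> M" "u \<in> E" for x u
    using coframe_sum[OF i that(1), of B "\<lambda>b. b" "\<lambda>b. u \<bullet> b"] B(2) B(3)[OF that(2)]
    by (auto simp: subset_iff)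
  have const: "const_field M u x = u" if "x \<in> M" for u x
    using that by (simp add: const_field_def)
  have smooth: "smooth_fun E M (\<lambda>x. \<theta> i x u)" if "u \<in> E" for u
    using coframe_smooth[OF i vfield_const[OF that]]
      smooth_cong[of "\<lambda>x. \<theta> i x (const_field M u x)" "\<lambda>x. \<theta> i x u"] const by simp
  have ct: "c t \<in> M" "W t \<in> E" using S W by auto
  have chr: "christoffel M conn (c t) v (W t) \<in> E"
    unfolding christoffel_def
    by (rule vfield_in'[OF conn_vfield[OF vfield_const[OF v] vfield_const[OF ct(2)]]])
  have "\<theta> i (c t) (christoffel M conn (c t) v (W t)) = dirderiv (\<lambda>x. \<theta> i x (const_field M (W t) x)) (c t) v"
    unfolding christoffel_def by (simp add: coframe_conn i ct v vfield_const const)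
  also have "\<dots> = dirderiv (\<lambda>x. \<Sum>b\<in>B. (W t \<bullet> b) * \<theta> i x b) (c t) v"
    by (rule dirderiv_cong) (simp_all add: ct v const expand)
  also have "\<dots> = (\<Sum>b\<in>B. (W t \<bullet> b) * dirderiv (\<lambda>x. \<theta> i x b) (c t) v)"
  proof -
    have "((\<lambda>s. \<Sum>b\<in>B. (W t \<bullet> b) * \<theta> i (c t + s *\<^sub>R v) b) has_vector_derivative
        (\<Sum>b\<in>B. (W t \<bullet> b) * dirderiv (\<lambda>x. \<theta> i x b) (c t) v)) (at 0)"
    proof (intro has_vector_derivative_sum has_vector_derivative_mult_right)
      fix b assume "b \<in> B"
      then show "((\<lambda>s. \<theta> i (c t + s *\<^sub>R v) b) has_vector_derivative dirderiv (\<lambda>x. \<theta> i x b) (c t) v) (at 0)"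
        using dirderiv_line[of "\<lambda>x. \<theta> i x b" "c t" v 0] smooth_differentiable[OF smooth] B(2) ct v in_E
        by auto
    qed
    then show ?thesis unfolding dirderiv_def by (rule vector_derivative_at)
  qed
  finally have "(\<Sum>b\<in>B. (W t \<bullet> b) * dirderiv (\<lambda>x. \<theta> i x b) (c t) v + (w \<bullet> b) * \<theta> i (c t) b) =
      \<theta> i (c t) (w + christoffel M conn (c t) v (W t))"
    by (simp add: coframe_add i ct w chr sum.distrib expand[OF ct(1) w])
  moreover have "((\<lambda>s. \<Sum>b\<in>B. (W s \<bullet> b) * \<theta> i (c s) b) has_vector_derivative
     (\<Sum>b\<in>B. (W t \<bullet> b) * dirderiv (\<lambda>x. \<theta> i x b) (c t) v + (w \<bullet> b) * \<theta> i (c t) b)) (at t within S)"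
  proof (intro has_vector_derivative_sum has_vector_derivative_mult)
    fix b assume "b \<in> B"
    then have b: "b \<in> E" using B(2) by auto
    show "((\<lambda>s. W s \<bullet> b) has_vector_derivative w \<bullet> b) (at t within S)"
      by (rule bounded_linear.has_vector_derivative[OF bounded_linear_inner_left W(1)])
    show "((\<lambda>s. \<theta> i (c s) b) has_vector_derivative dirderiv (\<lambda>x. \<theta> i x b) (c t) v) (at t within S)"
      using dirderiv_curve[OF smooth_differentiable[OF smooth[OF b]] c S v] .
  qed
  ultimately have "((\<lambda>s. \<Sum>b\<in>B. (W s \<bullet> b) * \<theta> i (c s) b) has_vector_derivative
      \<theta> i (c t) (w + christoffel M conn (c t) v (W t))) (at t within S)"
    by simp
  then show ?thesis
    by (rule has_vector_derivative_transform[OF S(2), rotated]) (simp add: expand S W)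
qed

text \<open>By \<open>coframe_along\<close> the geodesic equation says that the frame coefficients
  of the velocity have zero derivative on an interval, hence are constants \<open>k\<close>. The
  condition \<open>a < b\<close> makes one-sided derivatives unique.\<close>

lemma geodesic_on_iff:
  assumes ab: "a < b"
  shows "geodesic_on M conn {a..b} c \<longleftrightarrow>
    (\<exists>k. \<forall>t\<in>{a..b}. c t \<in> M \<and>
       (c has_vector_derivative (\<Sum>i\<in>I. k i *\<^sub>R e i (c t))) (at t within {a..b}))" (is "_ \<longleftrightarrow> ?R")
proof
  let ?S = "{a..b}"
  let ?v = "velocity ?S c"
  have nontriv: "at t within ?S \<noteq> bot" if "t \<in> ?S" for t
    using ab that by (simp add: trivial_limit_within islimpt_Icc)
  {
    assume g: "geodesic_on M conn ?S c"
    have cM: "c t \<in> M" if "t \<in> ?S" for t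
      using g that by (auto simp: geodesic_on_def)
    have c: "(c has_vector_derivative ?v t) (at t within ?S)" if "t \<in> ?S" for t
      using g that by (simp add: geodesic_on_def velocity_def differentiable_on_def vector_derivative_works)
    have v: "(?v has_vector_derivative vector_derivative ?v (at t within ?S)) (at t within ?S)" if "t \<in> ?S" for t
      using g that by (simp add: geodesic_on_def differentiable_on_def vector_derivative_works)
    have vE: "?v t \<in> E" if "t \<in> ?S" for t
      using has_vector_derivative_in_subspace[OF subspace_E c] that cM in_E nontriv by blast
    have wE: "vector_derivative ?v (at t within ?S) \<in> E" if "t \<in> ?S" for t
      using has_vector_derivative_in_subspace[OF subspace_E v] that vE nontriv by blast
    have eq: "vector_derivative ?v (at t within ?S) + christoffel M conn (c t) (?v t) (?v t) = 0" if "t \<in> ?S" for t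
      using g that by (simp add: geodesic_on_def cov_deriv_along_def)
    have "((\<lambda>t. \<theta> i (c t) (?v t)) has_vector_derivative 0) (at t within ?S)" if "t \<in> ?S" "i \<in> I" for i t
      using coframe_along[OF c vE cM _ v vE wE] that eq coframe_0 cM by simp
    then have const: "\<theta> i (c t) (?v t) = \<theta> i (c a) (?v a)" if "t \<in> ?S" "i \<in> I" for i t
      using has_derivative_zero_unique[of ?S "\<lambda>t. \<theta> i (c t) (?v t)" t a] that ab
      by (auto simp: has_vector_derivative_def)
    have "?v t = (\<Sum>i\<in>I. \<theta> i (c a) (?v a) *\<^sub>R e i (c t))" if "t \<in> ?S" for t
      using frame_expand[OF cM vE, OF that that] const[OF that] by simp
    then show ?R
      using c cM by (intro exI[of _ "\<lambda>i. \<theta> i (c a) (?v a)"]) auto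
  }
  assume ?R
  then obtain k where cM: "\<And>t. t \<in> ?S \<Longrightarrow> c t \<in> M"
    and c: "\<And>t. t \<in> ?S \<Longrightarrow> (c has_vector_derivative (\<Sum>i\<in>I. k i *\<^sub>R e i (c t))) (at t within ?S)"
    by blast
  have kE: "(\<Sum>i\<in>I. k i *\<^sub>R e i x) \<in> E" for x
    by (intro subspace_sum subspace_scale subspace_E vfield_in'[OF e_vfield])
  have vel: "?v t = (\<Sum>i\<in>I. k i *\<^sub>R e i (c t))" if "t \<in> ?S" for t
    unfolding velocity_def by (rule vector_derivative_within[OF nontriv c]) (use that in auto)
  have smooth: "smooth_fun E M (\<lambda>x. \<Sum>i\<in>I. k i *\<^sub>R e i x)"
    by (intro smooth_sum smooth_scaleR smooth_const vfield_smooth e_vfield)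
  \<comment> \<open>The first-order equation itself supplies the second derivative: the velocity is
    a smooth field evaluated along \<open>c\<close>.\<close>
  have v: "(?v has_vector_derivative dirderiv (\<lambda>x. \<Sum>i\<in>I. k i *\<^sub>R e i x) (c t) (\<Sum>i\<in>I. k i *\<^sub>R e i (c t))) (at t within ?S)"
    if "t \<in> ?S" for t
    using dirderiv_curve[OF smooth_differentiable[OF smooth] c cM _ kE] that vel
    by (intro has_vector_derivative_transform[OF that, of ?v]) auto
  have diff: "c differentiable_on ?S" "?v differentiable_on ?S"
    unfolding differentiable_on_def using c v differentiableI_vector by blast+
  have v': "(?v has_vector_derivative vector_derivative ?v (at t within ?S)) (at t within ?S)" if "t \<in> ?S" for t
    using diff(2) that by (simp add: differentiable_on_def vector_derivative_works)
  have vE: "?v t \<in> E" if "t \<in> ?S" for t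
    using vel[OF that] kE by simp
  have wE: "vector_derivative ?v (at t within ?S) \<in> E" if "t \<in> ?S" for t
    using has_vector_derivative_in_subspace[OF subspace_E v'] that vE nontriv by blast
  have c': "(c has_vector_derivative ?v t) (at t within ?S)" if "t \<in> ?S" for t
    using c[OF that] vel[OF that] by simp
  have "vector_derivative ?v (at t within ?S) + christoffel M conn (c t) (?v t) (?v t) = 0" if t: "t \<in> ?S" for t
  proof (rule coframe_inj[OF cM[OF t]])
    show "vector_derivative ?v (at t within ?S) + christoffel M conn (c t) (?v t) (?v t) \<in> E"
      unfolding christoffel_def
      by (intro subspace_add subspace_E wE vfield_in'[OF conn_vfield] vfield_const vE t)
    show "0 \<in> E" by (rule subspace_0[OF subspace_E])
    fix i assume i: "i \<in> I"
    have "((\<lambda>s. \<theta> i (c s) (?v s)) has_vector_derivative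
        \<theta> i (c t) (vector_derivative ?v (at t within ?S) + christoffel M conn (c t) (?v t) (?v t))) (at t within ?S)"
      by (rule coframe_along) (use c' vE cM t v' wE i in auto)
    moreover have "((\<lambda>s. \<theta> i (c s) (?v s)) has_vector_derivative 0) (at t within ?S)"
      by (rule has_vector_derivative_transform[OF t _ has_vector_derivative_const[of "k i"]])
        (simp add: vel cM i coframe_sum_frame)
    ultimately show "\<theta> i (c t) (vector_derivative ?v (at t within ?S) + christoffel M conn (c t) (?v t) (?v t)) =
        \<theta> i (c t) 0"
      using vector_derivative_unique_within[OF nontriv[OF t]] coframe_0[OF i cM[OF t]] by metis
  qed
  then show "geodesic_on M conn ?S c"
    using cM diff by (auto simp: geodesic_on_def cov_deriv_along_def)
qed

end

lemma (in frame_diffeo) inverse_frame_diffeo: "frame_diffeo F N E M g f I e' \<theta>' e \<theta>"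
proof -
  interpret inv: linear_diffeo F N E M g f by (rule inverse_diffeo)
  show ?thesis
  proof unfold_locales
    fix i y assume i: "i \<in> I" and y: "y \<in> N"
    have "dirderiv g (f (g y)) (dirderiv f (g y) (e i (g y))) = e i (g y)"
      by (rule dirderiv_inverse[OF g_in[OF y] M.vfield_in[OF M.e_vfield[OF i] g_in[OF y]]])
    then show "e i (g y) = dirderiv g y (e' i y)"
      using frame_related[OF i g_in[OF y]] f_g[OF y] by simp
  qed
qed

text \<open>The derivative of \<open>f\<close> is linear on tangent vectors and takes frame to
  frame, so the constants \<open>k\<close> are preserved.\<close>

lemma (in frame_diffeo) push_curve:
  assumes c: "(c has_vector_derivative (\<Sum>i\<in>I. k i *\<^sub>R e i (c t))) (at t within S)"
    and S: "\<And>s. s \<in> S \<Longrightarrow> c s \<in> M" "t \<in> S"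
  shows "((\<lambda>s. f (c s)) has_vector_derivative (\<Sum>i\<in>I. k i *\<^sub>R e' i (f (c t)))) (at t within S)"
proof -
  have diff: "f differentiable_on M" by (rule M.smooth_differentiable[OF f_smooth])
  have e: "e i x \<in> E" if "i \<in> I" for i x
    by (rule M.vfield_in'[OF M.e_vfield[OF that]])
  have "dirderiv f (c t) (\<Sum>i\<in>I. k i *\<^sub>R e i (c t)) = (\<Sum>i\<in>I. k i *\<^sub>R dirderiv f (c t) (e i (c t)))"
    by (rule M.dirderiv_sum[OF diff S(1)[OF S(2)] e])
  also have "\<dots> = (\<Sum>i\<in>I. k i *\<^sub>R e' i (f (c t)))"
    using frame_related S by simp
  finally show ?thesis
    using M.dirderiv_curve[OF diff c S subspace_sum[OF M.subspace_E subspace_scale[OF M.subspace_E e]]]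
    by simp
qed

section \<open>Connections that agree on smooth fields\<close>

context linear_domain
begin

lemma affine_connection_cong:
  assumes eq: "\<And>X Y. X \<in> vfields E M \<Longrightarrow> Y \<in> vfields E M \<Longrightarrow> D' X Y = D X Y"
    and D: "affine_connection E M D"
  shows "affine_connection E M D'"
  using D unfolding affine_connection_def
  by (simp add: eq vfield_add vfield_scaleR)

text \<open>Curvature nests connections, so \<open>D\<close> must return smooth fields before its
  values can serve as arguments of the outer \<open>D'\<close>.\<close>

lemma flat_connection_cong:
  assumes eq: "\<And>X Y. X \<in> vfields E M \<Longrightarrow> Y \<in> vfields E M \<Longrightarrow> D' X Y = D X Y"
    and D: "affine_connection E M D" "flat_connection E M D"
  shows "flat_connection E M D'"
proof -
  have "D X Y \<in> vfields E M" if "X \<in> vfields E M" "Y \<in> vfields E M" for X Y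
    using D(1) that by (simp add: affine_connection_def)
  then show ?thesis
    using D(2) unfolding flat_connection_def curvature_def
    by (simp add: eq vfield_lie_bracket)
qed

text \<open>The Christoffel map feeds constant fields to the connection; these are smooth fields
  because the velocity of a curve in \<open>M\<close> lies in \<open>E\<close>.\<close>

lemma geodesic_on_cong:
  assumes eq: "\<And>X Y. X \<in> vfields E M \<Longrightarrow> Y \<in> vfields E M \<Longrightarrow> D' X Y = D X Y" and ab: "a < b"
  shows "geodesic_on M D' {a..b} c \<longleftrightarrow> geodesic_on M D {a..b} c"
proof (cases "c ` {a..b} \<subseteq> M \<and> c differentiable_on {a..b}")
  case True
  have "velocity {a..b} c t \<in> E" if t: "t \<in> {a..b}" for t
  proof (rule has_vector_derivative_in_subspace[OF subspace_E _ _ t])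
    show "(c has_vector_derivative velocity {a..b} c t) (at t within {a..b})"
      using True t by (simp add: velocity_def differentiable_on_def vector_derivative_works)
    show "at t within {a..b} \<noteq> bot"
      using ab t by (simp add: trivial_limit_within islimpt_Icc)
  qed (use True in_E in blast)
  then have "christoffel M D' (c t) (velocity {a..b} c t) (velocity {a..b} c t) =
      christoffel M D (c t) (velocity {a..b} c t) (velocity {a..b} c t)" if "t \<in> {a..b}" for t
    using that by (simp add: christoffel_def eq vfield_const)
  then show ?thesis by (simp add: geodesic_on_def cov_deriv_along_def)
qed (auto simp: geodesic_on_def)

end

subsection \<open>Operators on complex vectors and their exponentials\<close>

lemma scaleR_eq_smult: "r *\<^sub>R (u :: complex^'n) = complex_of_real r *s u"
  by (simp add: vec_eq_iff scaleR_conv_of_real[symmetric])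

lemma bounded_linear_smult_left: "bounded_linear (\<lambda>c::complex. c *s (u :: complex^'n))"
  unfolding linear_conv_bounded_linear[symmetric]
  by (rule linearI) (simp_all add: vec_eq_iff distrib_right)

lemma exp_series_sums: "(\<lambda>k. (1 / fact k) *\<^sub>R z ^ k) sums exp (z :: 'a::{banach,real_normed_field})"
  using exp_converges[of z] by (simp add: inverse_eq_divide)

text \<open>The exponential series differentiated term by term. It governs Jordan blocks of size two
  and the confluent case of divided differences.\<close>

lemma exp_deriv_series_sums:
  "(\<lambda>k. (1 / fact k) *\<^sub>R (of_nat k * z ^ (k - 1))) sums exp (z :: 'a::{banach,real_normed_field})"
proof -
  have "(1 / fact (Suc k)) *\<^sub>R (of_nat (Suc k) * z ^ (Suc k - 1)) = (1 / fact k) *\<^sub>R z ^ k" for k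
  proof -
    have "(1 / fact (Suc k)) *\<^sub>R (of_nat (Suc k) * z ^ k) = (1 / fact (Suc k) * real (Suc k)) *\<^sub>R z ^ k"
      by (simp only: scaleR_conv_of_real of_real_mult of_real_of_nat_eq mult.assoc)
    also have "1 / fact (Suc k) * real (Suc k) = 1 / fact k"
      by (simp only: fact_Suc of_nat_mult) (simp del: of_nat_Suc)
    finally show ?thesis by simp
  qed
  then have "(\<lambda>k. (1 / fact (Suc k)) *\<^sub>R (of_nat (Suc k) * z ^ (Suc k - 1))) sums exp z"
    using exp_series_sums[of z] by simp
  from sums_Suc[OF this] show ?thesis by simp
qed

text \<open>\<open>L\<close> is the exponential of a complex-linear \<open>N\<close>, encoded by
  pointwise convergence of the series. The intended instance is right multiplication of row vectors
  by a complexified matrix.\<close>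

locale exp_operator =
  fixes N L :: "complex^'n \<Rightarrow> complex^'n"
  assumes N_add: "N (u + v) = N u + N v"
    and N_smult: "N (c *s u) = c *s N u"
    and exp_sums: "(\<lambda>k. (1 / fact k) *\<^sub>R (N ^^ k) u) sums L u"
begin

lemma N_0: "N 0 = 0"
  using N_smult[of 0 0] by simp

lemma pow_add: "(N ^^ k) (u + v) = (N ^^ k) u + (N ^^ k) v"
  by (induction k) (simp_all add: N_add)

lemma pow_smult: "(N ^^ k) (c *s u) = c *s (N ^^ k) u"
  by (induction k) (simp_all add: N_smult)

lemma bounded_linear_N: "bounded_linear N"
  unfolding linear_conv_bounded_linear[symmetric]
  by (rule linearI) (simp_all add: N_add N_smult scaleR_eq_smult)

lemma L_commute: "L (N u) = N (L u)"
proof -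
  have "(\<lambda>k. N ((1 / fact k) *\<^sub>R (N ^^ k) u)) sums N (L u)"
    by (rule bounded_linear.sums[OF bounded_linear_N exp_sums])
  then have "(\<lambda>k. (1 / fact k) *\<^sub>R (N ^^ k) (N u)) sums N (L u)"
    by (simp add: scaleR_eq_smult N_smult funpow_swap1)
  then show ?thesis using exp_sums sums_unique2 by blast
qed

lemma L_add: "L (u + v) = L u + L v"
proof -
  have "(\<lambda>k. (1 / fact k) *\<^sub>R (N ^^ k) (u + v)) sums (L u + L v)"
    using sums_add[OF exp_sums exp_sums, of u v] by (simp add: pow_add scaleR_add_right)
  then show ?thesis using exp_sums sums_unique2 by blast
qed

lemma L_smult: "L (c *s u) = c *s L u"
proof -
  have "bounded_linear ((*s) c :: complex^'n \<Rightarrow> _)"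
    unfolding linear_conv_bounded_linear[symmetric]
    by (rule linearI) (simp_all add: vec_eq_iff distrib_left)
  from bounded_linear.sums[OF this exp_sums[of u]]
  have "(\<lambda>k. (1 / fact k) *\<^sub>R (N ^^ k) (c *s u)) sums (c *s L u)"
    by (simp add: pow_smult scaleR_eq_smult mult.commute)
  then show ?thesis using exp_sums sums_unique2 by blast
qed

lemma L_eigenvector:
  assumes "N u = c *s u"
  shows "L u = exp c *s u"
proof -
  have "(N ^^ k) u = c ^ k *s u" for k
    by (induction k) (simp_all add: N_smult assms mult.commute)
  then have "(\<lambda>k. ((1 / fact k) *\<^sub>R c ^ k) *s u) = (\<lambda>k. (1 / fact k) *\<^sub>R (N ^^ k) u)"
    by (simp add: fun_eq_iff vec_eq_iff)
  with bounded_linear.sums[OF bounded_linear_smult_left[of u] exp_series_sums[of c]]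
  have "(\<lambda>k. (1 / fact k) *\<^sub>R (N ^^ k) u) sums (exp c *s u)" by (simp only:)
  then show ?thesis using exp_sums[of u] by (intro sums_unique2)
qed

text \<open>On a Jordan block of size two the nilpotent part survives with factor
  \<open>exp c\<close>, so \<open>u\<close> is an eigenvector of \<open>L\<close> for
  \<open>exp c\<close> only if \<open>w = 0\<close>.\<close>

lemma L_jordan:
  assumes "N u = c *s u + w" "N w = c *s w"
  shows "L u = exp c *s (u + w)"
proof -
  have pow: "(N ^^ k) u = c ^ k *s u + (of_nat k * c ^ (k - 1)) *s w" for k
  proof (induction k)
    case (Suc k)
    have "(N ^^ Suc k) u = c ^ Suc k *s u + (c ^ k + c * (of_nat k * c ^ (k - 1))) *s w"
      by (simp add: Suc N_add N_smult assms vec_eq_iff algebra_simps)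
    also have "c ^ k + c * (of_nat k * c ^ (k - 1)) = of_nat (Suc k) * c ^ (Suc k - 1)"
      by (cases k) (simp_all add: algebra_simps)
    finally show ?case .
  qed simp
  have "(\<lambda>k. ((1 / fact k) *\<^sub>R c ^ k) *s u + ((1 / fact k) *\<^sub>R (of_nat k * c ^ (k - 1))) *s w)
      = (\<lambda>k. (1 / fact k) *\<^sub>R (N ^^ k) u)"
    by (simp add: fun_eq_iff vec_eq_iff pow scaleR_add_right)
  moreover have "(\<lambda>k. ((1 / fact k) *\<^sub>R c ^ k) *s u + ((1 / fact k) *\<^sub>R (of_nat k * c ^ (k - 1))) *s w)
      sums (exp c *s u + exp c *s w)"
    by (intro sums_add bounded_linear.sums[OF bounded_linear_smult_left] exp_series_sums exp_deriv_series_sums)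
  ultimately have "(\<lambda>k. (1 / fact k) *\<^sub>R (N ^^ k) u) sums (exp c *s u + exp c *s w)" by (simp only:)
  then have "L u = exp c *s u + exp c *s w"
    using exp_sums[of u] by (intro sums_unique2)
  then show ?thesis by (simp add: vec_eq_iff distrib_left)
qed

section \<open>Polynomials in an operator\<close>

definition act :: "complex poly \<Rightarrow> complex^'n \<Rightarrow> complex^'n" where
  "act p u = (\<Sum>i\<le>degree p. coeff p i *s (N ^^ i) u)"

lemma act_eq: "degree p \<le> n \<Longrightarrow> act p u = (\<Sum>i\<le>n. coeff p i *s (N ^^ i) u)"
  unfolding act_def by (intro sum.mono_neutral_left) (auto simp: coeff_eq_0)

text \<open>Splitting off a root moves the factor \<open>N - c\<close> onto the vector, which is the
  descent step of an induction on the degree.\<close>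

lemma act_mult_linear: "act ([:- c, 1:] * q) u = act q (N u - c *s u)"
proof -
  let ?n = "degree q"
  have deg: "degree ([:- c, 1:] * q) \<le> Suc ?n"
    using degree_mult_le[of "[:- c, 1:]" q] by simp
  have "act ([:- c, 1:] * q) u = (\<Sum>i\<le>Suc ?n. coeff (smult (- c) q + pCons 0 q) i *s (N ^^ i) u)"
    by (subst act_eq[OF deg]) simp
  also have "\<dots> = (\<Sum>i\<le>Suc ?n. (- c * coeff q i) *s (N ^^ i) u) + (\<Sum>i\<le>Suc ?n. coeff (pCons 0 q) i *s (N ^^ i) u)"
    by (simp only: coeff_add coeff_smult vector_sadd_rdistrib sum.distrib)
  also have "(\<Sum>i\<le>Suc ?n. coeff (pCons 0 q) i *s (N ^^ i) u) = (\<Sum>i\<le>?n. coeff q i *s (N ^^ i) (N u))"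
    by (subst sum.atMost_Suc_shift) (simp add: funpow_swap1)
  also have "(\<Sum>i\<le>Suc ?n. (- c * coeff q i) *s (N ^^ i) u) = (\<Sum>i\<le>?n. (- c * coeff q i) *s (N ^^ i) u)"
    by (simp add: coeff_eq_0)
  also have "(\<Sum>i\<le>?n. (- c * coeff q i) *s (N ^^ i) u) + (\<Sum>i\<le>?n. coeff q i *s (N ^^ i) (N u)) =
      (\<Sum>i\<le>?n. coeff q i *s (N ^^ i) (N u + (- c) *s u))"
    unfolding sum.distrib[symmetric]
    by (rule sum.cong, rule refl, simp only: pow_add pow_smult) (simp add: vec_eq_iff algebra_simps)
  also have "N u + (- c) *s u = N u - c *s u"
    by (simp add: vec_eq_iff)
  finally show ?thesis by (simp add: act_def)
qed

text \<open>One more iterate than the real dimension cannot be independent, and a real dependency is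
  in particular a complex polynomial.\<close>

lemma ex_annihilator: "\<exists>p. p \<noteq> 0 \<and> act p u = 0"
proof -
  let ?d = "DIM(complex^'n)"
  let ?f = "\<lambda>i. (N ^^ i) u"
  show ?thesis
  \<comment> \<open>Dependence concerns sets of vectors, so repeated iterates are settled separately
    by a difference of two monomials.\<close>
  proof (cases "inj_on ?f {..?d}")
    case False
    then obtain i j where ij: "i \<noteq> j" "?f i = ?f j"
      by (auto simp: inj_on_def)
    define p where "p = monom 1 i - monom (1::complex) j"
    have "coeff p i = 1" using ij by (simp add: p_def)
    then have "p \<noteq> 0" by auto
    moreover have "act p u = 0"
    proof -
      have "degree p \<le> max i j"
        unfolding p_def by (intro degree_diff_le) (auto simp: degree_monom_eq)
      then have "act p u = (\<Sum>k\<le>max i j. coeff p k *s ?f k)" by (rule act_eq)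
      also have "\<dots> = (\<Sum>k\<le>max i j. (if k = i then ?f k else 0) - (if k = j then ?f k else 0))"
        by (intro sum.cong) (auto simp: p_def vec_eq_iff)
      also have "\<dots> = 0"
        by (simp add: sum_subtractf ij)
      finally show ?thesis .
    qed
    ultimately show ?thesis by blast
  next
    case True
    let ?S = "?f ` {..?d}"
    have "card ?S = ?d + 1" using True by (simp add: card_image)
    then have "dependent ?S" by (intro dependent_biggerset) auto
    then obtain c v where c: "v \<in> ?S" "c v \<noteq> 0" "(\<Sum>v\<in>?S. c v *\<^sub>R v) = 0"
      by (auto simp: dependent_finite)
    define p where "p = (\<Sum>k\<le>?d. monom (complex_of_real (c (?f k))) k)"
    have coeff: "coeff p i = (if i \<le> ?d then complex_of_real (c (?f i)) else 0)" for i
      by (simp add: p_def coeff_sum)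
    have "p \<noteq> 0"
    proof
      assume "p = 0"
      then have "c (?f i) = 0" if "i \<le> ?d" for i using coeff[of i] that by simp
      then show False using c(1,2) by auto
    qed
    moreover have "act p u = (\<Sum>i\<le>?d. coeff p i *s ?f i)"
      by (rule act_eq) (auto simp: coeff intro!: degree_le)
    then have "act p u = (\<Sum>i\<le>?d. c (?f i) *\<^sub>R ?f i)"
      by (simp add: coeff scaleR_eq_smult)
    then have "act p u = 0"
      using c(3) unfolding sum.reindex[OF True] o_def by (rule trans)
    ultimately show ?thesis by blast
  qed
qed

text \<open>The generalized eigenspaces of \<open>N\<close> inside the \<open>exp z\<close>-eigenspace of \<open>L\<close> belong to logarithms
  of \<open>exp z\<close>; the strip condition leaves only \<open>z\<close>, and a nontrivial Jordan block is impossible by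
  \<open>L_jordan\<close>.\<close>

lemma eigenvector_of_exp_eigenvector:
  assumes strip: "\<And>c u. u \<noteq> 0 \<Longrightarrow> N u = c *s u \<Longrightarrow> \<bar>Im c\<bar> < pi"
    and z: "Im z = 0" and u: "L u = exp z *s u"
  shows "N u = z *s u"
proof -
  have eigenvalue: "c = z" if v: "v \<noteq> 0" "N v = c *s v" "L v = exp z *s v" for c v
  proof -
    have "exp c *s v = exp z *s v" by (rule trans[OF L_eigenvector[OF v(2), symmetric] v(3)])
    then have "exp c = exp z" using v(1) by (auto simp: vec_eq_iff)
    then obtain n :: int where n: "c = z + of_int (2 * n) * pi * \<i>"
      using exp_eq[of c z] by auto
    have "\<bar>Im c\<bar> < pi" using strip[OF v(1,2)] .
    then have "\<bar>real_of_int (2 * n) * pi\<bar> < pi" using n z by simp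
    then have "\<bar>real_of_int (2 * n)\<bar> < 1" by (simp add: abs_mult)
    then have "n = 0" by linarith
    then show ?thesis using n by simp
  qed
  have "N u = z *s u" if "act p u = 0" "p \<noteq> 0" "L u = exp z *s u" for p u
    using that
  proof (induction "degree p" arbitrary: p u)
    case 0
    then obtain c where c: "p = [:c:]" by (metis degree_eq_zeroE)
    then have "u = 0" using 0 by (auto simp: act_def vec_eq_iff)
    then show ?case by (simp add: N_0)
  next
    case (Suc n)
    have "\<not> constant (poly p)" using Suc.hyps(2) by (simp add: constant_degree)
    \<comment> \<open>The cofactor \<open>q\<close> of this root annihilates \<open>w\<close>, which
      again lies in the \<open>exp z\<close>-eigenspace of \<open>L\<close>; so the induction
      hypothesis gives \<open>N w = z *s w\<close>.\<close>
    then obtain c where "poly p c = 0" using fundamental_theorem_of_algebra by blast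
    then obtain q where q: "p = [:- c, 1:] * q" by (auto simp: poly_eq_0_iff_dvd dvd_def)
    have q0: "q \<noteq> 0" using Suc.prems(2) q by auto
    have deg: "degree q = n"
      using Suc.hyps(2) q q0 by (subst (asm) q) (simp add: degree_mult_eq del: mult_pCons_left)
    define w where "w = N u - c *s u"
    have Nu: "N u = c *s u + w" by (simp add: w_def)
    have L_diff: "L (N u - d *s u) = exp z *s (N u - d *s u)" for d
    proof -
      have "L (N u + (- d) *s u) = exp z *s (N u + (- d) *s u)"
        unfolding L_add L_smult L_commute Suc.prems(3) N_smult by (simp add: vec_eq_iff algebra_simps)
      moreover have "N u + (- d) *s u = N u - d *s u" by (simp add: vec_eq_iff)
      ultimately show ?thesis by simp
    qed
    have "act q w = 0" using Suc.prems(1) unfolding q act_mult_linear w_def .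
    then have Nw: "N w = z *s w"
      using Suc.hyps(1)[OF deg[symmetric] _ q0] L_diff w_def by blast
    show ?case
    proof (cases "c = z")
      case True
      then have "L u = exp z *s (u + w)" using L_jordan[of u z w] Nu Nw by simp
      then have "w = 0" using Suc.prems(3) by (auto simp: vec_eq_iff)
      then show ?thesis using Nu True by simp
    next
      case False
      \<comment> \<open>\<open>N - c\<close> and \<open>N - z\<close> commute and the latter kills
        \<open>w\<close>, so \<open>N - c\<close> kills \<open>v\<close>. As \<open>c\<close>
        differs from \<open>z\<close>, the fact \<open>eigenvalue\<close> forces
        \<open>v = 0\<close>.\<close>
      define v where "v = N u - z *s u"
      have "N v = c *s v"
      proof -
        have w: "w = v + (z - c) *s u" by (simp add: v_def w_def vec_eq_iff algebra_simps)
        have Nu': "N u = v + z *s u" by (simp add: v_def)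
        have "N v + (z - c) *s N u = z *s w" using Nw by (subst (asm) w) (simp only: N_add N_smult)
        then have "N v = z *s w - (z - c) *s N u" by (simp only: eq_diff_eq)
        also have "\<dots> = c *s v" unfolding w Nu' by (simp add: vec_eq_iff algebra_simps)
        finally show ?thesis .
      qed
      moreover have "L v = exp z *s v" unfolding v_def by (rule L_diff)
      ultimately have "v = 0" using eigenvalue[of v c] False by blast
      then show ?thesis by (simp add: v_def)
    qed
  qed
  then show ?thesis using ex_annihilator[of u] u by blast
qed

end

subsection \<open>The matrix exponential\<close>

lemma bounded_bilinear_matrix_mult:
  "bounded_bilinear ((**) :: real^'n^'m \<Rightarrow> real^'p^'n \<Rightarrow> real^'p^'m)"
  unfolding bilinear_conv_bounded_bilinear[symmetric] bilinear_def
  by (auto intro!: linearI simp: vec_eq_iff matrix_matrix_mult_def sum.distrib sum_distrib_left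
      algebra_simps)

lemma mat_power_Suc: "mat_power A (Suc k) = A ** mat_power A k"
  by (simp add: mat_power_def)

lemma mat_power_0: "mat_power A 0 = mat 1"
  by (simp add: mat_power_def)

text \<open>With the bilinear bound \<open>K\<close> for the matrix product, powers grow at most
  geometrically with ratio \<open>norm X * K\<close>, and an exponential series dominates.\<close>

lemma mat_exp_sums:
  fixes X :: "real^'n^'n"
  shows "(\<lambda>k. (1 / fact k) *\<^sub>R mat_power X k) sums mat_exp X"
proof -
  obtain K where K: "K > 0" "\<And>(A :: real^'n^'n) (B :: real^'n^'n). norm (A ** B) \<le> norm A * norm B * K"
    using bounded_bilinear.pos_bounded[OF bounded_bilinear_matrix_mult] by blast
  have bound: "norm (mat_power X k) \<le> norm (mat 1 :: real^'n^'n) * (norm X * K) ^ k" for k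
  proof (induction k)
    case (Suc k)
    have "norm (mat_power X (Suc k)) \<le> norm X * norm (mat_power X k) * K"
      unfolding mat_power_Suc using K(2)[of X "mat_power X k"] .
    also have "\<dots> \<le> norm X * (norm (mat 1 :: real^'n^'n) * (norm X * K) ^ k) * K"
      using Suc K(1) by (intro mult_right_mono mult_left_mono) auto
    finally show ?case by (simp add: mult_ac)
  qed (simp add: mat_power_0)
  have "summable (\<lambda>k. norm (mat 1 :: real^'n^'n) * ((norm X * K) ^ k /\<^sub>R fact k))"
    by (intro summable_mult summable_exp_generic)
  then have "summable (\<lambda>k. (1 / fact k) *\<^sub>R mat_power X k)"
  proof (rule summable_comparison_test[rotated], intro exI allI impI)
    fix k
    have "norm ((1 / fact k) *\<^sub>R mat_power X k) = norm (mat_power X k) / fact k" by simp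
    also have "\<dots> \<le> norm (mat 1 :: real^'n^'n) * (norm X * K) ^ k / fact k"
      by (intro divide_right_mono bound) auto
    finally show "norm ((1 / fact k) *\<^sub>R mat_power X k) \<le> norm (mat 1 :: real^'n^'n) * ((norm X * K) ^ k /\<^sub>R fact k)"
      by (simp add: divide_inverse mult_ac)
  qed
  then show ?thesis unfolding mat_exp_def by (rule summable_sums)
qed

abbreviation cmat :: "real^'n^'m \<Rightarrow> complex^'n^'m" where
  "cmat \<equiv> map_matrix complex_of_real"

lemma cmat_mult: "cmat (A ** B) = cmat A ** cmat B"
  by (simp add: vec_eq_iff matrix_matrix_mult_def)

text \<open>Rows, because standard row vectors 1 and 2 are left eigenvectors of the matrices in
  \<open>H_group\<close>; complex scalars, because the strip condition concerns complex
  eigenvalues.\<close>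

lemma exp_operator_rows:
  fixes X :: "real^'n^'n"
  shows "exp_operator (\<lambda>u. u v* cmat X) (\<lambda>u. u v* cmat (mat_exp X))"
proof
  fix u v :: "complex^'n" and c
  show "(u + v) v* cmat X = u v* cmat X + v v* cmat X"
    by (simp add: vec_eq_iff vector_matrix_mult_def sum.distrib algebra_simps)
  show "(c *s u) v* cmat X = c *s (u v* cmat X)"
    by (simp add: vec_eq_iff vector_matrix_mult_def sum_distrib_left algebra_simps)
  have pow: "((\<lambda>u. u v* cmat X) ^^ k) u = u v* cmat (mat_power X k)" for k u
  proof (induction k arbitrary: u)
    case 0
    have "cmat (mat 1) = (mat 1 :: complex^'n^'n)" by (simp add: vec_eq_iff mat_def)
    then show ?case by (simp add: mat_power_0)
  next
    case (Suc k)
    then show ?case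
      by (simp only: funpow_Suc_right o_apply mat_power_Suc cmat_mult vector_matrix_mul_assoc)
  qed
  have "bounded_linear (\<lambda>A :: real^'n^'n. u v* cmat A)"
    unfolding linear_conv_bounded_linear[symmetric]
    by (rule linearI)
      (simp_all add: vec_eq_iff vector_matrix_mult_def sum.distrib algebra_simps scaleR_eq_smult sum_distrib_left)
  note lin = this
  have scale: "u v* cmat (r *\<^sub>R A) = r *\<^sub>R (u v* cmat A)" for r and A :: "real^'n^'n"
    using linear_scale[OF bounded_linear.linear[OF lin]] .
  show "(\<lambda>k. (1 / fact k) *\<^sub>R ((\<lambda>u. u v* cmat X) ^^ k) u) sums (u v* cmat (mat_exp X))"
    using bounded_linear.sums[OF lin mat_exp_sums[of X]] unfolding scale pow .
qed

text \<open>\<open>complex_eigenvalue\<close> speaks of column eigenvectors; a square matrix and its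
  transpose are singular together, so left eigenvalues qualify as well.\<close>

lemma complex_eigenvalue_rows:
  fixes X :: "real^'n^'n"
  assumes "u \<noteq> 0" "u v* cmat X = c *s u"
  shows "complex_eigenvalue X c"
proof -
  \<comment> \<open>The subtracted matrix is \<open>c\<close> times the identity.\<close>
  let ?A = "cmat X - ((\<chi> i. c *s mat 1 $ i) :: complex^'n^'n)"
  have eq: "((\<chi> i. c *s mat 1 $ i) :: complex^'n^'n) *v w = c *s w" "w v* ((\<chi> i. c *s mat 1 $ i) :: complex^'n^'n) = c *s w" for w
    by (simp_all add: vec_eq_iff matrix_vector_mult_def vector_matrix_mult_def mat_def if_distrib[of "\<lambda>x. _ * x"]
        if_distrib[of "\<lambda>x. x * _"] cong: if_cong)
  have "transpose ?A *v u = 0"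
    by (simp add: vector_matrix_mult_diff_rdistrib eq assms(2))
  then have "\<not> (\<exists>B. B ** transpose ?A = mat 1)"
    using assms(1) by (auto simp: matrix_left_invertible_ker)
  then have "\<not> (\<exists>B. B ** ?A = mat 1)"
    using left_invertible_transpose matrix_left_right_inverse by metis
  then obtain w where "w \<noteq> 0" "?A *v w = 0"
    by (auto simp: matrix_left_invertible_ker)
  then show ?thesis
    unfolding complex_eigenvalue_def by (intro exI[of _ w]) (simp add: matrix_vector_mult_diff_rdistrib eq)
qed

text \<open>\<open>axis i 1\<close> is a left eigenvector of \<open>mat_exp X\<close> for the
  exponential of the real number \<open>ln \<mu>\<close>. The strip condition makes it one of
  \<open>X\<close>, and this determines row \<open>i\<close> of \<open>X\<close>.\<close>

lemma row_eigenvector_log: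
  fixes X :: "real^'n^'n"
  assumes strip: "\<And>c. complex_eigenvalue X c \<Longrightarrow> \<bar>Im c\<bar> < pi"
    and row: "\<And>j. mat_exp X $ i $ j = (if i = j then \<mu> else 0)" and \<mu>: "\<mu> > 0"
  shows "X $ i $ j = (if i = j then ln \<mu> else 0)"
proof -
  interpret exp_operator "\<lambda>u. u v* cmat X" "\<lambda>u. u v* cmat (mat_exp X)"
    by (rule exp_operator_rows)
  have axis: "(axis i 1 v* cmat A) $ j = complex_of_real (A $ i $ j)" for A :: "real^'n^'n" and j
    by (simp add: vector_matrix_mult_def axis_def if_distrib[of "\<lambda>x. x * _"] cong: if_cong)
  have "axis i 1 v* cmat X = complex_of_real (ln \<mu>) *s axis i 1"
  proof (rule eigenvector_of_exp_eigenvector)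
    show "\<bar>Im c\<bar> < pi" if "u \<noteq> 0" "u v* cmat X = c *s u" for c u
      using strip complex_eigenvalue_rows[OF that] .
    show "axis i 1 v* cmat (mat_exp X) = exp (complex_of_real (ln \<mu>)) *s axis i 1"
      unfolding vec_eq_iff axis using \<mu> row by (auto simp: axis_def exp_of_real)
  qed simp
  then have "complex_of_real (X $ i $ j) = (complex_of_real (ln \<mu>) *s axis i 1) $ j"
    using axis by metis
  then show ?thesis by (auto simp: axis_def split: if_splits)
qed

subsection \<open>Exponential and logarithm on the triangular group\<close>

definition hmat :: "real \<Rightarrow> real \<Rightarrow> real \<Rightarrow> real \<Rightarrow> real \<Rightarrow> real^3^3" where
  "hmat a b f p q = vector [vector [a, 0, 0], vector [0, b, 0], vector [p, q, f]]"

lemma hmat_nth [simp]: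
  "hmat a b f p q $ 1 $ 1 = a" "hmat a b f p q $ 1 $ 2 = 0" "hmat a b f p q $ 1 $ 3 = 0"
  "hmat a b f p q $ 2 $ 1 = 0" "hmat a b f p q $ 2 $ 2 = b" "hmat a b f p q $ 2 $ 3 = 0"
  "hmat a b f p q $ 3 $ 1 = p" "hmat a b f p q $ 3 $ 2 = q" "hmat a b f p q $ 3 $ 3 = f"
  by (simp_all add: hmat_def)

lemma hmat_rows:
  "hmat a b f p q $ 1 $ j = (if 1 = j then a else 0)"
  "hmat a b f p q $ 2 $ j = (if 2 = j then b else 0)"
  using exhaust_3[of j] by auto

lemma mat_eq_iff_3: "(A :: 'a^3^3) = B \<longleftrightarrow>
    A$1$1 = B$1$1 \<and> A$1$2 = B$1$2 \<and> A$1$3 = B$1$3 \<and>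
    A$2$1 = B$2$1 \<and> A$2$2 = B$2$2 \<and> A$2$3 = B$2$3 \<and>
    A$3$1 = B$3$1 \<and> A$3$2 = B$3$2 \<and> A$3$3 = B$3$3"
  by (simp only: vec_eq_iff forall_3 conj_assoc)

lemma hmat_eq_iff: "hmat a b f p q = hmat a' b' f' p' q' \<longleftrightarrow> a = a' \<and> b = b' \<and> f = f' \<and> p = p' \<and> q = q'"
  by (auto simp: mat_eq_iff_3)

lemma mult_nth_3: "((A :: real^3^3) ** B) $ i $ j = A$i$1 * B$1$j + A$i$2 * B$2$j + A$i$3 * B$3$j"
  by (simp add: matrix_matrix_mult_def sum_3)

lemma hmat_mult: "hmat a b f p q ** hmat a' b' f' p' q' =
    hmat (a * a') (b * b') (f * f') (p * a' + f * p') (q * b' + f * q')"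
  by (simp add: mat_eq_iff_3 mult_nth_3)

lemma hmat_add: "hmat a b f p q + hmat a' b' f' p' q' = hmat (a + a') (b + b') (f + f') (p + p') (q + q')"
  and hmat_scaleR: "c *\<^sub>R hmat a b f p q = hmat (c * a) (c * b) (c * f) (c * p) (c * q)"
  and hmat_1: "mat 1 = hmat 1 1 1 0 0"
  by (simp_all add: mat_eq_iff_3 mat_def)

text \<open>Being linear in the five entries, this reduces series, derivatives and smoothness of
  matrix functions to those of the entries.\<close>

lemma hmat_decompose: "hmat a b f p q = a *\<^sub>R hmat 1 0 0 0 0 + b *\<^sub>R hmat 0 1 0 0 0 + f *\<^sub>R hmat 0 0 1 0 0 +
    p *\<^sub>R hmat 0 0 0 1 0 + q *\<^sub>R hmat 0 0 0 0 1"
  by (simp add: hmat_add hmat_scaleR)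

lemma h_algebra_iff: "A \<in> h_algebra \<longleftrightarrow> (\<exists>a b f p q. A = hmat a b f p q)"
proof
  assume "A \<in> h_algebra"
  then have "A = hmat (A$1$1) (A$2$2) (A$3$3) (A$3$1) (A$3$2)"
    by (auto simp: h_algebra_def mat_eq_iff_3)
  then show "\<exists>a b f p q. A = hmat a b f p q" by blast
qed (auto simp: h_algebra_def)

lemma hmat_in_h [simp]: "hmat a b f p q \<in> h_algebra"
  unfolding h_algebra_iff by blast

lemma h_algebraE:
  assumes "A \<in> h_algebra"
  obtains a b f p q where "A = hmat a b f p q"
  using assms h_algebra_iff by blast

lemma hmat_in_H [simp]: "hmat a b f p q \<in> H_group \<longleftrightarrow> a > 0 \<and> b > 0 \<and> f > 0"
  by (simp add: H_group_def forall_3)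

lemma H_groupE:
  assumes "T \<in> H_group"
  obtains a b f p q where "T = hmat a b f p q" "a > 0" "b > 0" "f > 0"
  using assms h_algebraE[of T] by (metis (no_types, lifting) H_group_def hmat_in_H mem_Collect_eq)

lemma subspace_h: "subspace h_algebra"
  unfolding subspace_def
proof (intro conjI ballI allI)
  show "0 \<in> h_algebra" by (simp add: h_algebra_def)
qed (auto elim!: h_algebraE simp: hmat_add hmat_scaleR)

lemma h_mult: "A \<in> h_algebra \<Longrightarrow> B \<in> h_algebra \<Longrightarrow> A ** B \<in> h_algebra"
  by (auto elim!: h_algebraE simp: hmat_mult)

lemma H_mult: "S \<in> H_group \<Longrightarrow> T \<in> H_group \<Longrightarrow> S ** T \<in> H_group"
  by (auto elim!: H_groupE simp: hmat_mult)

lemma H_subset_h: "T \<in> H_group \<Longrightarrow> T \<in> h_algebra"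
  by (simp add: H_group_def)

lemma matrix_inv_eqI:
  assumes "A ** B = mat 1" "B ** A = mat 1"
  shows "matrix_inv (A :: real^'n^'n) = B"
proof -
  have inv: "A ** matrix_inv A = mat 1"
    unfolding matrix_inv_def using someI[of "\<lambda>A'. A ** A' = mat 1 \<and> A' ** A = mat 1" B] assms by blast
  have "matrix_inv A = (B ** A) ** matrix_inv A" by (simp add: assms)
  also have "\<dots> = B" unfolding matrix_mul_assoc[symmetric] inv by simp
  finally show ?thesis .
qed

lemma matrix_inv_hmat:
  assumes "a > 0" "b > 0" "f > 0"
  shows "matrix_inv (hmat a b f p q) = hmat (1 / a) (1 / b) (1 / f) (- p / (a * f)) (- q / (b * f))"
  using assms by (intro matrix_inv_eqI) (simp_all add: hmat_mult hmat_1 hmat_eq_iff field_simps)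

lemma H_inv:
  assumes "T \<in> H_group"
  shows "matrix_inv T \<in> H_group" "T ** matrix_inv T = mat 1" "matrix_inv T ** T = mat 1"
  using assms by (auto elim!: H_groupE simp: matrix_inv_hmat hmat_mult hmat_1 hmat_eq_iff field_simps)

text \<open>The divided difference of \<open>exp\<close>, with its confluent value on the diagonal:
  the off-diagonal factor in the exponential of a triangular block.\<close>

definition exp_quot :: "real \<Rightarrow> real \<Rightarrow> real" where
  "exp_quot x y = (if x = y then exp x else (exp x - exp y) / (x - y))"

lemma exp_quot_mult: "(x - y) * exp_quot x y = exp x - exp y"
  by (simp add: exp_quot_def)

text \<open>\<open>exp\<close> is increasing. Positivity lets the off-diagonal entries be recovered
  from those of the exponential, which yields both injectivity and an explicit logarithm.\<close>

lemma exp_quot_pos: "exp_quot x y > 0"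
  by (cases x y rule: linorder_cases) (simp_all add: exp_quot_def divide_neg_neg)

lemma exp_quot_minus: "exp_quot (- x) (- y) = exp (- x) * exp (- y) * exp_quot x y"
proof (cases "x = y")
  case False
  then show ?thesis
    by (simp add: exp_quot_def exp_minus field_simps)
qed (simp add: exp_quot_def flip: exp_add)

text \<open>The divided difference of the \<open>k\<close>-th power. The recursion
  \<open>pow_quot_Suc\<close> is that of the last-row entries of matrix powers under left
  multiplication by \<open>hmat a b f p q\<close>.\<close>

definition pow_quot :: "nat \<Rightarrow> real \<Rightarrow> real \<Rightarrow> real" where
  "pow_quot k x y = (if x = y then real k * x ^ (k - 1) else (x ^ k - y ^ k) / (x - y))"

lemma pow_quot_Suc: "pow_quot (Suc k) x y = x ^ k + y * pow_quot k x y"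
proof (cases "x = y")
  case True
  then show ?thesis by (cases k) (simp_all add: pow_quot_def algebra_simps)
qed (simp add: pow_quot_def field_simps)

lemma pow_quot_sums: "(\<lambda>k. 1 / fact k * pow_quot k x y) sums exp_quot x y"
proof (cases "x = y")
  case True
  then show ?thesis using exp_deriv_series_sums[of x] by (simp add: pow_quot_def exp_quot_def)
next
  case False
  have "(\<lambda>k. ((1 / fact k) *\<^sub>R x ^ k - (1 / fact k) *\<^sub>R y ^ k) / (x - y)) sums ((exp x - exp y) / (x - y))"
    by (intro sums_divide sums_diff exp_series_sums)
  moreover have "((1 / fact k) *\<^sub>R x ^ k - (1 / fact k) *\<^sub>R y ^ k) / (x - y) = 1 / fact k * pow_quot k x y" for k
    using False by (simp add: pow_quot_def diff_divide_distrib right_diff_distrib)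
  ultimately show ?thesis using False by (simp add: exp_quot_def)
qed

lemma mat_power_hmat: "mat_power (hmat a b f p q) k =
    hmat (a ^ k) (b ^ k) (f ^ k) (p * pow_quot k a f) (q * pow_quot k b f)"
proof (induction k)
  case 0
  show ?case by (simp add: mat_power_0 hmat_1 hmat_eq_iff pow_quot_def)
next
  case (Suc k)
  show ?case
    by (simp add: mat_power_Suc Suc hmat_mult hmat_eq_iff pow_quot_Suc algebra_simps)
qed

lemma sums_hmat:
  assumes "a sums a'" "b sums b'" "f sums f'" "p sums p'" "q sums q'"
  shows "(\<lambda>k. hmat (a k) (b k) (f k) (p k) (q k)) sums hmat a' b' f' p' q'"
  unfolding hmat_decompose[of "a _"] hmat_decompose[of a']
  using assms by (intro sums_add bounded_linear.sums[OF bounded_linear_scaleR_left])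

lemma mat_exp_hmat: "mat_exp (hmat a b f p q) =
    hmat (exp a) (exp b) (exp f) (p * exp_quot a f) (q * exp_quot b f)"
proof -
  have "(\<lambda>k. hmat (1 / fact k * a ^ k) (1 / fact k * b ^ k) (1 / fact k * f ^ k)
      (p * (1 / fact k * pow_quot k a f)) (q * (1 / fact k * pow_quot k b f)))
      sums hmat (exp a) (exp b) (exp f) (p * exp_quot a f) (q * exp_quot b f)"
    using exp_series_sums[of a] exp_series_sums[of b] exp_series_sums[of f]
    by (intro sums_hmat sums_mult pow_quot_sums) simp_all
  then have "(\<lambda>k. (1 / fact k) *\<^sub>R mat_power (hmat a b f p q) k)
      sums hmat (exp a) (exp b) (exp f) (p * exp_quot a f) (q * exp_quot b f)"
    by (simp add: mat_power_hmat hmat_scaleR mult_ac)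
  then show ?thesis using mat_exp_sums sums_unique2 by blast
qed

lemma mat_exp_in_H: "A \<in> h_algebra \<Longrightarrow> mat_exp A \<in> H_group"
  by (auto elim!: h_algebraE simp: mat_exp_hmat)

lemma mat_exp_inj:
  assumes "A \<in> h_algebra" "B \<in> h_algebra" "mat_exp A = mat_exp B"
  shows "A = B"
  using assms exp_quot_pos by (auto elim!: h_algebraE simp: mat_exp_hmat hmat_eq_iff less_le)

lemma h_scaleR: "A \<in> h_algebra \<Longrightarrow> c *\<^sub>R A \<in> h_algebra"
  by (rule subspace_scale[OF subspace_h])

lemma mat_exp_minus:
  assumes "A \<in> h_algebra"
  shows "mat_exp ((- t) *\<^sub>R A) ** mat_exp (t *\<^sub>R A) = mat 1"
proof -
  obtain a b f p q where A: "A = hmat a b f p q" using assms by (rule h_algebraE)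
  have "- t * r * exp_quot (- t * x) (- t * f) * exp (t * x) + exp (- t * f) * (t * r * exp_quot (t * x) (t * f)) = 0" for r x
    using exp_quot_minus[of "t * x" "t * f"] by (simp add: exp_minus)
  then show ?thesis
    unfolding A hmat_scaleR mat_exp_hmat hmat_mult hmat_1 hmat_eq_iff
    by (simp add: exp_minus)
qed

lemma mat_exp_commute:
  assumes "A \<in> h_algebra"
  shows "A ** mat_exp (t *\<^sub>R A) = mat_exp (t *\<^sub>R A) ** A"
proof -
  obtain a b f p q where A: "A = hmat a b f p q" using assms by (rule h_algebraE)
  have "exp (t * x) + f * (t * exp_quot (t * x) (t * f)) = t * exp_quot (t * x) (t * f) * x + exp (t * f)" for x
    using exp_quot_mult[of "t * x" "t * f"] by (simp add: algebra_simps)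
  from this[of a] this[of b]
  have "r * exp (t * a) + f * (t * r * exp_quot (t * a) (t * f)) = t * r * exp_quot (t * a) (t * f) * a + exp (t * f) * r"
    and "r * exp (t * b) + f * (t * r * exp_quot (t * b) (t * f)) = t * r * exp_quot (t * b) (t * f) * b + exp (t * f) * r" for r
    by algebra+
  then show ?thesis
    by (simp add: A hmat_scaleR mat_exp_hmat hmat_mult hmat_eq_iff)
qed

lemma has_vector_derivative_hmat:
  assumes "(a has_real_derivative a') F" "(b has_real_derivative b') F" "(f has_real_derivative f') F"
    "(p has_real_derivative p') F" "(q has_real_derivative q') F"
  shows "((\<lambda>t. hmat (a t) (b t) (f t) (p t) (q t)) has_vector_derivative hmat a' b' f' p' q') F"
  unfolding hmat_decompose[of "a _"] hmat_decompose[of a']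
  using assms unfolding has_real_derivative_iff_has_vector_derivative
  by (intro has_vector_derivative_add bounded_linear.has_vector_derivative[OF bounded_linear_scaleR_left])

lemma mat_exp_has_derivative:
  assumes "A \<in> h_algebra"
  shows "((\<lambda>t. mat_exp (t *\<^sub>R A)) has_vector_derivative mat_exp (t *\<^sub>R A) ** A) (at t within S)"
proof -
  obtain a b f p q where A: "A = hmat a b f p q" using assms by (rule h_algebraE)
  have quot: "((\<lambda>t. t * r * exp_quot (t * x) (t * f)) has_real_derivative
      t * r * exp_quot (t * x) (t * f) * x + exp (t * f) * r) (at t within S)" for r x
  proof (cases "x = f")
    case True
    then show ?thesis
      by (auto simp: exp_quot_def intro!: derivative_eq_intros)
  next
    case False
    \<comment> \<open>Absorbing \<open>t\<close> leaves the fixed denominator \<open>x - f\<close>,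
      so that \<open>t = 0\<close> is no exception.\<close>
    have eq: "t * exp_quot (t * x) (t * f) = (exp (t * x) - exp (t * f)) / (x - f)" for t
      using exp_quot_mult[of "t * x" "t * f"] False by (simp add: field_simps)
    have eq': "t * r * exp_quot (t * x) (t * f) = r * ((exp (t * x) - exp (t * f)) / (x - f))" for t
      using eq[of t] by (simp add: mult_ac)
    have "((\<lambda>t. r * ((exp (t * x) - exp (t * f)) / (x - f))) has_real_derivative
        r * ((exp (t * x) * x - exp (t * f) * f) / (x - f))) (at t within S)"
      using False by (auto intro!: derivative_eq_intros)
    moreover have "(exp (t * x) * x - exp (t * f) * f) / (x - f) =
        (exp (t * x) - exp (t * f)) / (x - f) * x + exp (t * f)"
    proof -
      have "exp (t * x) * x - exp (t * f) * f = (exp (t * x) - exp (t * f)) * x + exp (t * f) * (x - f)"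
        by algebra
      then show ?thesis using False by (simp add: add_divide_distrib)
    qed
    ultimately show ?thesis unfolding eq' by (simp only: distrib_left mult.commute mult.left_commute)
  qed
  show ?thesis
    unfolding A hmat_scaleR mat_exp_hmat hmat_mult
    by (intro has_vector_derivative_hmat quot) (auto intro!: derivative_eq_intros)
qed

section \<open>The principal logarithm on the group\<close>

lemma complex_eigenvalue_hmat:
  assumes "complex_eigenvalue (hmat a b f p q) c"
  shows "c \<in> complex_of_real ` {a, b, f}"
proof -
  obtain v where v: "v \<noteq> 0" "cmat (hmat a b f p q) *v v = c *s v"
    using assms unfolding complex_eigenvalue_def by blast
  have "a * v$1 = c * v$1" "b * v$2 = c * v$2" "p * v$1 + q * v$2 + f * v$3 = c * v$3"
    using v(2) by (simp_all add: vec_eq_iff forall_3 matrix_vector_mult_def sum_3)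
  moreover have "v$1 \<noteq> 0 \<or> v$2 \<noteq> 0 \<or> v$3 \<noteq> 0"
    using v(1) by (auto simp: vec_eq_iff forall_3)
  ultimately show ?thesis by auto
qed

text \<open>For an arbitrary competitor \<open>X\<close>, \<open>row_eigenvector_log\<close> fixes
  the first two rows. This already forces \<open>X\<close> into \<open>h_algebra\<close>, where
  \<open>mat_exp\<close> is injective.\<close>

lemma mat_log_hmat:
  assumes "a > 0" "b > 0" "f > 0"
  shows "mat_log (hmat a b f p q) =
    hmat (ln a) (ln b) (ln f) (p / exp_quot (ln a) (ln f)) (q / exp_quot (ln b) (ln f))" (is "_ = ?Y")
  unfolding mat_log_def
proof (rule the_equality)
  have Y: "mat_exp ?Y = hmat a b f p q"
    using assms exp_quot_pos[of "ln a" "ln f"] exp_quot_pos[of "ln b" "ln f"]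
    by (simp add: mat_exp_hmat hmat_eq_iff)
  then show "mat_exp ?Y = hmat a b f p q \<and> (\<forall>z. complex_eigenvalue ?Y z \<longrightarrow> \<bar>Im z\<bar> < pi)"
    using complex_eigenvalue_hmat by fastforce
  fix X assume X: "mat_exp X = hmat a b f p q \<and> (\<forall>z. complex_eigenvalue X z \<longrightarrow> \<bar>Im z\<bar> < pi)"
  have "X $ 1 $ j = (if 1 = j then ln a else 0)" for j
    by (rule row_eigenvector_log) (use X assms in \<open>auto simp: hmat_rows\<close>)
  moreover have "X $ 2 $ j = (if 2 = j then ln b else 0)" for j
    by (rule row_eigenvector_log) (use X assms in \<open>auto simp: hmat_rows\<close>)
  ultimately have "X = hmat (ln a) (ln b) (X$3$3) (X$3$1) (X$3$2)"
    by (simp add: mat_eq_iff_3)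
  then have "X \<in> h_algebra" unfolding h_algebra_iff by (intro exI)
  then show "X = ?Y" by (rule mat_exp_inj) (simp_all add: X Y)
qed

lemma mat_log_in_h: "T \<in> H_group \<Longrightarrow> mat_log T \<in> h_algebra"
  by (auto elim!: H_groupE simp: mat_log_hmat)

lemma mat_exp_log: "T \<in> H_group \<Longrightarrow> mat_exp (mat_log T) = T"
  using exp_quot_pos by (auto elim!: H_groupE simp: mat_log_hmat mat_exp_hmat hmat_eq_iff less_le)

text \<open>The product of \<open>T t\<close> with the exponential of \<open>- t\<close> times
  \<open>A\<close> has derivative zero, because \<open>A\<close> commutes with its
  exponentials.\<close>

lemma one_parameter_curve_unique:
  assumes A: "A \<in> h_algebra" and T: "\<And>t. t \<in> {0..1} \<Longrightarrow> (T has_vector_derivative T t ** A) (at t within {0..1})"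
    and t: "t \<in> {0..1::real}"
  shows "T t = T 0 ** mat_exp (t *\<^sub>R A)"
proof -
  let ?E = "\<lambda>t. mat_exp ((- t) *\<^sub>R A)"
  have E: "(?E has_vector_derivative - (?E t ** A)) (at t within {0..1})" for t
  proof -
    have "((\<lambda>t. mat_exp (t *\<^sub>R (- A))) has_vector_derivative mat_exp (t *\<^sub>R (- A)) ** (- A)) (at t within {0..1})"
      by (rule mat_exp_has_derivative) (use subspace_neg[OF subspace_h] A in blast)
    then show ?thesis by (simp add: bounded_bilinear.minus_right[OF bounded_bilinear_matrix_mult])
  qed
  have "((\<lambda>t. T t ** ?E t) has_vector_derivative 0) (at t within {0..1})" if "t \<in> {0..1}" for t
  proof -
    have "((\<lambda>t. T t ** ?E t) has_vector_derivative T t ** (- (?E t ** A)) + T t ** A ** ?E t) (at t within {0..1})"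
      by (rule bounded_bilinear.has_vector_derivative[OF bounded_bilinear_matrix_mult T[OF that] E])
    moreover have "T t ** A ** ?E t = T t ** (?E t ** A)"
      using mat_exp_commute[OF A, of "- t"] by (simp only: matrix_mul_assoc[symmetric])
    ultimately show ?thesis by (simp add: bounded_bilinear.minus_right[OF bounded_bilinear_matrix_mult])
  qed
  then have "T t ** ?E t = T 0 ** ?E 0"
    using has_derivative_zero_unique[of "{0..1}" "\<lambda>t. T t ** ?E t" t 0] t
    by (auto simp: has_vector_derivative_def)
  moreover have "?E 0 = mat 1" using A by (auto elim!: h_algebraE simp: hmat_scaleR mat_exp_hmat hmat_1 simp del: scaleR_zero_left)
  ultimately have "T t ** (?E t ** mat_exp (t *\<^sub>R A)) = T 0 ** mat_exp (t *\<^sub>R A)"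
    by (simp add: matrix_mul_assoc)
  then show ?thesis using mat_exp_minus[OF A, of t] by simp
qed

context linear_domain
begin

lemma smooth_hmat:
  assumes "smooth_fun E M a" "smooth_fun E M b" "smooth_fun E M f" "smooth_fun E M p" "smooth_fun E M q"
  shows "smooth_fun E M (\<lambda>x. hmat (a x) (b x) (f x) (p x) (q x))"
  unfolding hmat_decompose[of "a _"]
  by (intro smooth_add smooth_bounded_linear[OF bounded_linear_scaleR_left] assms)

lemma smooth_nth:
  fixes f :: "'a \<Rightarrow> real^'n^'m"
  shows "smooth_fun E M f \<Longrightarrow> smooth_fun E M (\<lambda>x. f x $ i $ j)"
  by (rule smooth_bounded_linear[OF bounded_linear_compose[OF bounded_linear_vec_nth bounded_linear_vec_nth]])

end

subsection \<open>The Cholesky decomposition as a diffeomorphism\<close>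

definition smat :: "real \<Rightarrow> real \<Rightarrow> real \<Rightarrow> real \<Rightarrow> real \<Rightarrow> real^3^3" where
  "smat x y z u w = vector [vector [x, 0, u], vector [0, y, w], vector [u, w, z]]"

lemma smat_nth [simp]:
  "smat x y z u w $ 1 $ 1 = x" "smat x y z u w $ 1 $ 2 = 0" "smat x y z u w $ 1 $ 3 = u"
  "smat x y z u w $ 2 $ 1 = 0" "smat x y z u w $ 2 $ 2 = y" "smat x y z u w $ 2 $ 3 = w"
  "smat x y z u w $ 3 $ 1 = u" "smat x y z u w $ 3 $ 2 = w" "smat x y z u w $ 3 $ 3 = z"
  by (simp_all add: smat_def)

lemma transpose_nth: "transpose A $ i $ j = A $ j $ i"
  by (simp add: transpose_def)

lemma V_space_iff: "A \<in> V_space \<longleftrightarrow> (\<exists>x y z u w. A = smat x y z u w)"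
proof
  assume A: "A \<in> V_space"
  then have "A $ j $ i = A $ i $ j" for i j
    unfolding V_space_def using transpose_nth[of A i j] by auto
  then have "A = smat (A$1$1) (A$2$2) (A$3$3) (A$1$3) (A$2$3)"
    using A by (auto simp: V_space_def mat_eq_iff_3)
  then show "\<exists>x y z u w. A = smat x y z u w" by blast
next
  assume "\<exists>x y z u w. A = smat x y z u w"
  then obtain x y z u w where "A = smat x y z u w" by blast
  then show "A \<in> V_space" by (simp add: V_space_def mat_eq_iff_3 transpose_nth)
qed

lemma smat_in_V [simp]: "smat x y z u w \<in> V_space"
  unfolding V_space_iff by blast

lemma subspace_V: "subspace V_space"
  by (auto simp: subspace_def V_space_def vec_eq_iff transpose_def)

lemma quadratic_form_smat:
  "v \<bullet> (smat x y z u w *v v) =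
    x * (v$1)\<^sup>2 + y * (v$2)\<^sup>2 + z * (v$3)\<^sup>2 + 2 * u * v$1 * v$3 + 2 * w * v$2 * v$3"
  by (simp add: inner_vec_def sum_3 matrix_vector_mult_def power2_eq_square algebra_simps)

text \<open>Completing squares in \<open>v$1\<close> and \<open>v$2\<close> leaves the Schur
  complement \<open>z - u\<^sup>2 / x - w\<^sup>2 / y\<close> as the coefficient of the square of
  \<open>v$3\<close>.\<close>

lemma smat_in_Omega [simp]:
  "smat x y z u w \<in> Omega \<longleftrightarrow> x > 0 \<and> y > 0 \<and> z - u\<^sup>2 / x - w\<^sup>2 / y > 0"
proof
  assume "smat x y z u w \<in> Omega"
  then have pos: "v \<bullet> (smat x y z u w *v v) > 0" if "v \<noteq> 0" for v
    using that by (simp add: Omega_def)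
  \<comment> \<open>The third test vector makes both completed squares vanish, so the form takes the
    value of the Schur complement there.\<close>
  have "vector [1, 0, 0] \<noteq> (0 :: real^3)" "vector [0, 1, 0] \<noteq> (0 :: real^3)"
    "vector [- u / x, - w / y, 1] \<noteq> (0 :: real^3)"
    by (simp_all add: vec_eq_iff forall_3)
  from this(1,2)[THEN pos] pos[OF this(3)] show "x > 0 \<and> y > 0 \<and> z - u\<^sup>2 / x - w\<^sup>2 / y > 0"
    by (auto simp: quadratic_form_smat power2_eq_square)
next
  assume *: "x > 0 \<and> y > 0 \<and> z - u\<^sup>2 / x - w\<^sup>2 / y > 0"
  have "v \<bullet> (smat x y z u w *v v) > 0" if v: "v \<noteq> 0" for v
  proof -
    have eq: "v \<bullet> (smat x y z u w *v v) = x * (v$1 + u / x * v$3)\<^sup>2 + y * (v$2 + w / y * v$3)\<^sup>2 +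
        (z - u\<^sup>2 / x - w\<^sup>2 / y) * (v$3)\<^sup>2"
      using * unfolding quadratic_form_smat by (simp add: power2_eq_square field_simps)
    have nonneg: "x * (v$1 + u / x * v$3)\<^sup>2 \<ge> 0" "y * (v$2 + w / y * v$3)\<^sup>2 \<ge> 0"
      "(z - u\<^sup>2 / x - w\<^sup>2 / y) * (v$3)\<^sup>2 \<ge> 0"
      using * by simp_all
    show ?thesis
    proof (cases "v$3 = 0")
      case True
      then have "v$1 \<noteq> 0 \<or> v$2 \<noteq> 0" using v by (auto simp: vec_eq_iff forall_3)
      then show ?thesis using True * unfolding eq by (auto intro: add_pos_nonneg add_nonneg_pos)
    next
      case False
      then have "(z - u\<^sup>2 / x - w\<^sup>2 / y) * (v$3)\<^sup>2 > 0" using * by simp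
      then show ?thesis using nonneg unfolding eq by linarith
    qed
  qed
  then show "smat x y z u w \<in> Omega" by (simp add: Omega_def)
qed

lemma OmegaE:
  assumes "A \<in> Omega"
  obtains x y z u w where "A = smat x y z u w" "x > 0" "y > 0" "z - u\<^sup>2 / x - w\<^sup>2 / y > 0"
proof -
  have "A \<in> V_space" using assms by (simp add: Omega_def)
  then obtain x y z u w where "A = smat x y z u w" unfolding V_space_iff by blast
  then show ?thesis using that assms by (metis smat_in_Omega)
qed

lemma Phi_hmat: "Phi (hmat a b f p q) = smat (a\<^sup>2) (b\<^sup>2) (p\<^sup>2 + q\<^sup>2 + f\<^sup>2) (a * p) (b * q)"
  by (simp add: Phi_def mat_eq_iff_3 mult_nth_3 transpose_nth power2_eq_square)

text \<open>Solves \<open>Phi_hmat\<close> for the entries of the factor; the square of the last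
  diagonal entry is the Schur complement.\<close>

definition chol :: "real^3^3 \<Rightarrow> real^3^3" where
  "chol A = hmat (sqrt (A$1$1)) (sqrt (A$2$2)) (sqrt (A$3$3 - (A$1$3)\<^sup>2 / A$1$1 - (A$2$3)\<^sup>2 / A$2$2))
     (A$1$3 / sqrt (A$1$1)) (A$2$3 / sqrt (A$2$2))"

lemma chol_smat: "chol (smat x y z u w) =
    hmat (sqrt x) (sqrt y) (sqrt (z - u\<^sup>2 / x - w\<^sup>2 / y)) (u / sqrt x) (w / sqrt y)"
  by (simp add: chol_def)

lemma Phi_in_Omega: "T \<in> H_group \<Longrightarrow> Phi T \<in> Omega"
  by (auto elim!: H_groupE simp: Phi_hmat power_mult_distrib)

lemma chol_Phi: "T \<in> H_group \<Longrightarrow> chol (Phi T) = T"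
  by (auto elim!: H_groupE simp: Phi_hmat chol_smat hmat_eq_iff power_mult_distrib)

lemma chol_in_H: "A \<in> Omega \<Longrightarrow> chol A \<in> H_group"
  by (auto elim!: OmegaE simp: chol_smat)

lemma Phi_chol: "A \<in> Omega \<Longrightarrow> Phi (chol A) = A"
  by (auto elim!: OmegaE simp: chol_smat Phi_hmat power_divide)

lemma Phi_inv_eq: "A \<in> Omega \<Longrightarrow> Phi_inv A = chol A"
  unfolding Phi_inv_def
  by (rule inv_into_f_eq) (auto intro!: inj_on_inverseI chol_Phi simp: Phi_chol chol_in_H)

lemma open_entry: "open {A :: real^'n^'m. A $ i $ j > 0}"
  by (intro open_Collect_less continuous_intros)

lemma linear_domain_H: "linear_domain h_algebra H_group"
proof
  have eq: "H_group = h_algebra \<inter> ({T. T$1$1 > 0} \<inter> {T. T$2$2 > 0} \<inter> {T. T$3$3 > 0})"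
    by (auto simp: H_group_def forall_3)
  show "openin (top_of_set h_algebra) H_group"
    by (subst eq) (intro openin_open_Int open_Int open_entry)
qed (rule subspace_h)

lemma linear_domain_Omega: "linear_domain V_space Omega"
proof
  \<comment> \<open>The Schur complement cleared of denominators, which on \<open>V_space\<close> is
    the determinant. As a polynomial it is continuous on all matrices.\<close>
  let ?U = "{A :: real^3^3. A$3$3 * A$1$1 * A$2$2 - (A$1$3)\<^sup>2 * A$2$2 - (A$2$3)\<^sup>2 * A$1$1 > 0}"
  have "z - u\<^sup>2 / x - w\<^sup>2 / y > 0 \<longleftrightarrow> z * x * y - u\<^sup>2 * y - w\<^sup>2 * x > 0" if "x > 0" "y > 0" for x y z u w :: real
  proof -
    have xy: "x * y > 0" using that by simp
    have eq: "z * x * y - u\<^sup>2 * y - w\<^sup>2 * x = (x * y) * (z - u\<^sup>2 / x - w\<^sup>2 / y)"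
      using that by (simp add: field_simps)
    show ?thesis unfolding eq using xy mult_pos_pos zero_less_mult_pos by blast
  qed
  then have smat: "smat x y z u w \<in> Omega \<longleftrightarrow> smat x y z u w \<in> {A. A$1$1 > 0} \<inter> {A. A$2$2 > 0} \<inter> ?U" for x y z u w
    by auto
  have "A \<in> Omega \<longleftrightarrow> A \<in> V_space \<and> A \<in> {A. A$1$1 > 0} \<inter> {A. A$2$2 > 0} \<inter> ?U" for A
  proof (cases "A \<in> V_space")
    case True
    then obtain x y z u w where "A = smat x y z u w" unfolding V_space_iff by blast
    then show ?thesis using smat[of x y z u w] True by blast
  qed (simp add: Omega_def)
  then have eq: "Omega = V_space \<inter> ({A. A$1$1 > 0} \<inter> {A. A$2$2 > 0} \<inter> ?U)"
    by blast
  have "open ?U"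
    by (intro open_Collect_less continuous_intros)
  then show "openin (top_of_set V_space) Omega"
    by (subst eq) (intro openin_open_Int open_Int open_entry; assumption)
qed (rule subspace_V)

interpretation H: linear_domain h_algebra H_group by (rule linear_domain_H)
interpretation \<Omega>: linear_domain V_space Omega by (rule linear_domain_Omega)

lemma bounded_linear_transpose: "bounded_linear (transpose :: real^'n^'m \<Rightarrow> real^'m^'n)"
  unfolding linear_conv_bounded_linear[symmetric]
  by (rule linearI) (simp_all add: vec_eq_iff transpose_def)

text \<open>Both maps are smooth by explicit formulas: \<open>Phi\<close> is a bilinear expression
  in \<open>T\<close>, and \<open>chol\<close> takes roots of, and quotients by, functions positive
  on \<open>Omega\<close>.\<close>

interpretation Phi: linear_diffeo h_algebra H_group V_space Omega Phi Phi_inv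
proof
  show "smooth_fun h_algebra H_group Phi"
    unfolding Phi_def[abs_def]
    by (rule H.smooth_bilinear[OF bounded_bilinear_matrix_mult H.smooth_id
          H.smooth_bounded_linear[OF bounded_linear_transpose H.smooth_id]])
  have "smooth_fun V_space Omega chol"
    unfolding chol_def[abs_def] power2_eq_square
    by (intro \<Omega>.smooth_hmat \<Omega>.smooth_sqrt \<Omega>.smooth_divide \<Omega>.smooth_diff \<Omega>.smooth_mult \<Omega>.smooth_nth \<Omega>.smooth_id)
      (auto elim!: OmegaE simp: power2_eq_square)
  then show "smooth_fun V_space Omega Phi_inv"
    by (rule \<Omega>.smooth_transform) (rule Phi_inv_eq)
qed (simp_all add: Phi_in_Omega Phi_inv_eq chol_in_H chol_Phi Phi_chol)

subsection \<open>The left-invariant frame and the two connections\<close>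

definition h_index :: "(3 \<times> 3) set" where
  "h_index = {(1, 1), (2, 2), (3, 3), (3, 1), (3, 2)}"

definition h_unit :: "3 \<times> 3 \<Rightarrow> real^3^3" where
  "h_unit ij = axis (fst ij) (axis (snd ij) 1)"

lemma h_unit_nth: "h_unit ij $ k $ l = (if (k, l) = ij then 1 else 0)"
  by (cases ij) (auto simp: h_unit_def axis_def)

lemma h_unit_hmat:
  "h_unit (1, 1) = hmat 1 0 0 0 0" "h_unit (2, 2) = hmat 0 1 0 0 0" "h_unit (3, 3) = hmat 0 0 1 0 0"
  "h_unit (3, 1) = hmat 0 0 0 1 0" "h_unit (3, 2) = hmat 0 0 0 0 1"
  by (simp_all add: mat_eq_iff_3 h_unit_nth)

lemma h_unit_in_h: "ij \<in> h_index \<Longrightarrow> h_unit ij \<in> h_algebra"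
  unfolding h_index_def by (elim insertE) (simp_all only: h_unit_hmat hmat_in_h empty_iff)

lemma sum_h_index: "(\<Sum>ij\<in>h_index. F ij) = F (1, 1) + F (2, 2) + F (3, 3) + F (3, 1) + (F (3, 2) :: 'a::comm_monoid_add)"
  by (simp add: h_index_def add_ac)

lemma h_expand:
  assumes "A \<in> h_algebra"
  shows "(\<Sum>ij\<in>h_index. (A $ fst ij $ snd ij) *\<^sub>R h_unit ij) = A"
  using assms
  by (elim h_algebraE) (simp add: sum_h_index h_unit_hmat hmat_scaleR hmat_add)

text \<open>The entries of the left-invariant Maurer-Cartan form, so that left-invariant fields have
  constant coefficients.\<close>

definition h_coframe :: "3 \<times> 3 \<Rightarrow> real^3^3 \<Rightarrow> real^3^3 \<Rightarrow> real" where
  "h_coframe ij T v = (matrix_inv T ** v) $ fst ij $ snd ij"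

abbreviation h_frame :: "3 \<times> 3 \<Rightarrow> real^3^3 \<Rightarrow> real^3^3" where
  "h_frame ij \<equiv> left_inv_field (h_unit ij)"

lemma smooth_matrix_inv: "smooth_fun h_algebra H_group matrix_inv"
proof -
  have eq: "matrix_inv T = hmat (1 / T$1$1) (1 / T$2$2) (1 / T$3$3) (- (T$3$1) / (T$1$1 * T$3$3))
      (- (T$3$2) / (T$2$2 * T$3$3))" if "T \<in> H_group" for T
    using that by (auto elim!: H_groupE simp: matrix_inv_hmat)
  have pos: "T $ i $ i > 0" if "T \<in> H_group" for T i
    using that by (simp add: H_group_def)
  have "smooth_fun h_algebra H_group (\<lambda>T. hmat (1 / T$1$1) (1 / T$2$2) (1 / T$3$3) (- (T$3$1) / (T$1$1 * T$3$3))
      (- (T$3$2) / (T$2$2 * T$3$3)))"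
    by (intro H.smooth_hmat H.smooth_divide H.smooth_const H.smooth_uminus H.smooth_mult H.smooth_nth H.smooth_id)
      (auto simp: pos)
  then show ?thesis by (rule H.smooth_transform) (rule eq)
qed

lemma left_inv_field_vfield:
  assumes A: "A \<in> h_algebra"
  shows "left_inv_field A \<in> vfields h_algebra H_group"
proof (rule H.vfieldsI)
  have "smooth_fun h_algebra H_group (\<lambda>T. T ** A)"
    by (rule H.smooth_bounded_linear[OF bounded_bilinear.bounded_linear_left[OF bounded_bilinear_matrix_mult] H.smooth_id])
  then show "smooth_fun h_algebra H_group (left_inv_field A)"
    by (rule H.smooth_transform) (simp add: left_inv_field_def)
qed (simp_all add: left_inv_field_def h_mult H_subset_h A)

lemma left_mult_expand:
  assumes "A \<in> h_algebra"
  shows "(\<Sum>ij\<in>h_index. (A $ fst ij $ snd ij) *\<^sub>R (T ** h_unit ij)) = T ** A"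
proof -
  have "T ** A = T ** (\<Sum>ij\<in>h_index. (A $ fst ij $ snd ij) *\<^sub>R h_unit ij)"
    by (simp add: h_expand assms)
  then show ?thesis
    by (simp add: bounded_bilinear.sum_right[OF bounded_bilinear_matrix_mult]
        bounded_bilinear.scaleR_right[OF bounded_bilinear_matrix_mult])
qed

lemma h_coframe_left_inv: "T \<in> H_group \<Longrightarrow> h_coframe ij T (left_inv_field A T) = A $ fst ij $ snd ij"
  by (simp add: h_coframe_def left_inv_field_def matrix_mul_assoc H_inv)

interpretation H: parallel_frame h_algebra H_group h_index h_frame h_coframe
proof (unfold_locales, goal_cases)
  case 1
  then show ?case by (simp add: h_index_def)
next
  case (2 i)
  then show ?case by (intro left_inv_field_vfield h_unit_in_h)
next
  case (3 i Y)
  then show ?case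
    unfolding h_coframe_def
    by (intro H.smooth_nth H.smooth_bilinear[OF bounded_bilinear_matrix_mult] smooth_matrix_inv H.vfield_smooth)
next
  case (4 i x u v)
  then show ?case by (simp add: h_coframe_def bounded_bilinear.add_right[OF bounded_bilinear_matrix_mult])
next
  case (5 i x v c)
  then show ?case by (simp add: h_coframe_def bounded_bilinear.scaleR_right[OF bounded_bilinear_matrix_mult])
next
  case (6 T v)
  then have "(\<Sum>ij\<in>h_index. h_coframe ij T v *\<^sub>R h_frame ij T) = T ** (matrix_inv T ** v)"
    using left_mult_expand[of "matrix_inv T ** v" T] h_mult[of "matrix_inv T" v] H_inv(1)
    by (simp add: h_coframe_def left_inv_field_def H_subset_h)
  then show ?case using 6 by (simp add: matrix_mul_assoc H_inv)
next
  case (7 i j T)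
  then show ?case by (auto simp: h_coframe_left_inv h_unit_nth)
qed

text \<open>A left translation maps the left-invariant frame to itself; \<open>push_conn\<close>
  then gives the left invariance of \<open>H.conn\<close>.\<close>

lemma left_translation_diffeo:
  assumes S: "S \<in> H_group"
  shows "frame_diffeo h_algebra H_group h_algebra H_group ((**) S) ((**) (matrix_inv S))
    h_index h_frame h_coframe h_frame h_coframe"
proof unfold_locales
  have bl: "bounded_linear ((**) A :: real^3^3 \<Rightarrow> real^3^3)" for A :: "real^3^3"
    by (rule bounded_bilinear.bounded_linear_right[OF bounded_bilinear_matrix_mult])
  show "smooth_fun h_algebra H_group ((**) S)" "smooth_fun h_algebra H_group ((**) (matrix_inv S))"
    using H.smooth_bounded_linear[OF bl H.smooth_id] by blast+
  fix ij T assume ij: "ij \<in> h_index" and T: "T \<in> H_group"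
  have "dirderiv ((**) S) T (h_frame ij T) = S ** h_frame ij T"
    by (rule H.dirderiv_eqI[OF bounded_linear.has_derivative[OF bl has_derivative_ident] T])
      (rule H.vfield_in[OF H.e_vfield[OF ij] T])
  then show "h_frame ij (S ** T) = dirderiv ((**) S) T (h_frame ij T)"
    using S T by (simp add: left_inv_field_def H_mult matrix_mul_assoc)
qed (use S in \<open>simp_all add: H_mult H_inv matrix_mul_assoc\<close>)

lemma conn_left_inv_field:
  assumes A: "A \<in> h_algebra" and B: "B \<in> h_algebra"
  shows "H.conn (left_inv_field A) (left_inv_field B) = (\<lambda>_. 0)"
proof (rule H.vfield_eqI)
  fix i T assume iT: "i \<in> h_index" "T \<in> H_group"
  have "dirderiv (\<lambda>T. h_coframe i T (left_inv_field B T)) T (left_inv_field A T) =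
      dirderiv (\<lambda>_. B $ fst i $ snd i) T (left_inv_field A T)"
    by (rule H.dirderiv_cong) (simp_all add: iT h_coframe_left_inv H.vfield_in left_inv_field_vfield A)
  then show "h_coframe i T (H.conn (left_inv_field A) (left_inv_field B) T) = h_coframe i T 0"
    by (simp add: iT A B H.coframe_conn left_inv_field_vfield H.coframe_0 dirderiv_def)
qed (simp_all add: A B H.conn_vfield left_inv_field_vfield H.vfield_zero)

text \<open>\<open>conn_unique\<close> decides the values on smooth fields and the normalising
  clause all others, so the description has exactly one solution.\<close>

lemma nabla_H_eq: "nabla_H = H.conn"
  unfolding nabla_H_def
proof (rule the_equality)
  have "left_invariant_connection H.conn"
    unfolding left_invariant_connection_def
    using frame_diffeo.push_conn[OF left_translation_diffeo] by blast
  then show "affine_connection h_algebra H_group H.conn \<and> left_invariant_connection H.conn \<and>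
      (\<forall>A\<in>h_algebra. \<forall>B\<in>h_algebra. H.conn (left_inv_field A) (left_inv_field B) = (\<lambda>_. 0)) \<and>
      (\<forall>X Y. X \<notin> vfields h_algebra H_group \<or> Y \<notin> vfields h_algebra H_group \<longrightarrow> H.conn X Y = (\<lambda>_. 0))"
    using H.affine_conn conn_left_inv_field H.conn_eq_0 by blast
  fix D assume D: "affine_connection h_algebra H_group D \<and> left_invariant_connection D \<and>
      (\<forall>A\<in>h_algebra. \<forall>B\<in>h_algebra. D (left_inv_field A) (left_inv_field B) = (\<lambda>_. 0)) \<and>
      (\<forall>X Y. X \<notin> vfields h_algebra H_group \<or> Y \<notin> vfields h_algebra H_group \<longrightarrow> D X Y = (\<lambda>_. 0))"
  show "D = H.conn"
  proof (rule ext, rule ext)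
    fix X Y
    show "D X Y = H.conn X Y"
    proof (cases "X \<in> vfields h_algebra H_group \<and> Y \<in> vfields h_algebra H_group")
      case True
      show ?thesis
        by (rule H.conn_unique) (use D True h_unit_in_h in auto)
    next
      case False
      then have "D X Y = (\<lambda>_. 0)" using D by blast
      moreover have "H.conn X Y = (\<lambda>_. 0)" using False by (intro H.conn_eq_0) blast
      ultimately show ?thesis by simp
    qed
  qed
qed

section \<open>Transport of the frame to the cone\<close>

abbreviation \<Omega>_frame :: "3 \<times> 3 \<Rightarrow> real^3^3 \<Rightarrow> real^3^3" where
  "\<Omega>_frame ij \<equiv> pushforward Phi H_group Omega (h_frame ij)"

abbreviation \<Omega>_coframe :: "3 \<times> 3 \<Rightarrow> real^3^3 \<Rightarrow> real^3^3 \<Rightarrow> real" where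
  "\<Omega>_coframe ij x v \<equiv> h_coframe ij (Phi_inv x) (dirderiv Phi_inv x v)"

interpretation Phi: frame_diffeo h_algebra H_group V_space Omega Phi Phi_inv
  h_index h_frame h_coframe \<Omega>_frame \<Omega>_coframe
  by (rule Phi.frame_diffeo_transport) (rule H.parallel_frame_axioms)

interpretation Phi_inv: frame_diffeo V_space Omega h_algebra H_group Phi_inv Phi
  h_index \<Omega>_frame \<Omega>_coframe h_frame h_coframe
  by (rule Phi.inverse_frame_diffeo)

text \<open>Naturality moves the pushforward by \<open>Phi\<close> inside the connection, where it
  cancels against the pushforward by \<open>Phi_inv\<close>.\<close>

lemma nabla_cv_eq:
  assumes U: "U \<in> vfields V_space Omega" and W: "W \<in> vfields V_space Omega"
  shows "nabla_cv U W = Phi.N.conn U W"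
proof -
  have "nabla_cv U W = pushforward Phi H_group Omega
     (H.conn (pushforward Phi_inv Omega H_group U) (pushforward Phi_inv Omega H_group W))"
    by (simp add: nabla_cv_def nabla_H_eq)
  also have "\<dots> = Phi.N.conn (pushforward Phi H_group Omega (pushforward Phi_inv Omega H_group U))
      (pushforward Phi H_group Omega (pushforward Phi_inv Omega H_group W))"
    by (rule Phi.push_conn) (simp_all add: Phi_inv.push_vfield U W)
  also have "\<dots> = Phi.N.conn U W"
    by (simp add: Phi_inv.push_push U W)
  finally show ?thesis .
qed

subsection \<open>Torsion\<close>

lemma Phi_deriv:
  assumes T: "T \<in> H_group" and v: "v \<in> h_algebra"
  shows "dirderiv Phi T v = T ** transpose v + v ** transpose T"
  unfolding Phi_def[abs_def]
  using H.dirderiv_eqI[OF bounded_bilinear.FDERIV[OF bounded_bilinear_matrix_mult has_derivative_ident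
        bounded_linear.has_derivative[OF bounded_linear_transpose has_derivative_ident]] T v] .

text \<open>With \<open>T\<close> the Cholesky factor and \<open>h\<close> the unit matrix, the
  frame field is \<open>T ** (h + transpose h) ** transpose T\<close>, the derivative of
  \<open>Phi\<close> in direction \<open>T ** h\<close>.\<close>

lemma \<Omega>_frame_smat:
  assumes "smat x y z u w \<in> Omega"
  shows "\<Omega>_frame (1, 1) (smat x y z u w) = smat (2 * x) 0 (2 * u\<^sup>2 / x) (2 * u) 0"
    and "\<Omega>_frame (3, 1) (smat x y z u w) =
      smat 0 0 (2 * (u / sqrt x) * sqrt (z - u\<^sup>2 / x - w\<^sup>2 / y)) (sqrt x * sqrt (z - u\<^sup>2 / x - w\<^sup>2 / y)) 0"
proof -
  have eq: "\<Omega>_frame ij (smat x y z u w) = chol (smat x y z u w) ** transpose (chol (smat x y z u w) ** h_unit ij) +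
      (chol (smat x y z u w) ** h_unit ij) ** transpose (chol (smat x y z u w))" if "ij \<in> h_index" for ij
    using that assms
    by (simp add: Phi.push_eq Phi_inv_eq left_inv_field_def chol_in_H Phi_deriv h_mult H_subset_h h_unit_in_h)
  have "(1, 1) \<in> h_index" "(3, 1) \<in> h_index" by (simp_all add: h_index_def)
  from this[THEN eq] assms
  show "\<Omega>_frame (1, 1) (smat x y z u w) = smat (2 * x) 0 (2 * u\<^sup>2 / x) (2 * u) 0"
    and "\<Omega>_frame (3, 1) (smat x y z u w) =
      smat 0 0 (2 * (u / sqrt x) * sqrt (z - u\<^sup>2 / x - w\<^sup>2 / y)) (sqrt x * sqrt (z - u\<^sup>2 / x - w\<^sup>2 / y)) 0"
    by (simp_all add: chol_smat mat_eq_iff_3 mult_nth_3 transpose_nth h_unit_nth power2_eq_square)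
qed

text \<open>The units at (1,1) and (3,1) do not commute. Parallelism of the frame reduces torsion to
  the bracket, and the two terms in its (1,3) entry come out as 1 and 2.\<close>

lemma not_torsion_free_nabla_cv: "\<not> torsion_free V_space Omega nabla_cv"
proof
  assume tf: "torsion_free V_space Omega nabla_cv"
  let ?X = "\<Omega>_frame (1, 1)" and ?Y = "\<Omega>_frame (3, 1)" and ?I = "smat 1 1 1 0 0"
  have ix: "(1, 1) \<in> h_index" "(3, 1) \<in> h_index" by (simp_all add: h_index_def)
  have X: "?X \<in> vfields V_space Omega" and Y: "?Y \<in> vfields V_space Omega"
    using ix by (simp_all add: Phi.N.e_vfield)
  have I: "?I \<in> Omega" by simp
  have "torsion nabla_cv ?X ?Y ?I = 0"
    using tf X Y I unfolding torsion_free_def by blast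
  then have "lie_bracket ?X ?Y ?I = 0"
    by (simp add: torsion_def nabla_cv_eq X Y Phi.N.conn_frame ix)
  then have bracket: "dirderiv ?Y ?I (?X ?I) $ 1 $ 3 = dirderiv ?X ?I (?Y ?I) $ 1 $ 3"
    by (simp add: lie_bracket_def)
  \<comment> \<open>The formulas for the frame hold on \<open>Omega\<close> only; inside
    \<open>dirderiv\<close> they may be replaced by an expression in the five entries.\<close>
  have entry: "dirderiv Z ?I v $ 1 $ 3 = dirderiv (\<lambda>A. g (A$1$1) (A$2$2) (A$3$3) (A$1$3) (A$2$3)) ?I v"
    if Z: "Z \<in> vfields V_space Omega" and v: "v \<in> V_space"
      and g: "\<And>x y z u w. smat x y z u w \<in> Omega \<Longrightarrow> Z (smat x y z u w) $ 1 $ 3 = g x y z u w" for Z v g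
  proof -
    have "dirderiv Z ?I v $ 1 $ 3 = dirderiv (\<lambda>A. Z A $ 1 $ 3) ?I v"
      by (rule \<Omega>.dirderiv_bounded_linear[OF bounded_linear_compose[OF bounded_linear_vec_nth bounded_linear_vec_nth]
            \<Omega>.vfield_diff_on[OF Z] I v, symmetric])
    also have "\<dots> = dirderiv (\<lambda>A. g (A$1$1) (A$2$2) (A$3$3) (A$1$3) (A$2$3)) ?I v"
    proof (rule \<Omega>.dirderiv_cong[OF I v])
      fix A assume A: "A \<in> Omega"
      then obtain x y z u w where "A = smat x y z u w" by (rule OmegaE)
      then show "Z A $ 1 $ 3 = g (A$1$1) (A$2$2) (A$3$3) (A$1$3) (A$2$3)" using g A by simp
    qed
    finally show ?thesis .
  qed
  have XI: "?X ?I = smat 2 0 0 0 0" and YI: "?Y ?I = smat 0 0 0 1 0"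
    using I by (simp_all add: \<Omega>_frame_smat)
  \<comment> \<open>Direction \<open>?X ?I\<close> changes only \<open>x\<close>, to
    \<open>1 + t * 2\<close>, and the (1,3) entry of \<open>?Y\<close> is then
    \<open>sqrt x\<close>.\<close>
  have "dirderiv ?Y ?I (?X ?I) $ 1 $ 3 = vector_derivative (\<lambda>t. sqrt (1 + t * 2)) (at 0)"
    unfolding XI
    by (subst entry[OF Y, where g = "\<lambda>x y z u w. sqrt x * sqrt (z - u\<^sup>2 / x - w\<^sup>2 / y)"])
      (simp_all add: \<Omega>_frame_smat dirderiv_def)
  also have "\<dots> = 1"
    by (rule vector_derivative_at)
      (auto intro!: derivative_eq_intros simp flip: has_real_derivative_iff_has_vector_derivative)
  finally have "dirderiv ?Y ?I (?X ?I) $ 1 $ 3 = 1" .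
  \<comment> \<open>Direction \<open>?Y ?I\<close> changes only \<open>u\<close>, to
    \<open>t\<close>, and the (1,3) entry of \<open>?X\<close> is \<open>2 * u\<close>.\<close>
  moreover have "dirderiv ?X ?I (?Y ?I) $ 1 $ 3 = vector_derivative (\<lambda>t. 2 * t) (at 0)"
    unfolding YI
    by (subst entry[OF X, where g = "\<lambda>x y z u w. 2 * u"]) (simp_all add: \<Omega>_frame_smat dirderiv_def)
  moreover have "vector_derivative (\<lambda>t::real. 2 * t) (at 0) = 2"
    by (rule vector_derivative_at)
      (auto intro!: derivative_eq_intros simp flip: has_real_derivative_iff_has_vector_derivative)
  ultimately show False using bracket by simp
qed

subsection \<open>Geodesics of the Cholesky-Vinberg connection\<close>

text \<open>A constant combination of \<open>h_frame\<close> fields is \<open>T ** A\<close>, where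
  \<open>A\<close> has the constants as entries; \<open>push_curve\<close> for \<open>Phi\<close>
  and \<open>Phi_inv\<close> carries the equation between cone and group.\<close>

lemma geodesic_nabla_cv_iff:
  "geodesic_on Omega nabla_cv {0..1} c \<longleftrightarrow>
    (\<exists>A\<in>h_algebra. \<exists>T. (\<forall>t\<in>{0..1}. T t \<in> H_group \<and> c t = Phi (T t) \<and>
       (T has_vector_derivative T t ** A) (at t within {0..1})))" (is "?L \<longleftrightarrow> ?R")
proof -
  have L: "?L \<longleftrightarrow> (\<exists>k. \<forall>t\<in>{0..1}. c t \<in> Omega \<and>
      (c has_vector_derivative (\<Sum>i\<in>h_index. k i *\<^sub>R \<Omega>_frame i (c t))) (at t within {0..1}))"
    using \<Omega>.geodesic_on_cong[of nabla_cv Phi.N.conn 0 1 c] nabla_cv_eq Phi.N.geodesic_on_iff[of 0 1 c] by simp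
  have frame_sum: "(\<Sum>i\<in>h_index. (A $ fst i $ snd i) *\<^sub>R h_frame i T) = T ** A"
    if "A \<in> h_algebra" "T \<in> H_group" for A T
    using left_mult_expand[OF that(1), of T] that(2) by (simp add: left_inv_field_def)
  show ?thesis
  proof
    assume ?L
    then obtain k where c: "\<And>t. t \<in> {0..1} \<Longrightarrow> c t \<in> Omega"
      "\<And>t. t \<in> {0..1} \<Longrightarrow> (c has_vector_derivative (\<Sum>i\<in>h_index. k i *\<^sub>R \<Omega>_frame i (c t))) (at t within {0..1})"
      unfolding L by blast
    define A where "A = (\<Sum>i\<in>h_index. k i *\<^sub>R h_unit i)"
    have A: "A \<in> h_algebra"
      unfolding A_def by (intro subspace_sum subspace_scale subspace_h h_unit_in_h)
    have "A $ fst i $ snd i = k i" if "i \<in> h_index" for i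
      using that unfolding h_index_def
      by (elim insertE) (simp_all add: A_def sum_h_index h_unit_hmat hmat_scaleR hmat_add)
    then have "(\<Sum>i\<in>h_index. k i *\<^sub>R h_frame i T) = T ** A" if "T \<in> H_group" for T
      using frame_sum[OF A that] by simp
    then have "((\<lambda>t. Phi_inv (c t)) has_vector_derivative Phi_inv (c t) ** A) (at t within {0..1})"
      if "t \<in> {0..1}" for t
      using Phi_inv.push_curve[OF c(2)[OF that] c(1) that] Phi.g_in[OF c(1)[OF that]] by simp
    then show ?R
      using A c(1) Phi.g_in Phi.f_g by (intro bexI[of _ A] exI[of _ "\<lambda>t. Phi_inv (c t)"]) auto
  next
    assume ?R
    then obtain A T where A: "A \<in> h_algebra" and T: "\<And>t. t \<in> {0..1} \<Longrightarrow> T t \<in> H_group"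
      "\<And>t. t \<in> {0..1} \<Longrightarrow> c t = Phi (T t)"
      "\<And>t. t \<in> {0..1} \<Longrightarrow> (T has_vector_derivative T t ** A) (at t within {0..1})"
      by blast
    have "c t \<in> Omega" and "(c has_vector_derivative (\<Sum>i\<in>h_index. (A $ fst i $ snd i) *\<^sub>R \<Omega>_frame i (c t))) (at t within {0..1})"
      if t: "t \<in> {0..1}" for t
    proof -
      show "c t \<in> Omega" using T(1,2)[OF t] Phi_in_Omega by simp
      have "(T has_vector_derivative (\<Sum>i\<in>h_index. (A $ fst i $ snd i) *\<^sub>R h_frame i (T t))) (at t within {0..1})"
        using T(3)[OF t] frame_sum[OF A T(1)[OF t]] by simp
      from Phi.push_curve[OF this T(1) t]
      have "((\<lambda>t. Phi (T t)) has_vector_derivative (\<Sum>i\<in>h_index. (A $ fst i $ snd i) *\<^sub>R \<Omega>_frame i (c t))) (at t within {0..1})"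
        by (simp add: T(2)[OF t])
      then show "(c has_vector_derivative (\<Sum>i\<in>h_index. (A $ fst i $ snd i) *\<^sub>R \<Omega>_frame i (c t))) (at t within {0..1})"
        by (rule has_vector_derivative_transform[OF t T(2), rotated])
    qed
    then show ?L unfolding L by (intro exI[of _ "\<lambda>i. A $ fst i $ snd i"]) blast
  qed
qed

text \<open>The lift of a geodesic from \<open>x\<close> is \<open>Tx\<close> times the exponentials
  of the multiples of some \<open>B\<close>. Ending at \<open>y\<close> means
  \<open>mat_exp B = mat_exp A\<close>, so \<open>B = A\<close> by injectivity.\<close>

lemma cv_path_geodesic:
  assumes x: "x \<in> Omega" and y: "y \<in> Omega"
  shows "geodesic_on Omega nabla_cv {0..1} (cv_path x y)" "cv_path x y 0 = x" "cv_path x y 1 = y"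
    and "geodesic_on Omega nabla_cv {0..1} c \<Longrightarrow> c 0 = x \<Longrightarrow> c 1 = y \<Longrightarrow> t \<in> {0..1} \<Longrightarrow> c t = cv_path x y t"
proof -
  define Tx Ty where "Tx = Phi_inv x" and "Ty = Phi_inv y"
  have Tx: "Tx \<in> H_group" "Phi Tx = x" and Ty: "Ty \<in> H_group" "Phi Ty = y"
    using x y Phi.g_in Phi.f_g by (simp_all add: Tx_def Ty_def)
  define A where "A = mat_log (matrix_inv Tx ** Ty)"
  have Q: "matrix_inv Tx ** Ty \<in> H_group" by (intro H_mult H_inv Tx Ty)
  have A: "A \<in> h_algebra" "mat_exp A = matrix_inv Tx ** Ty"
    using Q by (simp_all add: A_def mat_log_in_h mat_exp_log)
  have path: "cv_path x y t = Phi (Tx ** mat_exp (t *\<^sub>R A))" for t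
    by (simp add: cv_path_def mat_powr_def A_def Tx_def Ty_def)
  have exp_0: "mat_exp (0 *\<^sub>R A) = mat 1"
    using mat_exp_minus[OF A(1), of 0] mat_exp_hmat[of 0 0 0 0 0] A(1)
    by (auto elim!: h_algebraE simp: hmat_scaleR mat_exp_hmat hmat_1 simp del: scaleR_zero_left)
  show "cv_path x y 0 = x" unfolding path exp_0 by (simp add: Tx)
  show "cv_path x y 1 = y" unfolding path by (simp add: A matrix_mul_assoc H_inv Tx Ty)
  have "((\<lambda>t. Tx ** mat_exp (t *\<^sub>R A)) has_vector_derivative Tx ** mat_exp (t *\<^sub>R A) ** A) (at t within {0..1})" for t
    using bounded_linear.has_vector_derivative[OF
        bounded_bilinear.bounded_linear_right[OF bounded_bilinear_matrix_mult] mat_exp_has_derivative[OF A(1)]]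
    by (simp add: matrix_mul_assoc)
  then show "geodesic_on Omega nabla_cv {0..1} (cv_path x y)"
    unfolding geodesic_nabla_cv_iff path
    by (intro bexI[OF _ A(1)] exI[of _ "\<lambda>t. Tx ** mat_exp (t *\<^sub>R A)"] ballI conjI H_mult Tx mat_exp_in_H h_scaleR A refl)
  assume "geodesic_on Omega nabla_cv {0..1} c" and c: "c 0 = x" "c 1 = y" and t: "t \<in> {0..1}"
  then obtain B T where B: "B \<in> h_algebra" and T: "\<And>t. t \<in> {0..1} \<Longrightarrow> T t \<in> H_group"
    "\<And>t. t \<in> {0..1} \<Longrightarrow> c t = Phi (T t)"
    "\<And>t. t \<in> {0..1} \<Longrightarrow> (T has_vector_derivative T t ** B) (at t within {0..1})"
    unfolding geodesic_nabla_cv_iff by blast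
  \<comment> \<open>\<open>Phi\<close> is injective on \<open>H_group\<close>, so the end points of
    \<open>c\<close> determine those of the lift.\<close>
  have lift: "T s = Phi_inv (c s)" if "s \<in> {0..1}" for s
    using T(1,2)[OF that] Phi.g_f by simp
  have T0: "T 0 = Tx" and T1: "T 1 = Ty"
    using lift[of 0] lift[of 1] c by (simp_all add: Tx_def Ty_def)
  have curve: "T s = Tx ** mat_exp (s *\<^sub>R B)" if "s \<in> {0..1}" for s
    using one_parameter_curve_unique[OF B T(3) that] T0 by simp
  from curve[of 1] have "Ty = Tx ** mat_exp B" by (simp add: T1)
  then have "mat_exp B = mat_exp A"
    by (simp add: A matrix_mul_assoc H_inv Tx)
  then have "B = A" using mat_exp_inj B A(1) by blast
  then show "c t = cv_path x y t"
    using T(2)[OF t] curve[OF t] path by simp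
qed

theorem theorem6p5:
  shows "affine_connection V_space Omega nabla_cv
    \<and> flat_connection V_space Omega nabla_cv
    \<and> \<not> torsion_free V_space Omega nabla_cv
    \<and> (\<forall>x\<in>Omega. \<forall>y\<in>Omega.
          geodesic_on Omega nabla_cv {0..1} (cv_path x y)
        \<and> cv_path x y 0 = x \<and> cv_path x y 1 = y
        \<and> (\<forall>\<gamma>. geodesic_on Omega nabla_cv {0..1} \<gamma> \<and> \<gamma> 0 = x \<and> \<gamma> 1 = y
               \<longrightarrow> (\<forall>t\<in>{0..1}. \<gamma> t = cv_path x y t))
        \<and> cv_mean x y = cv_path x y (1/2))"
proof (intro conjI ballI allI impI)
  show "affine_connection V_space Omega nabla_cv"
    by (rule \<Omega>.affine_connection_cong[OF nabla_cv_eq Phi.N.affine_conn])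
  show "flat_connection V_space Omega nabla_cv"
    by (rule \<Omega>.flat_connection_cong[OF nabla_cv_eq Phi.N.affine_conn Phi.N.flat_conn])
  show "\<not> torsion_free V_space Omega nabla_cv"
    by (rule not_torsion_free_nabla_cv)
  fix x y assume x: "x \<in> Omega" and y: "y \<in> Omega"
  show "geodesic_on Omega nabla_cv {0..1} (cv_path x y)" "cv_path x y 0 = x" "cv_path x y 1 = y"
    by (rule cv_path_geodesic[OF x y])+
  show "\<gamma> t = cv_path x y t"
    if "geodesic_on Omega nabla_cv {0..1} \<gamma> \<and> \<gamma> 0 = x \<and> \<gamma> 1 = y" "t \<in> {0..1}" for \<gamma> t
    using cv_path_geodesic(4)[OF x y] that by blast
  show "cv_mean x y = cv_path x y (1/2)"
    by (simp add: cv_mean_def cv_path_def)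
qed

end
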